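(* Let $G$ be a connected, $d$-regular, Lichnerowicz-sharp graph. Let $G_{\mathrm{vis}}$ be its visible subgraph, and let $G'$ be the graph whose vertices are the connected components of $G_{\mathrm{vis}}$, two distinct components being adjacent iff some collapsed edge of $G$ has one endpoint in each. Then $G$ is an $H_r$-bundle whose base graph is $G'$, where $r\ge 1$ is the degree of $G_{\mathrm{vis}}$ (which is a regular graph), and this bundle admits a section. If $G$ has at least one collapsed edge, then $G'$ is a connected, regular graph satisfying $\mathrm{CD}(2,\infty)$ with $\lambda_1(G')>2$.
   Context: All graphs are simple, finite and unweighted. For $f:V(G)\to\mathbb{R}$ put $Lf(x)=\sum_{y\sim x}(f(y)-f(x))$. The eigenvalues of $-L$ on a connected graph are $0=\lambda_0<\lambda_1\le\lambda_2\le\cdots$, counted with multiplicity. The Bakry--Émery operators are $2\Gamma(f,g)=L(fg)-fLg-gLf$ and $2\Gamma_2(f,g)=L\Gamma(f,g)-\Gamma(f,Lg)-\Gamma(g,Lf)$, with $\Gamma(f)=\Gamma(f,f)$ and $\Gamma_2(f)=\Gamma_2(f,f)$. $G$ satisfies $\mathrm{CD}(K,\infty)$ if $\Gamma_2(f)(x)\ge K\,\Gamma(f)(x)$ for all $f:V(G)\to\mathbb{R}$ and all $x\in V(G)$. A connected graph $G$ is Lichnerowicz-sharp if it satisfies $\mathrm{CD}(2,\infty)$ and $\lambda_1(G)=2$. Let $E_2=\ker(L+2I)$. An edge $xy$ of $G$ is collapsed if $f(x)=f(y)$ for every $f\in E_2$, and visible otherwise. $G_{\mathrm{vis}}$ is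 the graph on $V(G)$ whose edges are the visible edges of $G$. $H_r$ is the $r$-dimensional hypercube: vertex set $\mathbb{F}_2^r$, two vertices adjacent iff they differ in exactly one coordinate. Graph bundles: given graphs $G',F$ and a map $\sigma$ assigning to each oriented edge $(x,y)$ of $G'$ an automorphism $\sigma_{xy}\in\operatorname{Aut}(F)$ with $\sigma_{yx}=\sigma_{xy}^{-1}$, the graph $G'\square_\sigma F$ has vertex set $V(G')\times V(F)$ and edges $(x,u)\sim(y,\sigma_{xy}(u))$ whenever $x\sim y$ in $G'$, and $(x,u)\sim(x,v)$ whenever $u\sim v$ in $F$. A graph is an $F$-bundle with base graph $G'$ if it is isomorphic to $G'\square_\sigma F$ for some such $\sigma$. A section of $G'\square_\sigma F$ is a graph homomorphism $s:G'\to G'\square_\sigma F$ with $\pi_1\circ s=\mathrm{id}$ on $V(G')$, where $\pi_1(x,u)=x$. *)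

theory Defs
  imports
    Complex_Main
    "HOL-Library.Function_Algebras"
    "HOL-Library.FuncSet"
    "HOL-Library.Multiset"
    "HOL-Library.Z2"
    "Graph_Theory.Graph_Theory"
begin

text \<open>
  A finite simple graph is a \<^locale>\<open>pair_graph\<close>: a finite, loop-free digraph without parallel
  arcs whose arc set is symmetric, an edge \<open>xy\<close> being the two arcs \<open>(x,y)\<close> and \<open>(y,x)\<close>.
\<close>

definition graph_connected :: "'a pair_pre_digraph \<Rightarrow> bool" where
  "graph_connected G \<longleftrightarrow> Digraph_Component.connected (with_proj G)"

definition graph_regular :: "'a pair_pre_digraph \<Rightarrow> nat \<Rightarrow> bool" where
  "graph_regular G d \<longleftrightarrow> (\<forall>x\<in>pverts G. out_degree (with_proj G) x = d)"

text \<open>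
  A function on the vertices is given by a total function on the ambient type; at vertices, the
  operators below only depend on its values at vertices.
\<close>

definition laplacian :: "'a pair_pre_digraph \<Rightarrow> ('a \<Rightarrow> real) \<Rightarrow> 'a \<Rightarrow> real" where
  "laplacian G f x = (\<Sum>y | (x, y) \<in> parcs G. f y - f x)"

definition bakry_gamma ::
  "'a pair_pre_digraph \<Rightarrow> ('a \<Rightarrow> real) \<Rightarrow> ('a \<Rightarrow> real) \<Rightarrow> 'a \<Rightarrow> real" where
  "bakry_gamma G f g x =
     (laplacian G (\<lambda>z. f z * g z) x - f x * laplacian G g x - g x * laplacian G f x) / 2"

definition bakry_gamma2 ::
  "'a pair_pre_digraph \<Rightarrow> ('a \<Rightarrow> real) \<Rightarrow> ('a \<Rightarrow> real) \<Rightarrow> 'a \<Rightarrow> real" where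
  "bakry_gamma2 G f g x =
     (laplacian G (bakry_gamma G f g) x
        - bakry_gamma G f (laplacian G g) x - bakry_gamma G g (laplacian G f) x) / 2"

definition CD_inf :: "'a pair_pre_digraph \<Rightarrow> real \<Rightarrow> bool" where
  "CD_inf G K \<longleftrightarrow>
     (\<forall>f. \<forall>x\<in>pverts G. bakry_gamma2 G f f x \<ge> K * bakry_gamma G f f x)"

text \<open>
  The kernel of \<open>L + cI\<close>. Functions are normalised to vanish off the vertex set, so that this
  is a linear copy of the corresponding space of functions on the vertices.
\<close>

definition lap_eigenspace :: "'a pair_pre_digraph \<Rightarrow> real \<Rightarrow> ('a \<Rightarrow> real) set" where
  "lap_eigenspace G c =
     {f. (\<forall>x\<in>pverts G. laplacian G f x + c * f x = 0) \<and> (\<forall>x. x \<notin> pverts G \<longrightarrow> f x = 0)}"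

interpretation fun_space: vector_space "\<lambda>(c::real) (f::'a \<Rightarrow> real) x. c * f x"
  by unfold_locales (auto simp: fun_eq_iff algebra_simps)

definition lap_eigenvalues :: "'a pair_pre_digraph \<Rightarrow> real set" where
  "lap_eigenvalues G = {c. \<exists>f\<in>lap_eigenspace G c. f \<noteq> (\<lambda>_. 0)}"

text \<open>
  The eigenvalues of \<open>-L\<close> in nondecreasing order, repeated according to multiplicity;
  \<open>lap_spectrum G ! k\<close> is \<open>\<lambda>\<^sub>k\<close>, which exists iff \<open>k < length (lap_spectrum G)\<close>.
  As \<open>-L\<close> is symmetric, the multiplicity is the dimension of the eigenspace.
\<close>

definition lap_spectrum :: "'a pair_pre_digraph \<Rightarrow> real list" where
  "lap_spectrum G = sorted_list_of_multiset
     (\<Sum>c\<in>lap_eigenvalues G. replicate_mset (fun_space.dim (lap_eigenspace G c)) c)"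

definition Lichnerowicz_sharp :: "'a pair_pre_digraph \<Rightarrow> bool" where
  "Lichnerowicz_sharp G \<longleftrightarrow>
     graph_connected G \<and> CD_inf G 2 \<and> 1 < length (lap_spectrum G) \<and> lap_spectrum G ! 1 = 2"

definition collapsed_arcs :: "'a pair_pre_digraph \<Rightarrow> ('a \<times> 'a) set" where
  "collapsed_arcs G = {(x, y) \<in> parcs G. \<forall>f\<in>lap_eigenspace G 2. f x = f y}"

definition vis_graph :: "'a pair_pre_digraph \<Rightarrow> 'a pair_pre_digraph" where
  "vis_graph G = \<lparr>pverts = pverts G, parcs = parcs G - collapsed_arcs G\<rparr>"

text \<open>
  The vertices are the connected components of the visible subgraph, given by their vertex sets;
  since that graph is symmetric, these are its strongly connected components.
\<close>

definition vis_quotient :: "'a pair_pre_digraph \<Rightarrow> 'a set pair_pre_digraph" where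
  "vis_quotient G =
     (let C = pre_digraph.sccs_verts (with_proj (vis_graph G)) in
      \<lparr>pverts = C,
       parcs = {(A, B). A \<in> C \<and> B \<in> C \<and> A \<noteq> B \<and> (\<exists>x\<in>A. \<exists>y\<in>B. (x, y) \<in> collapsed_arcs G)}\<rparr>)"

definition hypercube :: "nat \<Rightarrow> (nat \<Rightarrow> bit) pair_pre_digraph" where
  "hypercube r =
     \<lparr>pverts = {..<r} \<rightarrow>\<^sub>E UNIV,
      parcs = {(u, v). u \<in> {..<r} \<rightarrow>\<^sub>E UNIV \<and> v \<in> {..<r} \<rightarrow>\<^sub>E UNIV \<and>
                       card {i\<in>{..<r}. u i \<noteq> v i} = 1}\<rparr>"

definition graph_auts :: "'a pair_pre_digraph \<Rightarrow> ('a \<Rightarrow> 'a) set" where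
  "graph_auts F =
     {\<phi>. bij_betw \<phi> (pverts F) (pverts F) \<and>
         (\<forall>u\<in>pverts F. \<forall>v\<in>pverts F. (\<phi> u, \<phi> v) \<in> parcs F \<longleftrightarrow> (u, v) \<in> parcs F)}"

definition bundle_twist ::
  "'a pair_pre_digraph \<Rightarrow> 'b pair_pre_digraph \<Rightarrow> ('a \<Rightarrow> 'a \<Rightarrow> 'b \<Rightarrow> 'b) \<Rightarrow> bool" where
  "bundle_twist B F \<sigma> \<longleftrightarrow>
     (\<forall>(x, y)\<in>parcs B. \<sigma> x y \<in> graph_auts F \<and> (\<forall>u\<in>pverts F. \<sigma> y x (\<sigma> x y u) = u))"

definition graph_bundle ::
  "'a pair_pre_digraph \<Rightarrow> 'b pair_pre_digraph \<Rightarrow> ('a \<Rightarrow> 'a \<Rightarrow> 'b \<Rightarrow> 'b) \<Rightarrow> ('a \<times> 'b) pair_pre_digraph"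
  where
  "graph_bundle B F \<sigma> =
     \<lparr>pverts = pverts B \<times> pverts F,
      parcs = {((x, u), (y, \<sigma> x y u)) | x y u. (x, y) \<in> parcs B \<and> u \<in> pverts F}
            \<union> {((x, u), (x, v)) | x u v. x \<in> pverts B \<and> (u, v) \<in> parcs F}\<rparr>"

definition bundle_section ::
  "'a pair_pre_digraph \<Rightarrow> 'b pair_pre_digraph \<Rightarrow> ('a \<Rightarrow> 'a \<Rightarrow> 'b \<Rightarrow> 'b) \<Rightarrow> ('a \<Rightarrow> 'a \<times> 'b) \<Rightarrow> bool"
  where
  "bundle_section B F \<sigma> s \<longleftrightarrow>
     (\<forall>x\<in>pverts B. s x \<in> pverts (graph_bundle B F \<sigma>)) \<and>
     (\<forall>(x, y)\<in>parcs B. (s x, s y) \<in> parcs (graph_bundle B F \<sigma>)) \<and>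
     (\<forall>x\<in>pverts B. fst (s x) = x)"

lemma pair_graphI:
  assumes "finite V" "E \<subseteq> V \<times> V" "sym E" "irrefl E"
  shows "pair_graph \<lparr>pverts = V, parcs = E\<rparr>"
proof -
  have "finite E"
    using assms(1,2) by (meson finite_SigmaI finite_subset)
  then show ?thesis
    using assms by unfold_locales (auto simp: symmetric_def irrefl_def)
qed

lemma sym_collapsed_arcs:
  assumes "pair_graph G"
  shows "sym (collapsed_arcs G)"
proof (rule symI)
  interpret pair_graph G by fact
  fix x y
  assume "(x, y) \<in> collapsed_arcs G"
  then have "(x, y) \<in> parcs G" "\<forall>f\<in>lap_eigenspace G 2. f y = f x"
    by (auto simp: collapsed_arcs_def)
  moreover from this(1) have "(y, x) \<in> parcs G"
    using pair_sym_arcs unfolding symmetric_def with_proj_simps by (rule symD[rotated])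
  ultimately show "(y, x) \<in> collapsed_arcs G"
    by (simp add: collapsed_arcs_def)
qed

lemma pair_graph_vis_graph:
  assumes "pair_graph G"
  shows "pair_graph (vis_graph G)"
proof -
  interpret pair_graph G by fact
  have sym: "sym (parcs G)"
    using pair_sym_arcs by (simp add: symmetric_def)
  show ?thesis
    unfolding vis_graph_def
  proof (rule pair_graphI)
    show "finite (pverts G)" by (rule pair_finite_verts)
    show "parcs G - collapsed_arcs G \<subseteq> pverts G \<times> pverts G"
      using in_arcsD1 in_arcsD2 by auto
    show "sym (parcs G - collapsed_arcs G)"
      using sym sym_collapsed_arcs[OF assms] unfolding sym_def by blast
    show "irrefl (parcs G - collapsed_arcs G)"
      using pair_no_loops unfolding irrefl_def by fastforce
  qed
qed

lemma pair_graph_vis_quotient: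
  assumes "pair_graph G"
  shows "pair_graph (vis_quotient G)"
proof -
  interpret pair_graph G by fact
  have "pre_digraph.sccs_verts (with_proj (vis_graph G)) \<subseteq> Pow (pverts G)"
  proof (intro subsetI PowI)
    fix S x assume "S \<in> pre_digraph.sccs_verts (with_proj (vis_graph G))" "x \<in> S"
    then have "x \<rightarrow>\<^sup>*\<^bsub>with_proj (vis_graph G)\<^esub> x"
      unfolding pre_digraph.sccs_verts_def by blast
    then have "x \<in> pverts (vis_graph G)"
      unfolding with_proj_simps(1)[symmetric] by (rule reachable_in_vertsE)
    then show "x \<in> pverts G"
      by (simp add: vis_graph_def)
  qed
  then have "finite (pre_digraph.sccs_verts (with_proj (vis_graph G)))"
    by (rule finite_subset) (simp add: pair_finite_verts)
  then show ?thesis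
    unfolding vis_quotient_def Let_def
  proof (rule pair_graphI)
    let ?C = "pre_digraph.sccs_verts (with_proj (vis_graph G))"
    show "sym {(A, B). A \<in> ?C \<and> B \<in> ?C \<and> A \<noteq> B \<and>
        (\<exists>x\<in>A. \<exists>y\<in>B. (x, y) \<in> collapsed_arcs G)}" (is "sym ?E")
    proof (rule symI)
      fix A B
      assume "(A, B) \<in> ?E"
      then obtain x y where "A \<in> ?C" "B \<in> ?C" "A \<noteq> B" "x \<in> A" "y \<in> B"
        "(x, y) \<in> collapsed_arcs G"
        by blast
      moreover from this(6) have "(y, x) \<in> collapsed_arcs G"
        by (rule symD[OF sym_collapsed_arcs[OF assms]])
      ultimately show "(B, A) \<in> ?E"
        by blast
    qed
  qed (unfold irrefl_def, blast+)
qed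

lemma pair_graph_hypercube: "pair_graph (hypercube r)"
proof -
  have "(UNIV :: bit set) = {0, 1}"
  proof (intro equalityI subsetI)
    fix b :: bit
    show "b \<in> {0, 1}" by (cases b) simp_all
  qed simp
  then have "finite (UNIV :: bit set)"
    by (metis finite.emptyI finite.insertI)
  then show ?thesis
    unfolding hypercube_def
    by (intro pair_graphI finite_PiE) (auto simp: sym_def irrefl_def eq_commute)
qed

lemma pair_graph_graph_bundle:
  assumes "pair_graph B" "pair_graph F" "bundle_twist B F \<sigma>"
  shows "pair_graph (graph_bundle B F \<sigma>)"
proof -
  interpret B: pair_graph B by fact
  interpret F: pair_graph F by fact
  have B: "(y, x) \<in> parcs B" if "(x, y) \<in> parcs B" for x y
    using B.pair_sym_arcs that by (auto simp: symmetric_def sym_def)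
  have F: "(y, x) \<in> parcs F" if "(x, y) \<in> parcs F" for x y
    using F.pair_sym_arcs that by (auto simp: symmetric_def sym_def)
  have \<sigma>: "\<sigma> x y u \<in> pverts F" "\<sigma> y x (\<sigma> x y u) = u"
    if "(x, y) \<in> parcs B" "u \<in> pverts F" for x y u
  proof -
    have "\<sigma> x y \<in> graph_auts F \<and> (\<forall>u\<in>pverts F. \<sigma> y x (\<sigma> x y u) = u)"
      using assms(3) that(1) by (auto simp: bundle_twist_def)
    then show "\<sigma> x y u \<in> pverts F" "\<sigma> y x (\<sigma> x y u) = u"
      using that(2) by (auto simp: graph_auts_def bij_betw_def)
  qed
  show ?thesis
    unfolding graph_bundle_def
  proof (rule pair_graphI)
    show "sym ({((x, u), y, \<sigma> x y u) |x y u. (x, y) \<in> parcs B \<and> u \<in> pverts F} \<union>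
      {((x, u), x, v) |x u v. x \<in> pverts B \<and> (u, v) \<in> parcs F})"
    proof (rule symI, elim UnE)
      fix p q
      assume "(p, q) \<in> {((x, u), y, \<sigma> x y u) |x y u. (x, y) \<in> parcs B \<and> u \<in> pverts F}"
      then obtain x y u where "p = (x, u)" "q = (y, \<sigma> x y u)" "(x, y) \<in> parcs B" "u \<in> pverts F"
        by blast
      then have "q = (y, \<sigma> x y u) \<and> p = (x, \<sigma> y x (\<sigma> x y u)) \<and>
          (y, x) \<in> parcs B \<and> \<sigma> x y u \<in> pverts F"
        using B \<sigma> by simp
      then show "(q, p) \<in> {((x, u), y, \<sigma> x y u) |x y u. (x, y) \<in> parcs B \<and> u \<in> pverts F} \<union>
          {((x, u), x, v) |x u v. x \<in> pverts B \<and> (u, v) \<in> parcs F}"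
        by blast
    next
      fix p q
      assume "(p, q) \<in> {((x, u), x, v) |x u v. x \<in> pverts B \<and> (u, v) \<in> parcs F}"
      then show "(q, p) \<in> {((x, u), y, \<sigma> x y u) |x y u. (x, y) \<in> parcs B \<and> u \<in> pverts F} \<union>
          {((x, u), x, v) |x u v. x \<in> pverts B \<and> (u, v) \<in> parcs F}"
        using F by blast
    qed
  next
    show "finite (pverts B \<times> pverts F)"
      using B.pair_finite_verts F.pair_finite_verts by simp
    show "{((x, u), y, \<sigma> x y u) |x y u. (x, y) \<in> parcs B \<and> u \<in> pverts F} \<union>
        {((x, u), x, v) |x u v. x \<in> pverts B \<and> (u, v) \<in> parcs F}
        \<subseteq> (pverts B \<times> pverts F) \<times> (pverts B \<times> pverts F)"
      using \<sigma>(1) B.in_arcsD1 B.in_arcsD2 F.in_arcsD1 F.in_arcsD2 by blast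
    show "irrefl ({((x, u), y, \<sigma> x y u) |x y u. (x, y) \<in> parcs B \<and> u \<in> pverts F} \<union>
        {((x, u), x, v) |x u v. x \<in> pverts B \<and> (u, v) \<in> parcs F})"
      using B.pair_no_loops F.pair_no_loops unfolding irrefl_def by fastforce
  qed
qed

end

theory Submission
  imports Defs "HOL-Analysis.Function_Topology"
begin

text \<open>
  Let \<open>Lf = -2f\<close>. Under \<open>CD(2,\<infinity>)\<close> the function \<open>\<Gamma>(f)\<close> is subharmonic, and as the values of a
  Laplacian sum to zero, \<open>\<Gamma>\<^sub>2 - 2\<Gamma>\<close> vanishes at \<open>f\<close> at every vertex. This form is nonnegative, so
  \<open>f\<close> lies in its kernel. Pairing \<open>f\<close> with the indicator of a vertex \<open>z \<noteq> x\<close> gives the midpoint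
  rule (\<open>eigenfunction_midpoint\<close>): over the common neighbours of \<open>x\<close> and \<open>z\<close>, the mean of \<open>f\<close> is
  \<open>(f x + f z) / 2\<close>.

  Let \<open>c(x,z)\<close> be the number of common neighbours, and \<open>s(x,z)\<close> the sum of the squared deviations of
  \<open>f\<close> from the midpoint over them. Counting three-step walks with the midpoint rule gives a linear
  identity for the numbers \<open>c - 2\<close> at every edge (\<open>square_identity\<close>); weighted sums of it are
  \<open>\<Sum> c (c - 2) (f z - f x)\<^sup>2 = 0\<close> and \<open>\<Sum> (c - 2) s = 0\<close>. In the second sum no term is
  negative. Against the first one stands the lower bound for \<open>c\<close> that \<open>CD(2,\<infinity>)\<close> yields for a test
  function concentrated at a single neighbour (\<open>codegree_test\<close>). Together they force \<open>c = 2\<close> for the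
  ends of every two-step path on which \<open>f\<close> is not constant: such a path lies in exactly one
  quadrilateral, and opposite sides of it carry the same increment of \<open>f\<close> (\<open>visible_square\<close>).

  Choose \<open>f\<close> in the eigenspace such that it separates the ends of every visible edge. Completing squares
  moves the neighbours of a vertex across an edge and keeps the increments of \<open>f\<close>. Hence the visible
  degree is constant, and the number of lower neighbours is a height function, which rises by one
  along ascending visible edges and is constant along collapsed ones. Two lower neighbours of a
  vertex have a common lower neighbour, so that a component of the visible graph has one bottom; and
  sending a vertex to the set of vertices of height one below it identifies the component with the
  Boolean lattice over the neighbours of the bottom, which is a hypercube (\<open>boolean_and_determined\<close>,
  \<open>atoms_surj\<close>). Collapsed edges are transported along visible edges down to the bottoms. Therefore the
  collapsed edges between two adjacent components are the graph of an isomorphism, which maps bottom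
  to bottom: these isomorphisms are the twist of the bundle, and the bottoms form the section.

  Functions on the quotient lift to functions that are constant on the components, and lifting
  commutes with the Laplacian. So the curvature bound descends, and the eigenvalues of the quotient
  are eigenvalues of the graph. The lift of an eigenfunction for 2 would be constant on components, and
  constant along collapsed edges because the definition of a collapsed edge quantifies over the
  whole eigenspace; it would be constant, which is absurd.
\<close>

section \<open>The curvature form of a regular graph\<close>

lemma quadratic_nonneg_imp_linear_zero:
  fixes b c :: real
  assumes "\<And>t. 2 * t * b + c * t\<^sup>2 \<ge> 0"
  shows "b = 0"
proof (rule ccontr)
  assume b: "b \<noteq> 0"
  \<comment> \<open>a parameter small enough for the linear term to dominate\<close>
  define q where "q = b / (\<bar>c\<bar> + 1)"
  have b_eq: "b = q * (\<bar>c\<bar> + 1)"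
    by (simp add: q_def)
  have "q \<noteq> 0"
    using b b_eq by auto
  moreover have "2 * (- q) * b + c * (- q)\<^sup>2 = q\<^sup>2 * (c - 2 * (\<bar>c\<bar> + 1))"
    by (subst b_eq) (simp add: power2_eq_square algebra_simps)
  ultimately have "2 * (- q) * b + c * (- q)\<^sup>2 < 0"
    by (simp add: mult_pos_neg)
  then show False using assms[of "- q"] by simp
qed

text \<open>
  The arguments run on neighbourhoods instead of arcs, for the graph and later for its quotient.
\<close>

locale regular_nbrs =
  fixes V :: "'a set" and N :: "'a \<Rightarrow> 'a set" and d :: nat
  assumes finite_V: "finite V"
    and N_subset: "N x \<subseteq> V"
    and N_sym: "y \<in> N x \<Longrightarrow> x \<in> N y"
    and N_irrefl: "x \<notin> N x"
    and card_N: "x \<in> V \<Longrightarrow> card (N x) = d"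
begin

lemma finite_N [simp]: "finite (N x)"
  using N_subset finite_V by (rule finite_subset)

lemma in_V: "y \<in> N x \<Longrightarrow> x \<in> V" "y \<in> N x \<Longrightarrow> y \<in> V"
  using N_subset N_sym by blast+

definition codegree :: "'a \<Rightarrow> 'a \<Rightarrow> real" where
  "codegree x z = card (N x \<inter> N z)"

lemma codegree_sym: "codegree x z = codegree z x"
  by (simp add: codegree_def Int_commute)

lemma codegree_self: "x \<in> V \<Longrightarrow> codegree x x = d"
  by (simp add: codegree_def card_N)

lemma sum_edges_swap: "(\<Sum>x\<in>V. \<Sum>y\<in>N x. h x y) = (\<Sum>x\<in>V. \<Sum>y\<in>N x. h y x)"
proof -
  have *: "N x = {y. y \<in> V \<and> y \<in> N x}" for x
    using N_subset by blast
  have **: "N x = {y. y \<in> V \<and> x \<in> N y}" for x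
    using N_subset N_sym by blast
  have "(\<Sum>x\<in>V. \<Sum>y\<in>N x. h x y) = (\<Sum>x\<in>V. \<Sum>y | y \<in> V \<and> y \<in> N x. h x y)"
    by (intro sum.cong refl *)
  also have "\<dots> = (\<Sum>y\<in>V. \<Sum>x | x \<in> V \<and> y \<in> N x. h x y)"
    by (rule sum.swap_restrict) (fact finite_V)+
  also have "\<dots> = (\<Sum>y\<in>V. \<Sum>x\<in>N y. h x y)"
    by (intro sum.cong refl **[symmetric])
  finally show ?thesis .
qed

lemma sum_nbrs_swap:
  "(\<Sum>y\<in>N x. \<Sum>z\<in>N y \<inter> A. h y z) = (\<Sum>z\<in>V \<inter> A. \<Sum>y\<in>N x \<inter> N z. h y z)"
proof -
  have 1: "N y \<inter> A = {z. z \<in> V \<inter> A \<and> z \<in> N y}" for y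
    using N_subset by blast
  have 2: "N x \<inter> N z = {y. y \<in> N x \<and> z \<in> N y}" for z
    using N_sym by blast
  show ?thesis
    unfolding 1 2 by (rule sum.swap_restrict) (simp_all add: finite_V)
qed

lemma sum_nbrs_swap_local:
  "(\<Sum>w\<in>N x. \<Sum>z\<in>N w \<inter> N y. h w z) = (\<Sum>z\<in>N y. \<Sum>w\<in>N x \<inter> N z. h w z)"
proof -
  have "V \<inter> N y = N y"
    using N_subset by blast
  then show ?thesis
    using sum_nbrs_swap[where x = x and A = "N y" and h = h] by simp
qed

text \<open>
  Four times \<open>\<Gamma>\<^sub>2(g) - 2\<Gamma>(g)\<close> at \<open>x\<close>; the lemma \<open>bochner_formula\<close> below makes the connection.
\<close>

definition bochner :: "('a \<Rightarrow> real) \<Rightarrow> 'a \<Rightarrow> real" where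
  "bochner g x = (\<Sum>y\<in>N x. \<Sum>z\<in>N y. (g z - 2 * g y + g x)\<^sup>2)
     - (2 * real d + 4) * (\<Sum>y\<in>N x. (g y - g x)\<^sup>2) + 2 * (\<Sum>y\<in>N x. g y - g x)\<^sup>2"

text \<open>
  For an eigenfunction the form is the Laplacian of \<open>\<Gamma>(f)\<close> up to a factor, and a Laplacian sums to
  zero. In explicit terms, the triple sum regrouped by its middle vertex is determined by the sums of
  the squared increments and of \<open>f\<^sup>2\<close>.
\<close>

lemma sum_bochner_eigenfunction:
  assumes eig: "\<And>x. x \<in> V \<Longrightarrow> (\<Sum>y\<in>N x. f y - f x) = - 2 * f x"
  shows "(\<Sum>x\<in>V. bochner f x) = 0"
proof -
  let ?S = "\<lambda>x. \<Sum>y\<in>N x. (f y - f x)\<^sup>2"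
  have "(\<Sum>x\<in>V. \<Sum>y\<in>N x. \<Sum>z\<in>N y. (f z - 2 * f y + f x)\<^sup>2)
      = (\<Sum>y\<in>V. \<Sum>x\<in>N y. \<Sum>z\<in>N y. (f z - 2 * f y + f x)\<^sup>2)"
    using sum_edges_swap[of "\<lambda>x y. \<Sum>z\<in>N y. (f z - 2 * f y + f x)\<^sup>2"] by simp
  also have "\<dots> = (\<Sum>y\<in>V. 2 * real d * ?S y + 8 * (f y)\<^sup>2)"
  proof (rule sum.cong[OF refl])
    fix y assume y: "y \<in> V"
    have "(\<Sum>x\<in>N y. \<Sum>z\<in>N y. (f z - 2 * f y + f x)\<^sup>2)
        = (\<Sum>x\<in>N y. \<Sum>z\<in>N y. (f z - f y)\<^sup>2 + 2 * (f x - f y) * (f z - f y) + (f x - f y)\<^sup>2)"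
      by (intro sum.cong refl) (simp add: power2_eq_square algebra_simps)
    also have "\<dots> = (\<Sum>x\<in>N y. ?S y + 2 * (f x - f y) * (\<Sum>z\<in>N y. f z - f y) + real d * (f x - f y)\<^sup>2)"
      by (simp only: sum.distrib sum_distrib_left[symmetric] sum_constant card_N[OF y])
    also have "\<dots> = real d * ?S y + 2 * (\<Sum>z\<in>N y. f z - f y) * (\<Sum>z\<in>N y. f z - f y) + real d * ?S y"
      by (simp only: sum.distrib sum_distrib_left[symmetric] sum_distrib_right[symmetric])
        (simp add: card_N[OF y])
    also have "\<dots> = 2 * real d * ?S y + 8 * (f y)\<^sup>2"
      unfolding eig[OF y] by (simp add: power2_eq_square)
    finally show "(\<Sum>x\<in>N y. \<Sum>z\<in>N y. (f z - 2 * f y + f x)\<^sup>2) = 2 * real d * ?S y + 8 * (f y)\<^sup>2" .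
  qed
  finally have 1: "(\<Sum>x\<in>V. \<Sum>y\<in>N x. \<Sum>z\<in>N y. (f z - 2 * f y + f x)\<^sup>2)
      = 2 * real d * (\<Sum>x\<in>V. ?S x) + 8 * (\<Sum>x\<in>V. (f x)\<^sup>2)"
    by (simp add: sum.distrib sum_distrib_left)
  have "(\<Sum>x\<in>V. ?S x) = (\<Sum>x\<in>V. \<Sum>y\<in>N x. f y * (f y - f x) - f x * (f y - f x))"
    by (simp add: power2_eq_square algebra_simps)
  also have "\<dots> = (\<Sum>x\<in>V. \<Sum>y\<in>N x. f y * (f y - f x)) - (\<Sum>x\<in>V. \<Sum>y\<in>N x. f x * (f y - f x))"
    by (simp add: sum_subtractf)
  also have "\<dots> = (\<Sum>x\<in>V. \<Sum>y\<in>N x. f x * (f x - f y)) - (\<Sum>x\<in>V. \<Sum>y\<in>N x. f x * (f y - f x))"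
    by (subst sum_edges_swap) simp
  also have "\<dots> = (\<Sum>x\<in>V. - 2 * (f x * (\<Sum>y\<in>N x. f y - f x)))"
    by (simp add: sum_subtractf[symmetric] sum_distrib_left algebra_simps sum_negf[symmetric])
  also have "\<dots> = (\<Sum>x\<in>V. 4 * (f x)\<^sup>2)"
    by (intro sum.cong refl) (simp add: eig power2_eq_square)
  finally have 2: "(\<Sum>x\<in>V. ?S x) = 4 * (\<Sum>x\<in>V. (f x)\<^sup>2)"
    by (simp add: sum_distrib_left)
  have "(\<Sum>x\<in>V. bochner f x) = (\<Sum>x\<in>V. \<Sum>y\<in>N x. \<Sum>z\<in>N y. (f z - 2 * f y + f x)\<^sup>2)
      - (2 * real d + 4) * (\<Sum>x\<in>V. ?S x) + 2 * (\<Sum>x\<in>V. (\<Sum>y\<in>N x. f y - f x)\<^sup>2)"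
    by (simp add: bochner_def sum.distrib sum_subtractf sum_distrib_left)
  also have "(\<Sum>x\<in>V. (\<Sum>y\<in>N x. f y - f x)\<^sup>2) = (\<Sum>x\<in>V. 4 * (f x)\<^sup>2)"
    by (intro sum.cong refl) (simp add: eig power2_eq_square)
  finally show ?thesis
    unfolding 1 2 by (simp add: sum_distrib_left[symmetric] algebra_simps)
qed

text \<open>
  The linear coefficient is the polar form at \<open>f\<close> and the indicator of \<open>z\<close>. If \<open>z\<close> is not adjacent
  to \<open>x\<close>, it only sees the two-step paths from \<open>x\<close> to \<open>z\<close>. If it is adjacent, the further terms
  cancel by the eigenvalue equations at \<open>x\<close> and \<open>z\<close>.
\<close>

lemma bochner_perturb:
  assumes x: "x \<in> V" and xz: "x \<noteq> z"
    and eig: "\<And>x. x \<in> V \<Longrightarrow> (\<Sum>y\<in>N x. f y - f x) = - 2 * f x"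
  shows "\<exists>c. \<forall>t. bochner (\<lambda>v. f v + (if v = z then t else 0)) x
      = bochner f x + 2 * t * (\<Sum>y\<in>N x \<inter> N z. f z - 2 * f y + f x) + c * t\<^sup>2"
proof -
  let ?e = "\<lambda>v. (if v = z then 1 else 0)::real"
  define c where "c = bochner ?e x"
  let ?cross = "(\<Sum>y\<in>N x. \<Sum>u\<in>N y. (f u - 2 * f y + f x) * (?e u - 2 * ?e y + ?e x))
     - (2 * real d + 4) * (\<Sum>y\<in>N x. (f y - f x) * (?e y - ?e x))
     + 2 * (\<Sum>y\<in>N x. f y - f x) * (\<Sum>y\<in>N x. ?e y - ?e x)"
  have cross: "?cross = (\<Sum>y\<in>N x \<inter> N z. f z - 2 * f y + f x)"
  proof -
    have e: "?e x = 0" using xz by simp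
    have "(\<Sum>y\<in>N x. \<Sum>u\<in>N y. (f u - 2 * f y + f x) * (?e u - 2 * ?e y + ?e x))
      = (\<Sum>y\<in>N x. \<Sum>u\<in>N y. (f u - 2 * f y + f x) * ?e u)
       - 2 * (\<Sum>y\<in>N x. ?e y * (\<Sum>u\<in>N y. (f u - 2 * f y + f x)))"
    proof -
      have "(f u - 2 * f y + f x) * (?e u - 2 * ?e y + ?e x)
          = (f u - 2 * f y + f x) * ?e u - 2 * (?e y * (f u - 2 * f y + f x))" for u y
        unfolding e by algebra
      then show ?thesis
        by (simp only: sum_subtractf sum_distrib_left[symmetric])
    qed
    also have "(\<Sum>y\<in>N x. \<Sum>u\<in>N y. (f u - 2 * f y + f x) * ?e u)
      = (\<Sum>y\<in>N x. if y \<in> N z then f z - 2 * f y + f x else 0)"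
    proof (rule sum.cong[OF refl])
      fix y assume "y \<in> N x"
      have "(\<Sum>u\<in>N y. (f u - 2 * f y + f x) * ?e u)
          = (\<Sum>u\<in>N y. if u = z then f z - 2 * f y + f x else 0)"
        by (intro sum.cong) auto
      also have "\<dots> = (if z \<in> N y then f z - 2 * f y + f x else 0)"
        by (simp add: sum.delta)
      also have "\<dots> = (if y \<in> N z then f z - 2 * f y + f x else 0)"
        using N_sym by auto
      finally show "(\<Sum>u\<in>N y. (f u - 2 * f y + f x) * ?e u)
          = (if y \<in> N z then f z - 2 * f y + f x else 0)" .
    qed
    also have "\<dots> = (\<Sum>y\<in>N x \<inter> N z. f z - 2 * f y + f x)"
      by (simp add: sum.inter_restrict)
    also have "(\<Sum>y\<in>N x. ?e y * (\<Sum>u\<in>N y. (f u - 2 * f y + f x)))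
      = (\<Sum>y\<in>N x. if y = z then (\<Sum>u\<in>N z. (f u - 2 * f z + f x)) else 0)"
      by (intro sum.cong) auto
    also have "\<dots> = (if z \<in> N x then (\<Sum>u\<in>N z. (f u - 2 * f z + f x)) else 0)"
      by (simp add: sum.delta)
    finally have 1: "(\<Sum>y\<in>N x. \<Sum>u\<in>N y. (f u - 2 * f y + f x) * (?e u - 2 * ?e y + ?e x))
      = (\<Sum>y\<in>N x \<inter> N z. f z - 2 * f y + f x)
        - 2 * (if z \<in> N x then (\<Sum>u\<in>N z. (f u - 2 * f z + f x)) else 0)" .
    have "(\<Sum>y\<in>N x. (f y - f x) * (?e y - ?e x)) = (\<Sum>y\<in>N x. if y = z then f z - f x else 0)"
      unfolding e by (intro sum.cong) auto
    then have 2: "(\<Sum>y\<in>N x. (f y - f x) * (?e y - ?e x)) = (if z \<in> N x then f z - f x else 0)"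
      by (simp add: sum.delta)
    have "(\<Sum>y\<in>N x. ?e y - ?e x) = (\<Sum>y\<in>N x. ?e y)"
      unfolding e by simp
    then have 3: "(\<Sum>y\<in>N x. ?e y - ?e x) = (if z \<in> N x then 1 else 0)"
      by (simp add: sum.delta)
    show ?thesis
    proof (cases "z \<in> N x")
      case True
      then have z: "z \<in> V" using in_V by blast
      have "(\<Sum>u\<in>N z. (f u - 2 * f z + f x)) = (\<Sum>u\<in>N z. f u - f z) + (\<Sum>u\<in>N z. f x - f z)"
        unfolding sum.distrib[symmetric] by (intro sum.cong) auto
      then have "(\<Sum>u\<in>N z. (f u - 2 * f z + f x)) = - 2 * f z + real d * (f x - f z)"
        using eig[OF z] by (simp add: card_N[OF z])
      then show ?thesis
        using True unfolding 1 2 3 eig[OF x] by (simp add: algebra_simps)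
    qed (simp add: 1 2 3)
  qed
  have "bochner (\<lambda>v. f v + (if v = z then t else 0)) x
      = bochner f x + 2 * t * (\<Sum>y\<in>N x \<inter> N z. f z - 2 * f y + f x) + c * t\<^sup>2" for t
  proof -
    have g: "f v + (if v = z then t else 0) = f v + t * ?e v" for v
      by simp
    have 1: "(\<Sum>y\<in>N x. \<Sum>u\<in>N y. ((f u + t * ?e u) - 2 * (f y + t * ?e y) + (f x + t * ?e x))\<^sup>2)
      = (\<Sum>y\<in>N x. \<Sum>u\<in>N y. (f u - 2 * f y + f x)\<^sup>2)
        + 2 * t * (\<Sum>y\<in>N x. \<Sum>u\<in>N y. (f u - 2 * f y + f x) * (?e u - 2 * ?e y + ?e x))
        + t\<^sup>2 * (\<Sum>y\<in>N x. \<Sum>u\<in>N y. (?e u - 2 * ?e y + ?e x)\<^sup>2)"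
    proof -
      have "((f u + t * ?e u) - 2 * (f y + t * ?e y) + (f x + t * ?e x))\<^sup>2
        = (f u - 2 * f y + f x)\<^sup>2 + 2 * t * ((f u - 2 * f y + f x) * (?e u - 2 * ?e y + ?e x))
          + t\<^sup>2 * (?e u - 2 * ?e y + ?e x)\<^sup>2" for u y
        unfolding power2_eq_square by algebra
      then show ?thesis
        by (simp only: sum.distrib sum_distrib_left)
    qed
    have 2: "(\<Sum>y\<in>N x. ((f y + t * ?e y) - (f x + t * ?e x))\<^sup>2)
      = (\<Sum>y\<in>N x. (f y - f x)\<^sup>2) + 2 * t * (\<Sum>y\<in>N x. (f y - f x) * (?e y - ?e x))
        + t\<^sup>2 * (\<Sum>y\<in>N x. (?e y - ?e x)\<^sup>2)"
    proof -
      have "((f y + t * ?e y) - (f x + t * ?e x))\<^sup>2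
        = (f y - f x)\<^sup>2 + 2 * t * ((f y - f x) * (?e y - ?e x)) + t\<^sup>2 * (?e y - ?e x)\<^sup>2" for y
        unfolding power2_eq_square by algebra
      then show ?thesis
        by (simp only: sum.distrib sum_distrib_left)
    qed
    have 3: "(\<Sum>y\<in>N x. (f y + t * ?e y) - (f x + t * ?e x))
      = (\<Sum>y\<in>N x. f y - f x) + t * (\<Sum>y\<in>N x. ?e y - ?e x)"
    proof -
      have "(f y + t * ?e y) - (f x + t * ?e x) = (f y - f x) + t * (?e y - ?e x)" for y
        by algebra
      then show ?thesis
        by (simp only: sum.distrib sum_distrib_left)
    qed
    show ?thesis
      unfolding g bochner_def c_def 1 2 3 cross[symmetric] by (simp only: power2_eq_square) algebra
  qed
  then show ?thesis by blast
qed

text \<open>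
  The form is nonnegative at every vertex and sums to zero at \<open>f\<close>, so \<open>f\<close> minimises it at each vertex
  and the derivative in the direction of a vertex \<open>z\<close> vanishes.
\<close>

lemma eigenfunction_midpoint:
  assumes CD: "\<And>g x. x \<in> V \<Longrightarrow> bochner g x \<ge> 0"
    and eig: "\<And>x. x \<in> V \<Longrightarrow> (\<Sum>y\<in>N x. f y - f x) = - 2 * f x"
    and xz: "x \<noteq> z"
  shows "(\<Sum>w\<in>N x \<inter> N z. f w) = codegree x z * (f x + f z) / 2"
proof (cases "x \<in> V")
  case True
  have "bochner f x = 0"
    using sum_nonneg_eq_0_iff[OF finite_V, of "bochner f"] sum_bochner_eigenfunction[of f] eig CD True
    by blast
  moreover obtain c where c: "\<And>t. bochner (\<lambda>v. f v + (if v = z then t else 0)) x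
      = bochner f x + 2 * t * (\<Sum>y\<in>N x \<inter> N z. f z - 2 * f y + f x) + c * t\<^sup>2"
    using bochner_perturb[OF True xz eig] by blast
  ultimately have "2 * t * (\<Sum>y\<in>N x \<inter> N z. f z - 2 * f y + f x) + c * t\<^sup>2 \<ge> 0" for t
    using CD[OF True, of "\<lambda>v. f v + (if v = z then t else 0)"] by simp
  then have "(\<Sum>y\<in>N x \<inter> N z. f z - 2 * f y + f x) = 0"
    by (rule quadratic_nonneg_imp_linear_zero)
  then show ?thesis
    by (simp add: sum.distrib sum_subtractf sum_distrib_left codegree_def algebra_simps)
next
  case False
  then have "N x = {}" using in_V by blast
  then show ?thesis by (simp add: codegree_def)
qed

end

section \<open>Common neighbours and two-step paths\<close>

locale midpoint_function = regular_nbrs +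
  fixes f :: "'a \<Rightarrow> real"
  assumes eig: "x \<in> V \<Longrightarrow> (\<Sum>y\<in>N x. f y - f x) = - 2 * f x"
    and midpoint: "x \<noteq> z \<Longrightarrow> (\<Sum>w\<in>N x \<inter> N z. f w) = codegree x z * (f x + f z) / 2"
begin

lemma sum_nbrs: "x \<in> V \<Longrightarrow> (\<Sum>y\<in>N x. f y) = (real d - 2) * f x"
  using eig[of x] by (simp add: sum_subtractf card_N algebra_simps)

text \<open>
  The quantities \<open>R\<close> and \<open>Q\<close> of the proof sum \<open>f\<close> over the three-step walks from \<open>x\<close> to \<open>y\<close>, at the
  second and at the third vertex. Cutting the walks at the third or at the second vertex and applying
  the midpoint rule expresses each of the two through the other one; the linear system determines \<open>Q\<close>.
\<close>

lemma square_identity: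
  assumes xy: "y \<in> N x"
  shows "(\<Sum>z\<in>N y - {x}. (codegree x z - 2) * (3 * f z - f x - 2 * f y)) = 0"
proof -
  have x: "x \<in> V" and y: "y \<in> V" and yx: "x \<in> N y"
    using xy in_V N_sym by auto
  \<comment> \<open>the midpoint rule, with its error for \<open>z = x\<close>\<close>
  have mid: "(\<Sum>w\<in>N x \<inter> N z. f w) = codegree x z * (f x + f z) / 2 - (if z = x then 2 * f x else 0)"
    if "x \<in> V" for x z
    using that midpoint[of x z] sum_nbrs[of x] by (auto simp: codegree_self algebra_simps)
  \<comment> \<open>three-step walks from \<open>x\<close> to \<open>y\<close>: their number, and the sums of \<open>f\<close> over their second and third vertices\<close>
  define T where "T = (\<Sum>z\<in>N y. codegree x z)"
  define R where "R = (\<Sum>z\<in>N y. \<Sum>w\<in>N x \<inter> N z. f w)"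
  define Q where "Q = (\<Sum>z\<in>N y. codegree x z * f z)"
  have T': "(\<Sum>w\<in>N x. codegree w y) = T"
    using sum_nbrs_swap_local[where x = x and y = y and h = "\<lambda>_ _. 1 :: real"] by (simp add: T_def codegree_def)
  have R': "R = (\<Sum>w\<in>N x. codegree w y * f w)"
    unfolding R_def sum_nbrs_swap_local[where x = x and y = y and h = "\<lambda>w _. f w", symmetric]
    by (simp add: codegree_def)
  have Q': "Q = (\<Sum>w\<in>N x. \<Sum>z\<in>N w \<inter> N y. f z)"
    unfolding Q_def sum_nbrs_swap_local[where x = x and y = y and h = "\<lambda>_ z. f z"]
    by (simp add: codegree_def)
  have "R = (\<Sum>z\<in>N y. codegree x z * f x / 2 + codegree x z * f z / 2 - (if z = x then 2 * f x else 0))"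
    unfolding R_def by (intro sum.cong refl) (simp add: mid[OF x] algebra_simps)
  also have "\<dots> = T * f x / 2 + Q / 2 - 2 * f x"
    using yx by (simp add: T_def Q_def sum.distrib sum_subtractf sum_divide_distrib sum_distrib_right)
  finally have 1: "R = T * f x / 2 + Q / 2 - 2 * f x" .
  have "Q = (\<Sum>w\<in>N x. codegree w y * f y / 2 + codegree w y * f w / 2 - (if w = y then 2 * f y else 0))"
    unfolding Q'
  proof (intro sum.cong refl)
    fix w assume "w \<in> N x"
    then have "w \<in> V" using in_V by blast
    then show "(\<Sum>z\<in>N w \<inter> N y. f z) = codegree w y * f y / 2 + codegree w y * f w / 2 - (if w = y then 2 * f y else 0)"
      by (subst mid) (auto simp: algebra_simps)
  qed
  also have "\<dots> = T * f y / 2 + R / 2 - 2 * f y"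
    using xy by (simp add: T'[symmetric] R' sum.distrib sum_subtractf sum_divide_distrib sum_distrib_right)
  finally have 2: "Q = T * f y / 2 + R / 2 - 2 * f y" .
  have "(\<Sum>z\<in>N y. (codegree x z - 2) * (3 * f z - f x - 2 * f y))
      = (\<Sum>z\<in>N y. 3 * (codegree x z * f z) - codegree x z * f x - 2 * codegree x z * f y - 6 * f z + 2 * f x + 4 * f y)"
    by (intro sum.cong refl) (simp add: algebra_simps)
  also have "\<dots> = 3 * Q - T * f x - 2 * T * f y - 6 * ((real d - 2) * f y) + real d * (2 * f x) + real d * (4 * f y)"
    by (simp add: T_def Q_def sum.distrib sum_subtractf sum_distrib_left sum_distrib_right
        sum_nbrs[OF y, symmetric] card_N[OF y])
  finally have 3: "(\<Sum>z\<in>N y. (codegree x z - 2) * (3 * f z - f x - 2 * f y))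
      = 3 * Q - T * f x - 2 * T * f y - 6 * ((real d - 2) * f y) + real d * (2 * f x) + real d * (4 * f y)" .
  have "(\<Sum>z\<in>N y - {x}. (codegree x z - 2) * (3 * f z - f x - 2 * f y))
      = (\<Sum>z\<in>N y. (codegree x z - 2) * (3 * f z - f x - 2 * f y)) - (real d - 2) * (2 * f x - 2 * f y)"
    by (simp add: sum_diff1 yx codegree_self[OF x])
  moreover have "3 * Q = T * f x + 2 * (T * f y) - 4 * f x - 8 * f y"
    using 1 2 by linarith
  ultimately show ?thesis
    unfolding 3 by (simp add: algebra_simps)
qed

abbreviation pair_sum :: "('a \<Rightarrow> 'a \<Rightarrow> real) \<Rightarrow> real" where
  "pair_sum h \<equiv> (\<Sum>x\<in>V. \<Sum>z\<in>V - {x}. h x z)"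

definition spread :: "'a \<Rightarrow> 'a \<Rightarrow> real" where
  "spread x z = (\<Sum>w\<in>N x \<inter> N z. (f w - (f x + f z) / 2)\<^sup>2)"

lemma sum_square_identity:
  assumes "x \<in> V"
  shows "(\<Sum>z\<in>V - {x}. (codegree x z - 2) * (\<Sum>y\<in>N x \<inter> N z. c y * (3 * f z - f x - 2 * f y))) = 0"
proof -
  have "(\<Sum>z\<in>V \<inter> - {x}. \<Sum>y\<in>N x \<inter> N z. c y * ((codegree x z - 2) * (3 * f z - f x - 2 * f y)))
      = (\<Sum>y\<in>N x. \<Sum>z\<in>N y \<inter> - {x}. c y * ((codegree x z - 2) * (3 * f z - f x - 2 * f y)))"
    by (rule sum_nbrs_swap[symmetric])
  also have "\<dots> = (\<Sum>y\<in>N x. c y * (\<Sum>z\<in>N y - {x}. (codegree x z - 2) * (3 * f z - f x - 2 * f y)))"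
    by (simp add: sum_distrib_left Diff_eq)
  also have "\<dots> = 0"
    by (simp add: square_identity)
  finally show ?thesis
    by (simp add: sum_distrib_left Diff_eq mult_ac)
qed

lemma sum_increments:
  "x \<noteq> z \<Longrightarrow> (\<Sum>w\<in>N x \<inter> N z. f w - (f x + f z) / 2) = 0"
  using midpoint[of x z] by (simp add: sum_subtractf codegree_def)

text \<open>
  Summed over the edges at \<open>x\<close> with equal weights, \<open>square_identity\<close> says that \<open>f\<close> is harmonic for the
  weights \<open>c (c - 2)\<close>, which may be negative.
\<close>

lemma codegree_harmonic:
  assumes x: "x \<in> V"
  shows "(\<Sum>z\<in>V - {x}. codegree x z * (codegree x z - 2) * (f z - f x)) = 0"
proof -
  have "(\<Sum>y\<in>N x \<inter> N z. 1 * (3 * f z - f x - 2 * f y)) = 2 * (codegree x z * (f z - f x))"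
    if "z \<in> V - {x}" for z
    using that midpoint[of x z, OF not_sym]
    by (simp add: sum.distrib sum_subtractf sum_distrib_left codegree_def field_simps)
  then have "(\<Sum>z\<in>V - {x}. (codegree x z - 2) * (\<Sum>y\<in>N x \<inter> N z. 1 * (3 * f z - f x - 2 * f y)))
      = (\<Sum>z\<in>V - {x}. 2 * (codegree x z * (codegree x z - 2) * (f z - f x)))"
    by (intro sum.cong refl) (simp only: mult_ac)
  also have "\<dots> = 2 * (\<Sum>z\<in>V - {x}. codegree x z * (codegree x z - 2) * (f z - f x))"
    by (rule sum_distrib_left[symmetric])
  finally have "(\<Sum>z\<in>V - {x}. (codegree x z - 2) * (\<Sum>y\<in>N x \<inter> N z. 1 * (3 * f z - f x - 2 * f y)))
      = 2 * (\<Sum>z\<in>V - {x}. codegree x z * (codegree x z - 2) * (f z - f x))" .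
  then show ?thesis
    using sum_square_identity[OF x, of "\<lambda>_. 1"] by simp
qed

lemma pair_sum_swap: "pair_sum h = pair_sum (\<lambda>x z. h z x)"
proof -
  have 1: "V - {x} = {z. z \<in> V \<and> z \<noteq> x}" for x :: 'a
    by auto
  have 2: "V - {x} = {z. z \<in> V \<and> x \<noteq> z}" for x :: 'a
    by auto
  have "pair_sum h = (\<Sum>x\<in>V. \<Sum>z | z \<in> V \<and> z \<noteq> x. h x z)"
    by (intro sum.cong refl 1)
  also have "\<dots> = (\<Sum>z\<in>V. \<Sum>x | x \<in> V \<and> z \<noteq> x. h x z)"
    by (rule sum.swap_restrict) (fact finite_V)+
  also have "\<dots> = pair_sum (\<lambda>x z. h z x)"
    by (intro sum.cong refl 2[symmetric])
  finally show ?thesis .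
qed

text \<open>
  Summation by parts in \<open>codegree_harmonic\<close>.
\<close>

lemma codegree_sum_distances: "pair_sum (\<lambda>x z. codegree x z * (codegree x z - 2) * (f z - f x)\<^sup>2) = 0"
proof -
  have 0: "pair_sum (\<lambda>x z. f x * (codegree x z * (codegree x z - 2) * (f z - f x))) = 0"
    by (simp add: sum_distrib_left[symmetric] codegree_harmonic)
  have "pair_sum (\<lambda>x z. f z * (codegree x z * (codegree x z - 2) * (f z - f x)))
      = pair_sum (\<lambda>x z. f x * (codegree z x * (codegree z x - 2) * (f x - f z)))"
    by (rule pair_sum_swap)
  also have "\<dots> = pair_sum (\<lambda>x z. - (f x * (codegree x z * (codegree x z - 2) * (f z - f x))))"
    by (intro sum.cong refl) (simp add: codegree_sym algebra_simps)
  also have "\<dots> = 0"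
    using 0 by (simp add: sum_negf)
  finally have "pair_sum (\<lambda>x z. f z * (codegree x z * (codegree x z - 2) * (f z - f x))
        - f x * (codegree x z * (codegree x z - 2) * (f z - f x))) = 0"
    using 0 by (simp add: sum_subtractf)
  then show ?thesis
    by (simp add: power2_eq_square left_diff_distrib[symmetric] mult_ac)
qed

text \<open>
  Here the increment along the edge serves as weight in \<open>square_identity\<close>. With \<open>D = f z - f x\<close> and \<open>u\<close>
  the deviation of \<open>f y\<close> from the midpoint, the summand is \<open>D\<^sup>2 + D u - 2u\<^sup>2\<close>, and the sum of \<open>u\<close> over
  the common neighbours vanishes.
\<close>

lemma codegree_sum_spread: "pair_sum (\<lambda>x z. (codegree x z - 2) * spread x z) = 0"
proof -
  have inner: "(\<Sum>y\<in>N x \<inter> N z. (f y - f x) * (3 * f z - f x - 2 * f y))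
      = codegree x z * (f z - f x)\<^sup>2 - 2 * spread x z" if "x \<noteq> z" for x z
  proof -
    have "(\<Sum>y\<in>N x \<inter> N z. (f y - f x) * (3 * f z - f x - 2 * f y))
      = (\<Sum>y\<in>N x \<inter> N z. (f z - f x)\<^sup>2 + (f z - f x) * (f y - (f x + f z) / 2)
          - 2 * (f y - (f x + f z) / 2)\<^sup>2)"
      by (intro sum.cong refl) (simp add: power2_eq_square field_simps)
    also have "\<dots> = codegree x z * (f z - f x)\<^sup>2
        + (f z - f x) * (\<Sum>y\<in>N x \<inter> N z. f y - (f x + f z) / 2) - 2 * spread x z"
      by (simp only: sum.distrib sum_subtractf sum_distrib_left[symmetric] spread_def codegree_def sum_constant)
    finally show ?thesis
      unfolding sum_increments[OF that] by simp
  qed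
  have "0 = pair_sum (\<lambda>x z. (codegree x z - 2) * (\<Sum>y\<in>N x \<inter> N z. (f y - f x) * (3 * f z - f x - 2 * f y)))"
    using sum_square_identity[of _ "\<lambda>y. f y - f _"] by simp
  also have "\<dots> = pair_sum (\<lambda>x z. codegree x z * (codegree x z - 2) * (f z - f x)\<^sup>2 - 2 * ((codegree x z - 2) * spread x z))"
    by (intro sum.cong refl) (subst inner, auto simp: algebra_simps)
  also have "\<dots> = 0 - 2 * pair_sum (\<lambda>x z. (codegree x z - 2) * spread x z)"
    by (simp only: sum_subtractf sum_distrib_left[symmetric] codegree_sum_distances)
  finally show ?thesis by simp
qed

lemma spread_nonneg: "spread x z \<ge> 0"
  by (simp add: spread_def sum_nonneg)

lemma spread_eq_0_iff: "spread x z = 0 \<longleftrightarrow> (\<forall>w\<in>N x \<inter> N z. f w = (f x + f z) / 2)"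
  unfolding spread_def by (subst sum_nonneg_eq_0_iff) auto

lemma codegree_cases:
  obtains "N x \<inter> N z = {}" "codegree x z = 0" | w where "N x \<inter> N z = {w}" "codegree x z = 1" | "codegree x z \<ge> 2"
proof -
  have "card (N x \<inter> N z) = 0 \<or> card (N x \<inter> N z) = 1 \<or> card (N x \<inter> N z) \<ge> 2"
    by linarith
  then show thesis
  proof (elim disjE)
    assume "card (N x \<inter> N z) = 1"
    then show thesis using that(2) by (metis card_1_singletonE codegree_def of_nat_1)
  qed (use that in \<open>auto simp: codegree_def\<close>)
qed

text \<open>
  A single common neighbour sits at the midpoint. Hence the terms of \<open>codegree_sum_spread\<close> with
  \<open>c < 2\<close> vanish, and none is negative.
\<close>

lemma spread_zero_if_codegree_ne_2:
  assumes xz: "x \<noteq> z" and codegree: "codegree x z \<noteq> 2"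
  shows "spread x z = 0"
proof (cases "x \<in> V \<and> z \<in> V")
  case True
  have small: "spread a b = 0" if "codegree a b < 2" "a \<noteq> b" for a b
    using codegree_cases[of a b]
  proof cases
    case (2 w)
    then show ?thesis
      using sum_increments[OF \<open>a \<noteq> b\<close>] by (simp add: spread_def)
  qed (use that in \<open>auto simp: spread_def\<close>)
  have nonneg: "(codegree a b - 2) * spread a b \<ge> 0" if "a \<noteq> b" for a b
    using small[OF _ that] spread_nonneg[of a b] by (cases "codegree a b < 2") auto
  have "(\<Sum>b\<in>V - {a}. (codegree a b - 2) * spread a b) \<ge> 0" for a
    by (intro sum_nonneg nonneg) auto
  then have "(\<Sum>b\<in>V - {x}. (codegree x b - 2) * spread x b) = 0"
    using codegree_sum_spread finite_V True by (subst (asm) sum_nonneg_eq_0_iff) auto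
  moreover have "(codegree x b - 2) * spread x b \<ge> 0" if "b \<in> V - {x}" for b
    using nonneg that by auto
  ultimately have "(codegree x z - 2) * spread x z = 0"
    using True xz finite_V by (subst (asm) sum_nonneg_eq_0_iff) auto
  then show ?thesis using codegree by simp
next
  case False
  then have "N x \<inter> N z = {}" using in_V by blast
  then show ?thesis by (simp add: spread_def)
qed

lemma off_midpoint_partner:
  assumes xz: "x \<noteq> z" and w: "w \<in> N x \<inter> N z" and off: "f w \<noteq> (f x + f z) / 2"
  obtains w' where "w' \<noteq> w" "N x \<inter> N z = {w, w'}" "f w + f w' = f x + f z"
proof -
  have "spread x z \<noteq> 0"
    using w off spread_eq_0_iff by blast
  then have "codegree x z = 2"
    using spread_zero_if_codegree_ne_2[OF xz] by blast
  then have card: "card (N x \<inter> N z) = 2"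
    by (simp add: codegree_def)
  then obtain a b where ab: "N x \<inter> N z = {a, b}" "a \<noteq> b"
    by (auto simp: card_2_iff)
  with w obtain w' where w': "N x \<inter> N z = {w, w'}" "w' \<noteq> w"
    by auto
  moreover have "f w + f w' = f x + f z"
    using midpoint[OF xz] w' \<open>codegree x z = 2\<close> by simp
  ultimately show thesis using that by blast
qed

text \<open>
  Among the triangles on which \<open>f\<close> is not constant take one with the least sum of values, and let
  \<open>f a \<le> f b \<le> f c\<close>. Then \<open>c\<close> is off the midpoint of \<open>a\<close> and \<open>b\<close>, so these have exactly one further
  common neighbour, whose value \<open>f a + f b - f c\<close> makes a triangle with a smaller sum.
\<close>

lemma triangles_flat:
  assumes "b \<in> N a" "c \<in> N a" "c \<in> N b"
  shows "f a = f b"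
proof -
  define bad where "bad = {(a, b, c). b \<in> N a \<and> c \<in> N a \<and> c \<in> N b \<and> f a \<le> f b \<and> f b \<le> f c \<and> f a < f c}"
  have "bad \<subseteq> V \<times> V \<times> V"
    using in_V by (auto simp: bad_def)
  then have fin: "finite bad"
    using finite_V by (meson finite_SigmaI finite_subset)
  have "bad = {}"
  proof (rule ccontr)
    assume "bad \<noteq> {}"
    then obtain t where t: "t \<in> bad"
      and min: "\<And>t'. t' \<in> bad \<Longrightarrow> (\<lambda>(a, b, c). f a + f b + f c) t \<le> (\<lambda>(a, b, c). f a + f b + f c) t'"
      using ex_is_arg_min_if_finite[OF fin, of "\<lambda>(a, b, c). f a + f b + f c"]
      unfolding is_arg_min_linorder by blast
    obtain a b c where abc: "t = (a, b, c)" by (cases t)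
    have t': "b \<in> N a" "c \<in> N a" "c \<in> N b" "f a \<le> f b" "f b \<le> f c" "f a < f c"
      using t unfolding abc bad_def by auto
    have "a \<noteq> b" using t' N_irrefl by blast
    moreover have "f c \<noteq> (f a + f b) / 2"
    proof
      assume "f c = (f a + f b) / 2"
      then show False using t'(4-6) by (simp add: field_simps)
    qed
    ultimately obtain c' where c': "c' \<noteq> c" "N a \<inter> N b = {c, c'}" "f c + f c' = f a + f b"
      using off_midpoint_partner[of a b c] t' by blast
    have "(c', a, b) \<in> bad"
      using c' t' N_sym by (auto simp: bad_def)
    from min[OF this] show False
      using c' t' abc by simp
  qed
  then have *: "f a = f b \<and> f b = f c"
    if "b \<in> N a" "c \<in> N a" "c \<in> N b" "f a \<le> f b" "f b \<le> f c" for a b c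
    using that by (force simp: bad_def)
  have n: "a \<in> N b" "a \<in> N c" "b \<in> N c"
    using assms N_sym by auto
  consider "f a \<le> f b" "f b \<le> f c" | "f a \<le> f c" "f c \<le> f b" | "f b \<le> f a" "f a \<le> f c"
    | "f b \<le> f c" "f c \<le> f a" | "f c \<le> f a" "f a \<le> f b" | "f c \<le> f b" "f b \<le> f a"
    using linear[of "f a" "f b"] linear[of "f b" "f c"] linear[of "f a" "f c"] by blast
  then show ?thesis
  proof cases
    case 1 then show ?thesis using *[of b a c] assms n by simp
  next
    case 2 then show ?thesis using *[of c a b] assms n by simp
  next
    case 3 then show ?thesis using *[of a b c] assms n by simp
  next
    case 4 then show ?thesis using *[of c b a] assms n by simp
  next
    case 5 then show ?thesis using *[of a c b] assms n by simp
  next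
    case 6 then show ?thesis using *[of b c a] assms n by simp
  qed
qed


text \<open>
  The test function is 1 at \<open>y\<close>, 0 at \<open>x\<close> and its other neighbours, and at each further neighbour
  \<open>z\<close> of \<open>y\<close> it takes the value \<open>2 / c(x,z)\<close>, which minimises the form.
\<close>

lemma codegree_test:
  assumes CD: "\<And>g x. x \<in> V \<Longrightarrow> bochner g x \<ge> 0"
    and xy: "y \<in> N x" and no_triangle: "N x \<inter> N y = {}"
  shows "(\<Sum>z\<in>N y - {x}. 2 - 4 / codegree x z) \<ge> 0"
proof -
  have x: "x \<in> V" and y: "y \<in> V" and yx: "x \<in> N y" and ne: "x \<noteq> y"
    using xy in_V N_sym N_irrefl by auto
  define g where "g v = (if v = y then 1 else if v \<in> N y \<and> v \<noteq> x then 2 / codegree x v else 0)" for v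
  have gx: "g x = 0" and gy: "g y = 1"
    using ne by (auto simp: g_def)
  have gN: "g v = (if v = y then 1 else 0)" if "v \<in> N x" for v
    using that no_triangle by (auto simp: g_def)
  have col: "(\<Sum>v\<in>N x \<inter> N z. (g z - 2 * g v + g x)\<^sup>2)
      = (if z = x then 4 else 0) + (if z \<in> N y - {x} then 4 - 4 / codegree x z else 0)"
    if "z \<in> V" for z
  proof -
    have "(\<Sum>v\<in>N x \<inter> N z. (g z - 2 * g v + g x)\<^sup>2)
        = (\<Sum>v\<in>N x \<inter> N z. (if v = y then (g z - 2)\<^sup>2 - (g z)\<^sup>2 else 0) + (g z)\<^sup>2)"
      by (intro sum.cong refl) (auto simp: gN gx)
    also have "\<dots> = (if y \<in> N z then (g z - 2)\<^sup>2 - (g z)\<^sup>2 else 0) + codegree x z * (g z)\<^sup>2"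
      using xy by (simp add: sum.distrib codegree_def)
    finally have eq: "(\<Sum>v\<in>N x \<inter> N z. (g z - 2 * g v + g x)\<^sup>2)
        = (if y \<in> N z then (g z - 2)\<^sup>2 - (g z)\<^sup>2 else 0) + codegree x z * (g z)\<^sup>2" .
    consider "z = x" | "z = y" | "z \<noteq> x" "z \<noteq> y" "z \<in> N y" | "z \<noteq> x" "z \<noteq> y" "z \<notin> N y"
      by blast
    then show ?thesis
    proof cases
      case 1
      then show ?thesis unfolding eq using xy by (simp add: gx)
    next
      case 2
      then show ?thesis unfolding eq using no_triangle ne N_irrefl by (simp add: codegree_def)
    next
      case 3
      then have yz: "y \<in> N z" using N_sym by blast
      then have "codegree x z \<noteq> 0"
        using xy by (auto simp: codegree_def)
      moreover have "g z = 2 / codegree x z"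
        using 3 by (simp add: g_def)
      ultimately show ?thesis unfolding eq using 3 yz by (simp add: power2_eq_square field_simps)
    next
      case 4
      then have "y \<notin> N z" using N_sym by blast
      then show ?thesis unfolding eq using 4 by (simp add: g_def)
    qed
  qed
  have "(\<Sum>v\<in>N x. \<Sum>z\<in>N v. (g z - 2 * g v + g x)\<^sup>2)
      = (\<Sum>z\<in>V. \<Sum>v\<in>N x \<inter> N z. (g z - 2 * g v + g x)\<^sup>2)"
    using sum_nbrs_swap[where x = x and A = UNIV and h = "\<lambda>v z. (g z - 2 * g v + g x)\<^sup>2"] by simp
  also have "\<dots> = (\<Sum>z\<in>V. (if z = x then 4 else 0) + (if z \<in> N y - {x} then 4 - 4 / codegree x z else 0))"
    by (intro sum.cong refl col)
  also have "\<dots> = 4 + (\<Sum>z\<in>V \<inter> (N y - {x}). 4 - 4 / codegree x z)"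
    unfolding sum.inter_restrict[OF finite_V] using x finite_V by (simp add: sum.distrib)
  also have "V \<inter> (N y - {x}) = N y - {x}"
    using N_subset by blast
  finally have 1: "(\<Sum>v\<in>N x. \<Sum>z\<in>N v. (g z - 2 * g v + g x)\<^sup>2)
      = 4 + (\<Sum>z\<in>N y - {x}. 4 - 4 / codegree x z)" .
  have 2: "(\<Sum>v\<in>N x. (g v - g x)\<^sup>2) = 1" "(\<Sum>v\<in>N x. g v - g x) = 1"
  proof -
    have "(\<Sum>v\<in>N x. (g v - g x)\<^sup>2) = (\<Sum>v\<in>N x. if v = y then 1 else 0)"
      "(\<Sum>v\<in>N x. g v - g x) = (\<Sum>v\<in>N x. if v = y then 1 else 0)"
      by (intro sum.cong refl; simp add: gN gx)+
    then show "(\<Sum>v\<in>N x. (g v - g x)\<^sup>2) = 1" "(\<Sum>v\<in>N x. g v - g x) = 1"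
      using xy by simp_all
  qed
  have d: "real d = card (N y - {x}) + 1"
    using card_Suc_Diff1[OF finite_N yx] card_N[OF y] by simp
  have "(\<Sum>z\<in>N y - {x}. 4 - 4 / codegree x z) = (\<Sum>z\<in>N y - {x}. 2 - 4 / codegree x z) + 2 * card (N y - {x})"
    by (simp add: sum_subtractf)
  then show ?thesis
    using CD[OF x, of g] unfolding bochner_def 1 2 d by simp
qed


text \<open>
  Weighting \<open>codegree_test\<close> by the squared increments of \<open>f\<close> and inserting that the spread vanishes
  unless \<open>c = 2\<close> gives \<open>\<Sum> (c - 2) D\<^sup>2 \<ge> 0\<close> over the pairs with \<open>c \<ge> 1\<close>, where \<open>D = f z - f x\<close>.
  Twice this sum, subtracted from \<open>\<Sum> c (c - 2) D\<^sup>2 = 0\<close>, leaves \<open>\<Sum> (c - 2)\<^sup>2 D\<^sup>2 \<le> 0\<close>.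
\<close>

lemma codegree_2_if_distinct_values:
  assumes CD: "\<And>g x. x \<in> V \<Longrightarrow> bochner g x \<ge> 0"
    and fxz: "f x \<noteq> f z" and w: "w \<in> N x \<inter> N z"
  shows "codegree x z = 2"
proof -
  \<comment> \<open>the summand of the weighted \<open>codegree_test\<close>, regrouped by the ends of the two-step path\<close>
  define h where "h x z = (2 - 4 / codegree x z) * (\<Sum>y\<in>N x \<inter> N z. (f y - f x)\<^sup>2)" for x z
  have "0 \<le> (\<Sum>x\<in>V. \<Sum>y\<in>N x. (f y - f x)\<^sup>2 * (\<Sum>z\<in>N y - {x}. 2 - 4 / codegree x z))"
  proof (intro sum_nonneg)
    fix x y assume y: "y \<in> N x"
    show "0 \<le> (f y - f x)\<^sup>2 * (\<Sum>z\<in>N y - {x}. 2 - 4 / codegree x z)"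
    proof (cases "f y = f x")
      case False
      then have "N x \<inter> N y = {}"
        using triangles_flat[OF y] by auto
      then show ?thesis
        using codegree_test[OF CD y] by simp
    qed simp
  qed
  also have "\<dots> = (\<Sum>x\<in>V. \<Sum>y\<in>N x. \<Sum>z\<in>N y \<inter> - {x}. (2 - 4 / codegree x z) * (f y - f x)\<^sup>2)"
    by (simp add: sum_distrib_left Diff_eq mult.commute)
  also have "\<dots> = pair_sum h"
    unfolding sum_nbrs_swap by (simp add: h_def sum_distrib_left Diff_eq)
  finally have h: "0 \<le> pair_sum h" .
  have eq: "codegree x z * (codegree x z - 2) * (f z - f x)\<^sup>2 - 4 * h x z
      = (if codegree x z = 0 then 0 else ((codegree x z - 2) * (f z - f x))\<^sup>2)" if "x \<noteq> z" for x z
  proof -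
    have "(\<Sum>y\<in>N x \<inter> N z. (f y - f x)\<^sup>2) = (\<Sum>y\<in>N x \<inter> N z.
        ((f z - f x) / 2)\<^sup>2 + (f z - f x) * (f y - (f x + f z) / 2) + (f y - (f x + f z) / 2)\<^sup>2)"
      by (intro sum.cong refl) (simp add: power2_eq_square field_simps)
    also have "\<dots> = codegree x z * ((f z - f x) / 2)\<^sup>2
        + (f z - f x) * (\<Sum>y\<in>N x \<inter> N z. f y - (f x + f z) / 2) + spread x z"
      by (simp only: sum.distrib sum_distrib_left[symmetric] spread_def codegree_def sum_constant)
    finally have S: "(\<Sum>y\<in>N x \<inter> N z. (f y - f x)\<^sup>2) = codegree x z * ((f z - f x) / 2)\<^sup>2 + spread x z"
      using sum_increments[OF that] by simp
    show ?thesis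
    proof (cases "codegree x z = 2 \<or> codegree x z = 0")
      case True
      moreover have "spread x z = 0" if "codegree x z = 0"
        using that by (simp add: spread_zero_if_codegree_ne_2[OF \<open>x \<noteq> z\<close>])
      ultimately show ?thesis
        unfolding h_def S by auto
    next
      case False
      then show ?thesis
        unfolding h_def S using spread_zero_if_codegree_ne_2[OF that]
        by (simp add: power2_eq_square field_simps)
    qed
  qed
  let ?q = "\<lambda>x z. if codegree x z = 0 then 0 else ((codegree x z - 2) * (f z - f x))\<^sup>2"
  have "pair_sum ?q = pair_sum (\<lambda>x z. codegree x z * (codegree x z - 2) * (f z - f x)\<^sup>2 - 4 * h x z)"
    by (intro sum.cong refl) (subst eq, auto)
  also have "\<dots> = 0 - 4 * pair_sum h"
    by (simp only: sum_subtractf sum_distrib_left[symmetric] codegree_sum_distances)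
  finally have le: "pair_sum ?q \<le> 0"
    using h by simp
  have xz: "x \<in> V" "z \<in> V - {x}"
    using w in_V fxz by auto
  have q: "0 \<le> ?q x z" for x z
    by simp
  have "?q x z \<le> (\<Sum>z\<in>V - {x}. ?q x z)"
    by (rule member_le_sum) (use xz finite_V in auto)
  also have "\<dots> \<le> pair_sum ?q"
    by (rule member_le_sum[of x V "\<lambda>x. \<Sum>z\<in>V - {x}. ?q x z"]) (use xz finite_V in \<open>auto intro!: sum_nonneg q simp del: power_mult_distrib\<close>)
  finally have "?q x z \<le> 0"
    using le by linarith
  moreover have "codegree x z \<noteq> 0"
    using w by (auto simp: codegree_def)
  ultimately have "((codegree x z - 2) * (f z - f x))\<^sup>2 = 0"
    by (simp add: order_antisym)
  then show ?thesis
    using fxz by auto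
qed

text \<open>
  For ends with the same value, the middle vertex is off the midpoint; for ends with different values
  the previous lemma applies.
\<close>

lemma visible_square:
  assumes CD: "\<And>g x. x \<in> V \<Longrightarrow> bochner g x \<ge> 0"
    and xz: "x \<noteq> z" and w: "w \<in> N x \<inter> N z" and visible: "f w \<noteq> f x \<or> f w \<noteq> f z"
  obtains w' where "w' \<noteq> w" "N x \<inter> N z = {w, w'}" "f w + f w' = f x + f z"
proof -
  have "card (N x \<inter> N z) = 2"
  proof (cases "f x = f z")
    case True
    then have "(f x + f z) / 2 = f z" "f w \<noteq> f z"
      using visible by simp_all
    then have "f w \<noteq> (f x + f z) / 2"
      by simp
    then obtain w' where "w' \<noteq> w" "N x \<inter> N z = {w, w'}"
      by (rule off_midpoint_partner[OF xz w])
    then show ?thesis by simp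
  next
    case False
    then show ?thesis
      using codegree_2_if_distinct_values[OF CD False w] by (simp add: codegree_def)
  qed
  then obtain a b where ab: "N x \<inter> N z = {a, b}" "a \<noteq> b"
    by (auto simp: card_2_iff)
  with w obtain w' where w': "N x \<inter> N z = {w, w'}" "w' \<noteq> w"
    by auto
  moreover have "f w + f w' = f x + f z"
    using midpoint[OF xz] w' by (simp add: codegree_def)
  ultimately show thesis using that by blast
qed

end

section \<open>Components of the visible graph\<close>

text \<open>
  The combinatorial outcome of the curvature bound: every two-step path on which \<open>f\<close> is not constant
  lies in exactly one quadrilateral, a parallelogram for \<open>f\<close>. Connectedness is stated as an induction
  principle along edges.
\<close>

locale square_function = regular_nbrs +
  fixes f :: "'a \<Rightarrow> real"
  assumes square: "\<lbrakk>x \<noteq> z; w \<in> N x; w \<in> N z; f w \<noteq> f x \<or> f w \<noteq> f z\<rbrakk>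
      \<Longrightarrow> \<exists>w'. w' \<noteq> w \<and> N x \<inter> N z = {w, w'} \<and> f w + f w' = f x + f z"
    and connected: "\<lbrakk>P x; x \<in> V; y \<in> V; \<And>u v. \<lbrakk>P u; v \<in> N u\<rbrakk> \<Longrightarrow> P v\<rbrakk> \<Longrightarrow> P y"
begin

definition lower :: "'a \<Rightarrow> 'a set" where "lower x = {y \<in> N x. f y < f x}"
definition upper :: "'a \<Rightarrow> 'a set" where "upper x = {y \<in> N x. f x < f y}"

text \<open>
  For a generic eigenfunction these are the neighbours along visible edges.
\<close>

definition visible :: "'a \<Rightarrow> 'a set" where "visible x = {y \<in> N x. f y \<noteq> f x}"

text \<open>
  It will turn out to be the number of hypercube coordinates in which \<open>x\<close> differs from the bottom of
  its component.
\<close>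

definition height :: "'a \<Rightarrow> nat" where "height x = card (lower x)"

lemma finite_lower [simp]: "finite (lower x)" and finite_upper [simp]: "finite (upper x)"
  by (simp_all add: lower_def upper_def)

lemma lowerD:
  assumes "w \<in> lower z"
  shows "w \<in> N z" "z \<in> N w" "f w < f z"
  using assms N_sym by (auto simp: lower_def)

lemma upper_iff_lower: "y \<in> upper x \<longleftrightarrow> x \<in> lower y"
  using N_sym by (auto simp: lower_def upper_def)

lemma two_middle_vertices:
  assumes "x \<noteq> z" "w \<in> N x" "w \<in> N z" "f w \<noteq> f x \<or> f w \<noteq> f z"
    and "a \<in> N x" "a \<in> N z" "b \<in> N x" "b \<in> N z" "a \<noteq> w" "b \<noteq> w"
  shows "a = b"
proof -
  obtain w' where "N x \<inter> N z = {w, w'}"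
    using square[OF assms(1-4)] by blast
  with assms(5-10) show ?thesis by blast
qed

text \<open>
  A neighbour \<open>u\<close> of \<open>x\<close> is moved to the fourth vertex of the quadrilateral through \<open>y\<close>, \<open>x\<close>, \<open>u\<close>. The
  condition on \<open>Q\<close> excludes paths on which \<open>f\<close> is constant, which need not lie in a unique one.
\<close>

lemma transport_card_le:
  assumes xy: "y \<in> N x" and Q: "f x = f y \<Longrightarrow> \<not> Q 0"
  shows "card {u \<in> N x - {y}. Q (f u - f x)} \<le> card {z \<in> N y - {x}. Q (f z - f y)}"
proof -
  have yx: "x \<in> N y" and ne: "x \<noteq> y"
    using xy N_sym N_irrefl by auto
  have "\<exists>z. z \<noteq> x \<and> N y \<inter> N u = {x, z} \<and> f x + f z = f y + f u"
    if "u \<in> {u \<in> N x - {y}. Q (f u - f x)}" for u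
    using that Q N_sym yx by (intro square) auto
  then obtain \<tau> where \<tau>: "\<And>u. u \<in> {u \<in> N x - {y}. Q (f u - f x)} \<Longrightarrow>
      \<tau> u \<noteq> x \<and> N y \<inter> N u = {x, \<tau> u} \<and> f x + f (\<tau> u) = f y + f u"
    by metis
  show ?thesis
  proof (rule card_inj_on_le)
    show "\<tau> ` {u \<in> N x - {y}. Q (f u - f x)} \<subseteq> {z \<in> N y - {x}. Q (f z - f y)}"
    proof (rule image_subsetI)
      fix u assume u: "u \<in> {u \<in> N x - {y}. Q (f u - f x)}"
      have eq: "f (\<tau> u) - f y = f u - f x"
        using \<tau>[OF u] by linarith
      have "Q (f (\<tau> u) - f y)"
        unfolding eq using u by blast
      then show "\<tau> u \<in> {z \<in> N y - {x}. Q (f z - f y)}"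
        using \<tau>[OF u] by blast
    qed
    show "inj_on \<tau> {u \<in> N x - {y}. Q (f u - f x)}"
    proof (rule inj_onI)
      fix u v assume u: "u \<in> {u \<in> N x - {y}. Q (f u - f x)}"
        and v: "v \<in> {u \<in> N x - {y}. Q (f u - f x)}" and eq: "\<tau> u = \<tau> v"
      have \<tau>u: "\<tau> u \<in> N y" "\<tau> u \<in> N u" "\<tau> v \<in> N v" "\<tau> u \<noteq> x" "f (\<tau> u) - f y = f u - f x"
        using \<tau>[OF u] \<tau>[OF v] by auto
      have "f y \<noteq> f x \<or> f y \<noteq> f (\<tau> u)"
        using Q u \<tau>u(5) by auto
      then show "u = v"
        using two_middle_vertices[of x "\<tau> u" y u v] \<tau>u xy u v eq N_sym by auto
    qed
  qed simp
qed

lemma transport_card: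
  assumes xy: "y \<in> N x" and Q: "f x = f y \<Longrightarrow> \<not> Q 0"
  shows "card {u \<in> N x - {y}. Q (f u - f x)} = card {z \<in> N y - {x}. Q (f z - f y)}"
  using transport_card_le[of y x Q] transport_card_le[of x y Q] xy N_sym Q by fastforce

lemma height_upper:
  assumes "x \<in> lower y"
  shows "height y = Suc (height x)"
proof -
  have xy: "y \<in> N x" "x \<in> N y" "f x < f y"
    using assms N_sym by (auto simp: lower_def)
  have "lower x = {u \<in> N x - {y}. f u - f x < 0}"
    using xy by (auto simp: lower_def)
  moreover have "lower y = insert x {u \<in> N y - {x}. f u - f y < 0}"
    using xy by (auto simp: lower_def)
  ultimately show ?thesis
    using transport_card[OF xy(1), of "\<lambda>t. t < 0"] by (simp add: height_def)
qed

lemma height_collapsed: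
  assumes "y \<in> N x" "f y = f x"
  shows "height y = height x"
proof -
  have "lower x = {u \<in> N x - {y}. f u - f x < 0}" "lower y = {u \<in> N y - {x}. f u - f y < 0}"
    using assms by (auto simp: lower_def)
  then show ?thesis
    using transport_card[OF assms(1), of "\<lambda>t. t < 0"] by (simp add: height_def)
qed

lemma card_visible_edge:
  assumes xy: "y \<in> N x"
  shows "card (visible y) = card (visible x)"
proof -
  have yx: "x \<in> N y" using xy N_sym by blast
  have *: "card {u \<in> N x - {y}. f u - f x \<noteq> 0} = card {u \<in> N y - {x}. f u - f y \<noteq> 0}"
    using transport_card[OF xy, of "\<lambda>t. t \<noteq> 0"] by simp
  show ?thesis
  proof (cases "f x = f y")
    case True
    then have "visible x = {u \<in> N x - {y}. f u - f x \<noteq> 0}" "visible y = {u \<in> N y - {x}. f u - f y \<noteq> 0}"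
      by (auto simp: visible_def)
    with * show ?thesis by simp
  next
    case False
    then have "visible x = insert y {u \<in> N x - {y}. f u - f x \<noteq> 0}"
      "visible y = insert x {u \<in> N y - {x}. f u - f y \<noteq> 0}"
      using xy yx by (auto simp: visible_def)
    with * show ?thesis by simp
  qed
qed

lemma card_visible: "x \<in> V \<Longrightarrow> y \<in> V \<Longrightarrow> card (visible y) = card (visible x)"
  by (rule connected[of "\<lambda>y. card (visible y) = card (visible x)" x y]) (simp_all add: card_visible_edge)

lemma height_0_iff: "height x = 0 \<longleftrightarrow> lower x = {}"
  by (simp add: height_def)

text \<open>
  The square through \<open>w\<close>, \<open>z\<close>, \<open>w'\<close> has its fourth vertex below, since \<open>f z + f u = f w + f w'\<close>.
\<close>

lemma common_lower:
  assumes w: "w \<in> lower z" "w' \<in> lower z" "w \<noteq> w'"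
  obtains u where "u \<in> lower w" "u \<in> lower w'" "N w \<inter> N w' = {z, u}" "u \<noteq> z"
proof -
  have z: "z \<in> N w" "z \<in> N w'" "f w < f z" "f w' < f z"
    using w N_sym by (auto simp: lower_def)
  then obtain u where u: "u \<noteq> z" "N w \<inter> N w' = {z, u}" "f z + f u = f w + f w'"
    using square[of w w' z] w(3) by auto
  then have "u \<in> N w" "u \<in> N w'" by auto
  moreover have "f u < f w" "f u < f w'"
    using u(3) z by linarith+
  ultimately show thesis
    using that u by (simp add: lower_def)
qed

definition below :: "'a rel" where "below = {(x, y). y \<in> lower x}"

lemma bottom_exists: "\<exists>b. height b = 0 \<and> (x, b) \<in> below\<^sup>*"
proof (induction "height x" arbitrary: x)
  case (Suc n)
  then have "lower x \<noteq> {}"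
    using height_0_iff[of x] by simp
  then obtain w where "w \<in> lower x"
    by blast
  then show ?case
    using Suc height_upper[of w x] by (auto simp: below_def intro: converse_rtrancl_into_rtrancl)
qed auto

lemma below_height_0: "(x, y) \<in> below\<^sup>* \<Longrightarrow> height x = 0 \<Longrightarrow> y = x"
  by (erule converse_rtranclE) (auto simp: below_def height_0_iff)

text \<open>
  Two descents with different first steps are joined below by a common lower neighbour of the two.
\<close>

lemma bottom_unique:
  assumes "height b = 0" "(x, b) \<in> below\<^sup>*" "height b' = 0" "(x, b') \<in> below\<^sup>*"
  shows "b = b'"
  using assms
proof (induction "height x" arbitrary: x b b')
  case 0
  then show ?case using below_height_0 by metis
next
  case (Suc n)
  have "x \<noteq> b" "x \<noteq> b'" using Suc by auto
  then obtain w w' where w: "(x, w) \<in> below" "(w, b) \<in> below\<^sup>*" "(x, w') \<in> below" "(w', b') \<in> below\<^sup>*"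
    using Suc by (metis converse_rtranclE)
  then have "height w = n" "height w' = n"
    using Suc height_upper[of w x] height_upper[of w' x] by (auto simp: below_def)
  note IH = Suc(1)[OF this(1)[symmetric]] Suc(1)[OF this(2)[symmetric]]
  show ?case
  proof (cases "w = w'")
    case True
    then show ?thesis using IH w Suc by blast
  next
    case False
    then obtain u where "u \<in> lower w" "u \<in> lower w'"
      using w common_lower[of w x w'] by (auto simp: below_def)
    moreover obtain c where c: "height c = 0" "(u, c) \<in> below\<^sup>*"
      using bottom_exists by blast
    ultimately have "(w, c) \<in> below\<^sup>*" "(w', c) \<in> below\<^sup>*"
      by (auto simp: below_def intro: converse_rtrancl_into_rtrancl)
    then show ?thesis using IH w Suc c by blast
  qed
qed

definition bottom :: "'a \<Rightarrow> 'a" where "bottom x = (THE b. height b = 0 \<and> (x, b) \<in> below\<^sup>*)"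

lemma bottom: "height (bottom x) = 0" "(x, bottom x) \<in> below\<^sup>*"
  using theI'[of "\<lambda>b. height b = 0 \<and> (x, b) \<in> below\<^sup>*"] bottom_exists[of x] bottom_unique
  unfolding bottom_def by blast+

lemma bottom_eqI: "height b = 0 \<Longrightarrow> (x, b) \<in> below\<^sup>* \<Longrightarrow> bottom x = b"
  using bottom_unique bottom by blast

lemma bottom_height_0: "height x = 0 \<Longrightarrow> bottom x = x"
  by (rule bottom_eqI) auto

lemma bottom_below:
  assumes "(x, y) \<in> below\<^sup>*"
  shows "bottom y = bottom x"
  using bottom_eqI[OF bottom(1) rtrancl_trans[OF assms bottom(2)]] by simp

lemma bottom_visible: "y \<in> visible x \<Longrightarrow> bottom y = bottom x"
  using bottom_below[of x y] bottom_below[of y x] N_sym by (force simp: below_def visible_def lower_def)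

lemma below_V: "(x, y) \<in> below\<^sup>* \<Longrightarrow> x \<in> V \<Longrightarrow> y \<in> V"
  by (induction rule: rtrancl_induct) (auto simp: below_def lower_def in_V)

lemma bottom_V: "x \<in> V \<Longrightarrow> bottom x \<in> V"
  using below_V bottom by blast

definition vis :: "'a rel" where "vis = {(x, y). y \<in> visible x}"

lemma sym_vis: "sym vis"
  using N_sym by (auto simp: vis_def visible_def sym_def)

lemma bottom_vis: "(x, y) \<in> vis\<^sup>* \<Longrightarrow> bottom y = bottom x"
  by (induction rule: rtrancl_induct) (auto simp: vis_def bottom_visible)

lemma vis_bottom: "(x, bottom x) \<in> vis\<^sup>*"
proof -
  have "below \<subseteq> vis"
    by (auto simp: below_def vis_def lower_def visible_def)
  then show ?thesis
    using bottom rtrancl_mono by blast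
qed

lemma vis_iff_bottom: "(x, y) \<in> vis\<^sup>* \<longleftrightarrow> bottom x = bottom y"
proof
  assume "bottom x = bottom y"
  then show "(x, y) \<in> vis\<^sup>*"
    using vis_bottom[of x] vis_bottom[of y] sym_vis by (metis rtrancl_trans sym_rtrancl symD)
qed (simp add: bottom_vis)

text \<open>
  The vertices that will serve as the coordinates of \<open>z\<close> with value 1.
\<close>

definition atoms :: "'a \<Rightarrow> 'a set" where "atoms z = {a. height a = 1 \<and> (z, a) \<in> below\<^sup>*}"

lemma atoms_height_0: "height z = 0 \<Longrightarrow> atoms z = {}"
  using below_height_0 by (fastforce simp: atoms_def)

lemma atoms_step:
  assumes "height z \<noteq> 1"
  shows "atoms z = (\<Union>w\<in>lower z. atoms w)"
proof (intro equalityI subsetI)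
  fix a assume "a \<in> atoms z"
  then have a: "height a = 1" "(z, a) \<in> below\<^sup>*" by (auto simp: atoms_def)
  then have "z \<noteq> a" using assms by auto
  then obtain w where "(z, w) \<in> below" "(w, a) \<in> below\<^sup>*"
    using a by (metis converse_rtranclE)
  then show "a \<in> (\<Union>w\<in>lower z. atoms w)"
    using a by (auto simp: below_def atoms_def)
qed (auto simp: below_def atoms_def intro: converse_rtrancl_into_rtrancl)

lemma atoms_height_1:
  assumes "height z = 1"
  shows "atoms z = {z}"
proof -
  have "a = z" if "height a = 1" "(z, a) \<in> below\<^sup>*" for a
    using that(2)
  proof (cases rule: converse_rtranclE)
    case (step w)
    then have "height w = 0"
      using assms height_upper[of w z] by (auto simp: below_def)
    then show ?thesis
      using below_height_0 step that by force
  qed auto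
  then show ?thesis
    using assms by (auto simp: atoms_def)
qed

text \<open>
  The lower neighbours of \<open>z\<close> are the coatoms of the power set of its atoms.
\<close>

definition boolean_at :: "'a \<Rightarrow> bool" where
  "boolean_at z \<longleftrightarrow> finite (atoms z) \<and> card (atoms z) = height z \<and> inj_on atoms (lower z) \<and>
     (\<forall>w\<in>lower z. \<exists>a\<in>atoms z. atoms w = atoms z - {a})"

lemma boolean_at_coatom:
  assumes "boolean_at z" "a \<in> atoms z"
  obtains w where "w \<in> lower z" "atoms w = atoms z - {a}"
proof -
  have "atoms ` lower z = (\<lambda>a. atoms z - {a}) ` atoms z"
  proof (rule card_subset_eq)
    show "atoms ` lower z \<subseteq> (\<lambda>a. atoms z - {a}) ` atoms z"
      using assms by (auto simp: boolean_at_def)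
    show "finite ((\<lambda>a. atoms z - {a}) ` atoms z)"
      using assms by (auto simp: boolean_at_def)
    have "inj_on (\<lambda>a. atoms z - {a}) (atoms z)"
      by (auto simp: inj_on_def)
    then show "card (atoms ` lower z) = card ((\<lambda>a. atoms z - {a}) ` atoms z)"
      using assms by (simp add: boolean_at_def card_image height_def)
  qed
  then have "atoms z - {a} \<in> atoms ` lower z"
    using assms(2) by simp
  then obtain w where "w \<in> lower z" "atoms z - {a} = atoms w"
    by (rule imageE)
  then show thesis
    using that[of w] by simp
qed

text \<open>
  Any two lower neighbours of \<open>z\<close> have a common lower neighbour, so their atom sets arise from each
  other by exchanging one element. A family of sets with this property either lies in a set with one
  more element, as claimed, or contains three sets with the same pairwise intersection. In the latter
  case a single vertex \<open>u\<close> lies below three lower neighbours of \<open>z\<close>, but \<open>u\<close> and \<open>z\<close> have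
  only two common neighbours.
\<close>

lemma boolean_at_step:
  assumes n: "height z \<ge> 2"
    and bool: "\<And>w. height w < height z \<Longrightarrow> boolean_at w"
    and inj: "\<And>w w'. \<lbrakk>w \<in> lower z; w' \<in> lower z; atoms w = atoms w'\<rbrakk> \<Longrightarrow> w = w'"
  shows "boolean_at z"
proof -
  have height_lower: "Suc (height w) = height z" if "w \<in> lower z" for w
    using height_upper[OF that] by simp
  have bool_lower: "boolean_at w" if "w \<in> lower z" for w
    using bool height_lower[OF that] by simp
  have link: "\<exists>u a a'. u \<in> lower w \<and> u \<in> lower w' \<and> a \<in> atoms w \<and> a' \<in> atoms w' \<and>
      atoms u = atoms w - {a} \<and> atoms u = atoms w' - {a'} \<and> a \<notin> atoms w' \<and> a' \<notin> atoms w"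
    if w: "w \<in> lower z" "w' \<in> lower z" "w \<noteq> w'" for w w'
  proof -
    obtain u where u: "u \<in> lower w" "u \<in> lower w'"
      using common_lower[OF w] by blast
    obtain a a' where a: "a \<in> atoms w" "a' \<in> atoms w'" "atoms u = atoms w - {a}" "atoms u = atoms w' - {a'}"
      using u bool_lower[OF w(1)] bool_lower[OF w(2)] unfolding boolean_at_def by blast
    have W: "atoms w = insert a (atoms u)" "atoms w' = insert a' (atoms u)"
      using a by auto
    have "atoms w \<noteq> atoms w'"
      using inj w by blast
    then have "a \<noteq> a'"
      using W by auto
    moreover have "a \<notin> atoms u"
      using a(3) by simp
    moreover have "a' \<notin> atoms u"
      using a(4) by simp
    ultimately have "a \<notin> atoms w'" "a' \<notin> atoms w"
      unfolding W by simp_all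
    with u a show ?thesis by blast
  qed
  have "\<not> card (lower z) \<le> Suc 0"
    using n by (simp add: height_def)
  then obtain w1 w2 where w12: "w1 \<in> lower z" "w2 \<in> lower z" "w1 \<noteq> w2"
    unfolding card_le_Suc0_iff_eq[OF finite_lower] by blast
  obtain u12 a2 b where l12: "u12 \<in> lower w1" "u12 \<in> lower w2" "a2 \<in> atoms w1" "b \<in> atoms w2"
    "atoms u12 = atoms w1 - {a2}" "atoms u12 = atoms w2 - {b}" "a2 \<notin> atoms w2" "b \<notin> atoms w1"
    using link[OF w12] by blast
  \<comment> \<open>\<open>T\<close> is the union of the first two atom sets; a third one outside of \<open>T\<close> would have to contain
    their intersection\<close>
  define T where "T = insert b (atoms w1)"
  have fin: "finite (atoms w)" "Suc (card (atoms w)) = height z" if "w \<in> lower z" for w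
    using bool_lower[OF that] height_lower[OF that] by (auto simp: boolean_at_def)
  have T: "finite T" "card T = height z"
    using fin[OF w12(1)] l12 by (auto simp: T_def)
  have sub: "atoms w3 \<subseteq> T" if w3: "w3 \<in> lower z" for w3
  proof (rule ccontr)
    assume not_sub: "\<not> atoms w3 \<subseteq> T"
    then have ne: "w1 \<noteq> w3" "w2 \<noteq> w3"
      using l12 by (auto simp: T_def)
    obtain u13 a3 c where l13: "u13 \<in> lower w1" "u13 \<in> lower w3" "a3 \<in> atoms w1" "c \<in> atoms w3"
      "atoms u13 = atoms w1 - {a3}" "atoms u13 = atoms w3 - {c}" "c \<notin> atoms w1"
      using link[OF w12(1) w3 ne(1)] by blast
    obtain u23 p q where l23: "atoms u23 = atoms w2 - {p}" "atoms u23 = atoms w3 - {q}"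
      using link[OF w12(2) w3 ne(2)] by blast
    have "c \<noteq> b"
      using not_sub l13 by (auto simp: T_def)
    have "b \<notin> atoms w3"
      using \<open>c \<noteq> b\<close> l12(8) l13(5,6) by blast
    have "c \<notin> atoms w2"
      using \<open>c \<noteq> b\<close> l12(5,6) l13(7) by blast
    have "p = b"
      using \<open>b \<notin> atoms w3\<close> l12(4) l23 by blast
    moreover have "q = c"
      using \<open>c \<notin> atoms w2\<close> l13(4) l23 by blast
    ultimately have "atoms u12 = atoms u13"
      using l12(6) l13(6) l23 by simp
    moreover have "inj_on atoms (lower w1)"
      using bool_lower[OF w12(1)] by (simp add: boolean_at_def)
    ultimately have u: "u12 = u13"
      using l12(1) l13(1) by (simp add: inj_on_def)
    have "f u12 < f w1" "f w1 < f z"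
      using lowerD[OF l12(1)] lowerD[OF w12(1)] by simp_all
    then have "u12 \<noteq> z" "f w1 \<noteq> f u12 \<or> f w1 \<noteq> f z"
      by auto
    from two_middle_vertices[OF this(1) _ _ this(2), of w2 w3] show False
      using lowerD(1,2)[OF w12(1)] lowerD(1,2)[OF w12(2)] lowerD(1,2)[OF w3]
        lowerD(1,2)[OF l12(1)] lowerD(1,2)[OF l12(2)] lowerD(1,2)[OF l13(2)] u ne w12(3) by simp
  qed
  have "T \<subseteq> atoms w1 \<union> atoms w2"
    using l12 by (auto simp: T_def)
  then have zT: "atoms z = T"
    using sub w12 n by (subst atoms_step) auto
  have "\<exists>a\<in>T. atoms w = T - {a}" if w: "w \<in> lower z" for w
  proof -
    have "card (T - atoms w) = 1"
      using card_Diff_subset[OF fin(1)[OF w] sub[OF w]] fin(2)[OF w] T by simp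
    then obtain a where "T - atoms w = {a}"
      by (auto simp: card_1_singleton_iff)
    then show ?thesis
      using sub[OF w] by blast
  qed
  then show ?thesis
    using T inj unfolding boolean_at_def zT by (auto intro: inj_onI)
qed

text \<open>
  The two claims support each other in the induction on the height. A vertex of height at least two is
  determined by its atoms because two of its coatoms, which are determined by induction, have besides
  their common lower neighbour only one common neighbour. At height zero the atoms are empty, so
  there the component has to be known as well.
\<close>

lemma boolean_and_determined:
  "boolean_at z \<and> (\<forall>z'. height z \<ge> 1 \<longrightarrow> height z' = height z \<longrightarrow> atoms z = atoms z' \<longrightarrow> z = z')"
proof (induction "height z" arbitrary: z rule: less_induct)
  case less
  have bool: "boolean_at z" if IH: "\<And>w. height w < height z \<Longrightarrow> boolean_at w \<and>
      (\<forall>z'. height w \<ge> 1 \<longrightarrow> height z' = height w \<longrightarrow> atoms w = atoms z' \<longrightarrow> w = z')" for z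
  proof -
    consider "height z = 0" | "height z = 1" | "height z \<ge> 2" by linarith
    then show ?thesis
    proof cases
      case 1
      then show ?thesis
        using height_0_iff[of z] by (auto simp: boolean_at_def atoms_height_0)
    next
      case 2
      then obtain b where "lower z = {b}"
        by (auto simp: height_def card_1_singleton_iff)
      moreover from this have "height b = 0"
        using height_upper[of b z] 2 by simp
      ultimately show ?thesis
        using 2 by (simp add: boolean_at_def atoms_height_0 atoms_height_1)
    next
      case 3
      then show ?thesis
      proof (rule boolean_at_step)
        fix w w' assume w: "w \<in> lower z" "w' \<in> lower z" "atoms w = atoms w'"
        then show "w = w'"
          using height_upper[of w z] height_upper[of w' z] IH[of w] 3 by simp
      qed (use IH in blast)
    qed
  qed
  have bz: "boolean_at z"
    using bool less by blast
  have "z = z'" if z': "height z \<ge> 1" "height z' = height z" "atoms z = atoms z'" for z'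
  proof (cases "height z = 1")
    case True
    then show ?thesis using z' atoms_height_1 by force
  next
    case False
    have bz': "boolean_at z'"
      using bool less z'(2) by metis
    have "\<not> card (atoms z) \<le> Suc 0" and fin: "finite (atoms z)"
      using bz False z' by (simp_all add: boolean_at_def)
    then obtain a b where ab: "a \<in> atoms z" "b \<in> atoms z" "a \<noteq> b"
      unfolding card_le_Suc0_iff_eq[OF fin] by blast
    have common: "\<exists>w. w \<in> lower z \<and> w \<in> lower z' \<and> atoms w = atoms z - {a}" if a: "a \<in> atoms z" for a
    proof -
      obtain w w' where w: "w \<in> lower z" "atoms w = atoms z - {a}" "w' \<in> lower z'" "atoms w' = atoms z' - {a}"
        using boolean_at_coatom[OF bz a] boolean_at_coatom[OF bz'] a z' by metis
      have "w = w'"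
        using less[of w] height_upper[OF w(1)] height_upper[OF w(3)] w z' False by simp
      then show ?thesis using w by blast
    qed
    obtain w v where w: "w \<in> lower z" "w \<in> lower z'" "atoms w = atoms z - {a}"
      and v: "v \<in> lower z" "v \<in> lower z'" "atoms v = atoms z - {b}"
      using common ab by metis
    have "w \<noteq> v"
      using w v ab by blast
    then obtain u where u: "u \<in> lower w" "N w \<inter> N v = {z, u}"
      using common_lower[OF w(1) v(1)] by blast
    have "z' \<in> N w \<inter> N v"
      using w v N_sym by (auto simp: lower_def)
    then have "z' \<in> {z, u}"
      by (simp only: u(2))
    moreover have "z' \<noteq> u"
      using u w by (auto simp: lower_def)
    ultimately show ?thesis
      by blast
  qed
  with bz show ?case by blast
qed

lemma boolean_at: "boolean_at z"
  using boolean_and_determined by blast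

lemma card_atoms: "card (atoms z) = height z" and finite_atoms [simp]: "finite (atoms z)"
  using boolean_at by (auto simp: boolean_at_def)

lemma atoms_subset: "atoms z \<subseteq> upper (bottom z)"
proof
  fix a assume "a \<in> atoms z"
  then have a: "height a = 1" "bottom a = bottom z"
    by (auto simp: atoms_def bottom_below)
  then obtain b where b: "b \<in> lower a"
    using height_0_iff[of a] by auto
  then have "height b = 0"
    using height_upper[OF b] a by simp
  then have "bottom b = b" by (rule bottom_height_0)
  moreover have "bottom b = bottom a"
    using b by (intro bottom_below) (auto simp: below_def)
  ultimately show "a \<in> upper (bottom z)"
    using a b by (simp add: upper_iff_lower)
qed

lemma atoms_inj:
  assumes "bottom x = bottom y" "atoms x = atoms y"
  shows "x = y"
proof -
  have "height x = height y"
    using assms card_atoms by metis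
  show ?thesis
  proof (cases "height x = 0")
    case True
    then show ?thesis
      using assms \<open>height x = height y\<close> bottom_height_0 by metis
  next
    case False
    then show ?thesis
      using boolean_and_determined[of x] assms \<open>height x = height y\<close> by simp
  qed
qed

lemma atoms_upper:
  assumes "y \<in> upper x"
  obtains a where "a \<notin> atoms x" "atoms y = insert a (atoms x)" "bottom y = bottom x"
proof -
  have x: "x \<in> lower y"
    using assms by (simp add: upper_iff_lower)
  then obtain a where "a \<in> atoms y" "atoms x = atoms y - {a}"
    using boolean_at[of y] by (auto simp: boolean_at_def)
  moreover have "bottom y = bottom x"
    using bottom_below[OF r_into_rtrancl, of y x] x by (simp add: below_def[THEN eqset_imp_iff])
  ultimately show thesis
    using that by blast
qed

lemma visible_split: "visible x = lower x \<union> upper x" "lower x \<inter> upper x = {}"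
  by (auto simp: visible_def lower_def upper_def)

text \<open>
  By regularity of the visible graph, the number of upper neighbours of \<open>x\<close> is the number of atoms of the
  component that are missing in \<open>x\<close>, and each upper neighbour adds another one of them.
\<close>

lemma upper_neighbour_exists:
  assumes x: "x \<in> V" and b: "b \<in> upper (bottom x)" "b \<notin> atoms x"
  obtains y where "y \<in> upper x" "atoms y = insert b (atoms x)"
proof -
  let ?I = "(\<lambda>b. insert b (atoms x)) ` (upper (bottom x) - atoms x)"
  have card_upper_bottom: "card (upper (bottom x)) = card (visible x)"
    using card_visible[OF x bottom_V[OF x]] visible_split[of "bottom x"] bottom(1)[of x] by (simp add: height_0_iff)
  have "card (visible x) = height x + card (upper x)"
    using card_Un_disjoint[of "lower x" "upper x"] by (simp add: visible_split height_def)
  moreover have "card (upper (bottom x) - atoms x) = card (upper (bottom x)) - height x"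
    using card_Diff_subset[OF finite_atoms atoms_subset] card_atoms by simp
  moreover have "inj_on (\<lambda>b. insert b (atoms x)) (upper (bottom x) - atoms x)"
    by (auto simp: inj_on_def)
  moreover have "inj_on atoms (upper x)"
    by (rule inj_onI) (metis atoms_inj atoms_upper)
  ultimately have card: "card (atoms ` upper x) = card ?I"
    using card_upper_bottom by (simp add: card_image)
  have "atoms ` upper x \<subseteq> ?I"
  proof (rule image_subsetI)
    fix y assume y: "y \<in> upper x"
    obtain a where a: "a \<notin> atoms x" "atoms y = insert a (atoms x)" "bottom y = bottom x"
      using atoms_upper[OF y] by blast
    then have "a \<in> upper (bottom x)"
      using atoms_subset[of y] by auto
    then show "atoms y \<in> ?I"
      using a by auto
  qed
  then have "atoms ` upper x = ?I"
    using card by (intro card_subset_eq) auto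
  then have "insert b (atoms x) \<in> atoms ` upper x"
    using b by auto
  then obtain y where "y \<in> upper x" "atoms y = insert b (atoms x)"
    by (metis imageE)
  then show thesis by (rule that)
qed

lemma atoms_surj:
  assumes b: "b \<in> V" "height b = 0" and T: "T \<subseteq> upper b"
  obtains x where "x \<in> V" "bottom x = b" "atoms x = T"
proof -
  have "finite T"
    using T finite_subset finite_upper by blast
  then have "\<exists>x\<in>V. bottom x = b \<and> atoms x = T"
    using T
  proof (induction T)
    case empty
    then show ?case
      using b atoms_height_0 bottom_height_0 by blast
  next
    case (insert a T)
    then obtain x where x: "x \<in> V" "bottom x = b" "atoms x = T"
      by auto
    obtain y where y: "y \<in> upper x" "atoms y = insert a T"
      using upper_neighbour_exists[OF x(1), of a] insert x by auto
    moreover have "y \<in> V" "bottom y = b"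
      using y x in_V(2)[of y x] atoms_upper[OF y(1)] by (auto simp: upper_def)
    ultimately show ?case by blast
  qed
  then show thesis using that by blast
qed

lemma collapsed_transport:
  assumes xy: "y \<in> N x" "f y = f x" and x': "x' \<in> visible x"
  obtains y' where "y' \<in> N x'" "f y' = f x'" "y' \<in> visible y" "bottom y' = bottom y"
proof -
  have "x' \<noteq> y" "x \<in> N x'" "x \<in> N y" "f x \<noteq> f x'"
    using xy x' N_sym by (auto simp: visible_def)
  then obtain y' where "N x' \<inter> N y = {x, y'}" "f x + f y' = f x' + f y"
    using square[of x' y x] by blast
  then have "y' \<in> N x'" "f y' = f x'" "y' \<in> visible y"
    using xy x' by (auto simp: visible_def)
  then show thesis
    using that bottom_visible by blast
qed

text \<open>
  Transporting the edge to the bottom would give a loop.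
\<close>

lemma collapsed_not_within:
  assumes "y \<in> N x" "f y = f x"
  shows "bottom y \<noteq> bottom x"
  using assms
proof (induction "height x" arbitrary: x y)
  case 0
  then have "height y = 0" using height_collapsed by simp
  then show ?case
    using 0 N_irrefl bottom_height_0[of x] bottom_height_0[of y] by auto
next
  case (Suc n)
  then obtain w where w: "w \<in> lower x"
    using height_0_iff[of x] by auto
  then have w': "height w = n" "w \<in> visible x"
    using height_upper[OF w] Suc by (auto simp: lower_def visible_def)
  obtain y' where "y' \<in> N w" "f y' = f w" "bottom y' = bottom y"
    using collapsed_transport[OF Suc(3,4) w'(2)] by blast
  then show ?case
    using Suc(1)[of w y'] w' bottom_visible by metis
qed

text \<open>
  Two such edges are transported to two edges from the bottom, where both other ends have height zero
  and agree. The proof runs upwards: if the transported ends agree, then the vertex \<open>z1\<close> and \<open>x\<close> would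
  have three common neighbours unless \<open>y1 = y2\<close>.
\<close>

lemma collapsed_unique:
  assumes "y1 \<in> N x" "f y1 = f x" "y2 \<in> N x" "f y2 = f x" "bottom y1 = bottom y2"
  shows "y1 = y2"
  using assms
proof (induction "height x" arbitrary: x y1 y2)
  case 0
  then have "height y1 = 0" "height y2 = 0" using height_collapsed by simp_all
  then show ?case
    using 0 bottom_height_0 by metis
next
  case (Suc n)
  then obtain w where w: "w \<in> lower x"
    using height_0_iff[of x] by auto
  then have w': "height w = n" "w \<in> visible x" "w \<in> N x" "f w < f x"
    using height_upper[OF w] Suc by (auto simp: lower_def visible_def)
  obtain z1 where z1: "z1 \<in> N w" "f z1 = f w" "z1 \<in> visible y1" "bottom z1 = bottom y1"
    using collapsed_transport[OF Suc(3,4) w'(2)] by blast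
  obtain z2 where z2: "z2 \<in> N w" "f z2 = f w" "z2 \<in> visible y2" "bottom z2 = bottom y2"
    using collapsed_transport[OF Suc(5,6) w'(2)] by blast
  have ne: "x \<noteq> z1" "y1 \<noteq> w" "y2 \<noteq> w"
    using z1 w' Suc(4,6) by auto
  have "z1 = z2"
    using Suc(1)[of w z1 z2] w' z1 z2 Suc(7) by simp
  then show ?case
    using two_middle_vertices[of x z1 w y1 y2] ne z1 z2 w' Suc(3,5) N_sym by (simp add: visible_def)
qed

lemma collapsed_exists:
  assumes xy: "y \<in> N x" "f y = f x" and x': "bottom x' = bottom x"
  obtains y' where "y' \<in> N x'" "f y' = f x'" "bottom y' = bottom y"
proof -
  have "(x, x') \<in> vis\<^sup>*"
    using x' vis_iff_bottom by simp
  then have "\<exists>y'. y' \<in> N x' \<and> f y' = f x' \<and> bottom y' = bottom y"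
  proof (induction rule: rtrancl_induct)
    case base
    then show ?case using xy by blast
  next
    case (step u v)
    then obtain y' where y': "y' \<in> N u" "f y' = f u" "bottom y' = bottom y" by blast
    moreover have "v \<in> visible u" using step by (simp add: vis_def)
    ultimately obtain y'' where "y'' \<in> N v" "f y'' = f v" "bottom y'' = bottom y'"
      using collapsed_transport by blast
    then show ?case using y' by auto
  qed
  then show thesis using that by blast
qed

end

section \<open>Eigenfunctions of sharp graphs\<close>

definition nbrs :: "'a pair_pre_digraph \<Rightarrow> 'a \<Rightarrow> 'a set" where
  "nbrs G x = {y. (x, y) \<in> parcs G}"

lemma laplacian_nbrs: "laplacian G f x = (\<Sum>y\<in>nbrs G x. f y - f x)"
  by (simp add: laplacian_def nbrs_def)

lemma out_degree_nbrs: "out_degree (with_proj G) x = card (nbrs G x)"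
proof -
  have "out_arcs (with_proj G) x = Pair x ` nbrs G x"
    by (auto simp: out_arcs_def nbrs_def)
  then show ?thesis
    by (simp add: out_degree_def card_image inj_on_def)
qed

lemma bakry_gamma_nbrs:
  "bakry_gamma G f g x = (\<Sum>y\<in>nbrs G x. (f y - f x) * (g y - g x)) / 2"
proof -
  have "(\<Sum>y\<in>nbrs G x. (f y - f x) * (g y - g x))
      = (\<Sum>y\<in>nbrs G x. (f y * g y - f x * g x) - f x * (g y - g x) - g x * (f y - f x))"
    by (intro sum.cong refl) (simp add: algebra_simps)
  also have "\<dots> = 2 * bakry_gamma G f g x"
    unfolding bakry_gamma_def laplacian_nbrs
    by (simp only: sum_subtractf sum_distrib_left[symmetric]) simp
  finally show ?thesis by simp
qed

lemma regular_nbrs_graph: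
  assumes "pair_graph G" "graph_regular G d"
  shows "regular_nbrs (pverts G) (nbrs G) d"
proof -
  interpret G: pair_graph G by fact
  show ?thesis
  proof
    show "finite (pverts G)" by (rule G.pair_finite_verts)
    show "nbrs G x \<subseteq> pverts G" for x
      using G.in_arcsD2 by (auto simp: nbrs_def)
    show "x \<in> nbrs G y" if "y \<in> nbrs G x" for x y
      using that G.arcs_symmetric by (simp add: nbrs_def)
    show "x \<notin> nbrs G x" for x
      using G.no_loops' by (auto simp: nbrs_def)
    show "card (nbrs G x) = d" if "x \<in> pverts G" for x
      using assms(2) that by (simp add: graph_regular_def out_degree_nbrs)
  qed
qed

lemma bochner_formula:
  assumes "pair_graph G" "graph_regular G d" and x: "x \<in> pverts G"
  shows "regular_nbrs.bochner (nbrs G) d g x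
    = 4 * (bakry_gamma2 G g g x - 2 * bakry_gamma G g g x)"
proof -
  interpret regular_nbrs "pverts G" "nbrs G" d
    using assms(1,2) by (rule regular_nbrs_graph)
  have halves: "4 * ((a - b - b) / 2) = S - D - 2 * T + 2 * q"
    if "a = (S - D) / 2" "b = (T - q) / 2" for a b S D T q :: real
    using that by simp
  let ?N = "nbrs G" and ?S = "\<lambda>y. \<Sum>z\<in>nbrs G y. (g z - g y)\<^sup>2" and ?L = "laplacian G g"
  have "(\<Sum>y\<in>?N x. \<Sum>z\<in>?N y. (g z - 2 * g y + g x)\<^sup>2)
      = (\<Sum>y\<in>?N x. ?S y - 2 * ((g y - g x) * ?L y) + real d * (g y - g x)\<^sup>2)"
  proof (intro sum.cong refl)
    fix y assume "y \<in> ?N x"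
    then have y: "y \<in> pverts G" using in_V by blast
    have "(\<Sum>z\<in>?N y. (g z - 2 * g y + g x)\<^sup>2)
        = (\<Sum>z\<in>?N y. (g z - g y)\<^sup>2 - (2 * (g y - g x)) * (g z - g y) + (g y - g x)\<^sup>2)"
      by (intro sum.cong refl) (simp add: power2_eq_square algebra_simps)
    also have "\<dots> = ?S y - 2 * (g y - g x) * ?L y + real d * (g y - g x)\<^sup>2"
      by (simp only: sum.distrib sum_subtractf sum_distrib_left[symmetric] laplacian_nbrs
          sum_constant card_N[OF y])
    finally show "(\<Sum>z\<in>?N y. (g z - 2 * g y + g x)\<^sup>2)
        = ?S y - 2 * ((g y - g x) * ?L y) + real d * (g y - g x)\<^sup>2" by simp
  qed
  also have "\<dots> = (\<Sum>y\<in>?N x. ?S y) - 2 * (\<Sum>y\<in>?N x. (g y - g x) * ?L y) + real d * ?S x"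
    by (simp only: sum.distrib sum_subtractf sum_distrib_left[symmetric])
  finally have 1: "(\<Sum>y\<in>?N x. \<Sum>z\<in>?N y. (g z - 2 * g y + g x)\<^sup>2)
      = (\<Sum>y\<in>?N x. ?S y) - 2 * (\<Sum>y\<in>?N x. (g y - g x) * ?L y) + real d * ?S x" .
  have gamma: "bakry_gamma G g g = (\<lambda>y. ?S y / 2)"
    by (auto simp: bakry_gamma_nbrs power2_eq_square)
  have "laplacian G (bakry_gamma G g g) x = ((\<Sum>y\<in>?N x. ?S y) - real d * ?S x) / 2"
    unfolding gamma laplacian_nbrs
    by (simp add: sum_subtractf card_N[OF x] sum_divide_distrib[symmetric] diff_divide_distrib)
  moreover have "bakry_gamma G g ?L x = ((\<Sum>y\<in>?N x. (g y - g x) * ?L y) - ?L x * ?L x) / 2"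
  proof -
    have "(\<Sum>y\<in>?N x. (g y - g x) * (?L y - ?L x))
        = (\<Sum>y\<in>?N x. (g y - g x) * ?L y - ?L x * (g y - g x))"
      by (intro sum.cong refl) (simp add: algebra_simps)
    also have "\<dots> = (\<Sum>y\<in>?N x. (g y - g x) * ?L y) - ?L x * ?L x"
      by (simp only: sum_subtractf sum_distrib_left[symmetric] laplacian_nbrs)
    finally show ?thesis
      by (simp add: bakry_gamma_nbrs)
  qed
  ultimately have 2: "4 * bakry_gamma2 G g g x
      = (\<Sum>y\<in>?N x. ?S y) - real d * ?S x - 2 * (\<Sum>y\<in>?N x. (g y - g x) * ?L y) + 2 * (?L x * ?L x)"
    unfolding bakry_gamma2_def by (rule halves)
  have 3: "8 * bakry_gamma G g g x = 4 * ?S x"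
    by (simp add: gamma)
  show ?thesis
    unfolding bochner_def 1 laplacian_nbrs[symmetric] using 2 3
    by (simp add: power2_eq_square algebra_simps)
qed

lemma reachable_with_proj:
  assumes "pair_wf_digraph G"
  shows "u \<rightarrow>\<^sup>*\<^bsub>with_proj G\<^esub> v \<longleftrightarrow> u \<in> pverts G \<and> (u, v) \<in> (parcs G)\<^sup>*"
proof
  interpret pair_wf_digraph G by fact
  assume r: "u \<rightarrow>\<^sup>*\<^bsub>with_proj G\<^esub> v"
  then have "(u, v) \<in> (parcs G)\<^sup>*"
    unfolding reachable_def with_proj_simps
    by (rule rtrancl_on_rtranclI)
  moreover have "u \<in> pverts G"
    using r unfolding with_proj_simps(1)[symmetric] by (rule reachable_in_vertsE)
  ultimately show "u \<in> pverts G \<and> (u, v) \<in> (parcs G)\<^sup>*" by simp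
next
  interpret pair_wf_digraph G by fact
  assume "u \<in> pverts G \<and> (u, v) \<in> (parcs G)\<^sup>*"
  then have "(u, v) \<in> (parcs G)\<^sup>*" and u: "u \<in> pverts G" by auto
  from this(1) have "(u, v) \<in> rtrancl_on (pverts G) (parcs G)"
  proof (induction rule: rtrancl_induct)
    case (step y z)
    show ?case
      using step(3,2) in_arcsD2[OF step(2)] by (rule rtrancl_on_into_rtrancl_on)
  qed (rule rtrancl_on_refl[OF u])
  then show "u \<rightarrow>\<^sup>*\<^bsub>with_proj G\<^esub> v"
    by (simp add: reachable_def)
qed

lemma graph_connected_iff:
  assumes "pair_graph G"
  shows "graph_connected G \<longleftrightarrow>
    pverts G \<noteq> {} \<and> (\<forall>u\<in>pverts G. \<forall>v\<in>pverts G. (u, v) \<in> (parcs G)\<^sup>*)"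
proof -
  interpret pair_graph G by fact
  have "parcs (mk_symmetric (with_proj G)) = parcs G"
    using arcs_symmetric by (auto simp: mk_symmetric_def)
  then have "mk_symmetric (with_proj G) = G"
    by (simp add: mk_symmetric_def)
  then show ?thesis
    unfolding graph_connected_def connected_def strongly_connected_def
    using reachable_with_proj[OF pair_wf_digraph] by auto
qed

lemma connected_induct:
  assumes "pair_graph G" "graph_connected G" "x \<in> pverts G" "y \<in> pverts G" "P x"
    and "\<And>u v. P u \<Longrightarrow> v \<in> nbrs G u \<Longrightarrow> P v"
  shows "P y"
proof -
  have "(x, y) \<in> (parcs G)\<^sup>*"
    using assms graph_connected_iff by blast
  then show ?thesis
    by (induction rule: rtrancl_induct) (use assms(5,6) in \<open>auto simp: nbrs_def\<close>)
qed

text \<open>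
  A vector space over an infinite field is not a finite union of proper subspaces. On the line
  \<open>f + t g\<close> every pair that \<open>f\<close> or \<open>g\<close> separates is separated for all but at most one \<open>t\<close>.
\<close>

lemma separating_element:
  fixes E :: "('a \<Rightarrow> real) set"
  assumes "finite P"
    and lin: "\<And>f g t. f \<in> E \<Longrightarrow> g \<in> E \<Longrightarrow> (\<lambda>x. f x + t * g x) \<in> E"
    and "E \<noteq> {}"
    and "\<And>a b. (a, b) \<in> P \<Longrightarrow> \<exists>f\<in>E. f a \<noteq> f b"
  shows "\<exists>f\<in>E. \<forall>(a, b)\<in>P. f a \<noteq> f b"
  using assms(1,4)
proof (induction P)
  case empty
  then show ?case using \<open>E \<noteq> {}\<close> by auto
next
  case (insert p P)
  then have "\<exists>f\<in>E. \<forall>(a, b)\<in>P. f a \<noteq> f b"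
    by simp
  then obtain f where f: "f \<in> E" "\<forall>(a, b)\<in>P. f a \<noteq> f b"
    by blast
  obtain a b where p: "p = (a, b)" by (cases p)
  then obtain g where g: "g \<in> E" "g a \<noteq> g b"
    using insert.prems by blast
  \<comment> \<open>the values of \<open>t\<close> for which some pair fails to be separated\<close>
  let ?bad = "(\<lambda>(a, b). - (f a - f b) / (g a - g b)) ` insert p P"
  obtain t where t: "t \<notin> ?bad"
    using ex_new_if_finite[OF infinite_UNIV_char_0, of ?bad] insert.hyps by blast
  have "f a' + t * g a' \<noteq> f b' + t * g b'" if "(a', b') \<in> insert p P" for a' b'
  proof
    assume eq: "f a' + t * g a' = f b' + t * g b'"
    show False
    proof (cases "g a' = g b'")
      case True
      then show False
        using that eq f(2) g(2) p by auto
    next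
      case False
      then have "t = - (f a' - f b') / (g a' - g b')"
        using eq by (simp add: field_simps)
      then show False
        using t that by force
    qed
  qed
  then show ?case
    using lin[OF f(1) g(1), of t] by (intro bexI[of _ "\<lambda>x. f x + t * g x"]) auto
qed

lemma lap_eigenspace_linear:
  assumes "f \<in> lap_eigenspace G c" "g \<in> lap_eigenspace G c"
  shows "(\<lambda>x. f x + t * g x) \<in> lap_eigenspace G c"
proof -
  have "laplacian G (\<lambda>x. f x + t * g x) x = laplacian G f x + t * laplacian G g x" for x
    unfolding laplacian_nbrs sum_distrib_left sum.distrib[symmetric]
    by (intro sum.cong refl) (simp add: algebra_simps)
  then have "laplacian G (\<lambda>x. f x + t * g x) x + c * (f x + t * g x)
      = (laplacian G f x + c * f x) + t * (laplacian G g x + c * g x)" for x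
    by (simp add: algebra_simps)
  then show ?thesis
    using assms unfolding lap_eigenspace_def by simp
qed

lemma zero_in_lap_eigenspace: "(\<lambda>_. 0) \<in> lap_eigenspace G c"
  by (simp add: lap_eigenspace_def laplacian_def)

lemma generic_eigenfunction:
  assumes "pair_graph G"
  obtains f where "f \<in> lap_eigenspace G 2"
    "collapsed_arcs G = {(x, y) \<in> parcs G. f x = f y}"
proof -
  interpret pair_graph G by fact
  have "\<exists>f\<in>lap_eigenspace G 2. \<forall>(a, b)\<in>parcs G - collapsed_arcs G. f a \<noteq> f b"
  proof (rule separating_element)
    show "finite (parcs G - collapsed_arcs G)"
      using pair_finite_arcs by blast
    show "lap_eigenspace G 2 \<noteq> {}"
      using zero_in_lap_eigenspace by blast
  qed (auto simp: collapsed_arcs_def lap_eigenspace_linear)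
  then obtain f where f: "f \<in> lap_eigenspace G 2" "\<forall>(a, b)\<in>parcs G - collapsed_arcs G. f a \<noteq> f b"
    by blast
  then have "collapsed_arcs G = {(x, y) \<in> parcs G. f x = f y}"
    by (auto simp: collapsed_arcs_def)
  with f(1) show thesis by (rule that)
qed

lemma square_function_eigenfunction:
  assumes G: "pair_graph G" "graph_connected G" "graph_regular G d" "CD_inf G 2"
    and f: "f \<in> lap_eigenspace G 2"
  shows "square_function (pverts G) (nbrs G) d f"
proof -
  interpret regular_nbrs "pverts G" "nbrs G" d
    using G(1,3) by (rule regular_nbrs_graph)
  have CD: "bochner g x \<ge> 0" if "x \<in> pverts G" for g x
    using G(4) that unfolding bochner_formula[OF G(1,3) that] CD_inf_def by simp
  have eig: "(\<Sum>y\<in>nbrs G x. f y - f x) = - 2 * f x" if "x \<in> pverts G" for x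
  proof -
    have "laplacian G f x + 2 * f x = 0"
      using f that by (simp add: lap_eigenspace_def)
    then show ?thesis
      unfolding laplacian_nbrs by linarith
  qed
  interpret midpoint_function "pverts G" "nbrs G" d f
    by unfold_locales (use eig eigenfunction_midpoint[OF CD eig] in auto)
  show ?thesis
  proof
    fix x z w
    assume xz: "x \<noteq> z" and "w \<in> nbrs G x" "w \<in> nbrs G z" and vis: "f w \<noteq> f x \<or> f w \<noteq> f z"
    then have w: "w \<in> nbrs G x \<inter> nbrs G z" by simp
    obtain w' where "w' \<noteq> w" "nbrs G x \<inter> nbrs G z = {w, w'}" "f w + f w' = f x + f z"
      by (rule visible_square[OF CD xz w vis])
    then show "\<exists>w'. w' \<noteq> w \<and> nbrs G x \<inter> nbrs G z = {w, w'} \<and> f w + f w' = f x + f z"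
      by blast
  next
    fix P x y assume "P x" "x \<in> pverts G" "y \<in> pverts G" "\<And>u v. P u \<Longrightarrow> v \<in> nbrs G u \<Longrightarrow> P v"
    then show "P y"
      using connected_induct[OF G(1,2), of x y P] by blast
  qed
qed

section \<open>The hypercube bundle\<close>

lemma digraph_isoI:
  assumes G: "pair_wf_digraph G" and H: "pair_wf_digraph H"
    and bij: "bij_betw h (pverts G) (pverts H)"
    and arcs: "\<And>x y. \<lbrakk>x \<in> pverts G; y \<in> pverts G\<rbrakk> \<Longrightarrow> (h x, h y) \<in> parcs H \<longleftrightarrow> (x, y) \<in> parcs G"
  shows "digraph_iso (with_proj G) (with_proj H)"
proof -
  interpret G: pair_wf_digraph G by fact
  interpret H: pair_wf_digraph H by fact
  define \<phi> where "\<phi> = \<lparr>iso_verts = h, iso_arcs = map_prod h h, iso_head = snd, iso_tail = fst\<rparr>"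
  have inj: "inj_on h (pverts G)" and img: "h ` pverts G = pverts H"
    using bij by (auto simp: bij_betw_def)
  have "inj_on (map_prod h h) (parcs G)"
    using map_prod_inj_on[OF inj inj] by (rule inj_on_subset) (use G.in_arcsD1 G.in_arcsD2 in auto)
  then have iso: "G.digraph_isomorphism \<phi>"
    using inj G.wf_digraph by (auto simp: G.digraph_isomorphism_def \<phi>_def)
  have "map_prod h h ` parcs G = parcs H"
  proof (intro equalityI subsetI)
    fix e assume "e \<in> parcs H"
    then obtain x y where "e = (h x, h y)" "x \<in> pverts G" "y \<in> pverts G"
      using H.in_arcsD1 H.in_arcsD2 img by (cases e) blast
    with \<open>e \<in> parcs H\<close> show "e \<in> map_prod h h ` parcs G"
      using arcs by force
  qed (use arcs G.in_arcsD1 G.in_arcsD2 in auto)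
  then have "with_proj H = app_iso \<phi> (with_proj G)"
    using img by (simp add: app_iso_def with_proj_def \<phi>_def)
  with iso show ?thesis
    unfolding digraph_iso_def by blast
qed

text \<open>
  A graph with a generic eigenfunction, one for which exactly the collapsed edges are flat.
\<close>

locale collapsed_structure = square_function "pverts G" "nbrs G" d f
  for G :: "'a pair_pre_digraph" and d f +
  assumes graph: "pair_graph G"
    and collapsed_arcs_eq: "collapsed_arcs G = {(x, y) \<in> parcs G. f x = f y}"
begin

lemma parcs_vis: "parcs (vis_graph G) = vis" and pverts_vis: "pverts (vis_graph G) = pverts G"
  by (auto simp: vis_graph_def collapsed_arcs_eq vis_def visible_def nbrs_def)

lemma nbrs_vis: "nbrs (vis_graph G) = visible"
  by (auto simp: nbrs_def[of "vis_graph G"] parcs_vis vis_def)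

definition vis_degree :: nat where "vis_degree = card (visible (SOME x. x \<in> pverts G))"

lemma card_visible_r: "x \<in> pverts G \<Longrightarrow> card (visible x) = vis_degree"
  unfolding vis_degree_def by (rule card_visible) (auto intro: someI)

lemma regular_vis: "graph_regular (vis_graph G) vis_degree"
  by (simp add: graph_regular_def out_degree_nbrs nbrs_vis pverts_vis card_visible_r)

text \<open>
  The component of \<open>x\<close> in the visible graph, identified by its bottom.
\<close>

definition fibre :: "'a \<Rightarrow> 'a set" where "fibre x = {y \<in> pverts G. bottom y = bottom x}"

lemma fibre_eq_iff: "x \<in> pverts G \<Longrightarrow> fibre x = fibre y \<longleftrightarrow> bottom x = bottom y"
  by (auto simp: fibre_def)

lemma fibre_self: "x \<in> pverts G \<Longrightarrow> x \<in> fibre x"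
  by (simp add: fibre_def)

lemma reach_vis: "u \<rightarrow>\<^sup>*\<^bsub>with_proj (vis_graph G)\<^esub> v \<longleftrightarrow> u \<in> pverts G \<and> bottom u = bottom v"
proof -
  have "pair_wf_digraph (vis_graph G)"
    using pair_graph_vis_graph[OF graph] by (simp add: pair_digraph.axioms pair_digraph_def
        pair_fin_digraph_def pair_graph.axioms(1) pair_graph_def)
  then show ?thesis
    by (simp add: reachable_with_proj parcs_vis pverts_vis vis_iff_bottom)
qed

lemma sccs_vis: "pre_digraph.sccs_verts (with_proj (vis_graph G)) = fibre ` pverts G"
proof (intro equalityI subsetI)
  fix S assume "S \<in> pre_digraph.sccs_verts (with_proj (vis_graph G))"
  then have S: "S \<noteq> {}" "\<And>u v. u \<in> S \<Longrightarrow> v \<in> S \<Longrightarrow> u \<in> pverts G \<and> bottom u = bottom v"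
    "\<And>u v. u \<in> S \<Longrightarrow> v \<notin> S \<Longrightarrow> \<not> (u \<in> pverts G \<and> bottom u = bottom v) \<or> \<not> (v \<in> pverts G \<and> bottom v = bottom u)"
    unfolding pre_digraph.sccs_verts_def reach_vis by blast+
  then obtain u where u: "u \<in> S" by blast
  have "S = fibre u"
  proof (intro equalityI subsetI)
    fix v assume "v \<in> S"
    then show "v \<in> fibre u"
      using S(2)[of v u] u by (simp add: fibre_def)
  next
    fix v assume "v \<in> fibre u"
    then have "v \<in> pverts G" "bottom v = bottom u" by (simp_all add: fibre_def)
    then show "v \<in> S"
      using S(3)[OF u, of v] S(2)[OF u u] by auto
  qed
  then show "S \<in> fibre ` pverts G"
    using S(2)[OF u u] by blast
next
  fix S assume "S \<in> fibre ` pverts G"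
  then obtain x where x: "x \<in> pverts G" "S = fibre x" by blast
  show "S \<in> pre_digraph.sccs_verts (with_proj (vis_graph G))"
    unfolding pre_digraph.sccs_verts_def reach_vis using x by (auto simp: fibre_def)
qed

lemma pverts_quotient: "pverts (vis_quotient G) = fibre ` pverts G"
  by (simp add: vis_quotient_def Let_def sccs_vis)

lemma quotient_arc_iff:
  assumes x: "x \<in> pverts G"
  shows "(fibre x, B) \<in> parcs (vis_quotient G) \<longleftrightarrow> (\<exists>y. y \<in> nbrs G x \<and> f y = f x \<and> B = fibre y)"
proof
  assume "(fibre x, B) \<in> parcs (vis_quotient G)"
  then have "\<exists>u\<in>fibre x. \<exists>v\<in>B. (u, v) \<in> collapsed_arcs G" and B: "B \<in> fibre ` pverts G"
    by (simp_all add: vis_quotient_def Let_def sccs_vis)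
  then obtain u v where u: "u \<in> fibre x" "v \<in> B" "v \<in> nbrs G u" "f v = f u"
    by (auto simp: collapsed_arcs_eq nbrs_def)
  then have "bottom x = bottom u" "B = fibre v"
    using B by (auto simp: fibre_def)
  then show "\<exists>y. y \<in> nbrs G x \<and> f y = f x \<and> B = fibre y"
    using collapsed_exists[OF u(3,4)] by (metis fibre_def)
next
  assume "\<exists>y. y \<in> nbrs G x \<and> f y = f x \<and> B = fibre y"
  then obtain y where y: "y \<in> nbrs G x" "f y = f x" "B = fibre y" by blast
  then have "y \<in> pverts G" using in_V by blast
  moreover have "fibre x \<noteq> fibre y"
    using collapsed_not_within[OF y(1,2)] x by (simp add: fibre_eq_iff)
  moreover have "(x, y) \<in> collapsed_arcs G"
    using y by (simp add: collapsed_arcs_eq nbrs_def)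
  ultimately show "(fibre x, B) \<in> parcs (vis_quotient G)"
    using x y fibre_self by (auto simp: vis_quotient_def Let_def sccs_vis)
qed

lemma quotient_arcE:
  assumes "(A, B) \<in> parcs (vis_quotient G)"
  obtains x where "x \<in> pverts G" "A = fibre x"
  using assms by (auto simp: vis_quotient_def Let_def sccs_vis)

lemma fibre_of_mem: "y \<in> fibre x \<Longrightarrow> fibre y = fibre x \<and> y \<in> pverts G"
  by (auto simp: fibre_def)

lemma quotient_arc_sym:
  assumes "(A, B) \<in> parcs (vis_quotient G)"
  shows "(B, A) \<in> parcs (vis_quotient G)"
proof -
  interpret Q: pair_graph "vis_quotient G"
    by (rule pair_graph_vis_quotient[OF graph])
  show ?thesis
    using assms by (rule Q.arcs_symmetric)
qed

text \<open>
  The end in \<open>B\<close> of the edge from \<open>x\<close> to the component \<open>B\<close>; for adjacent components this is the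
  isomorphism between them.
\<close>

definition partner :: "'a set \<Rightarrow> 'a \<Rightarrow> 'a" where "partner B x = (THE y. y \<in> B \<and> y \<in> nbrs G x)"

lemma partner_unique:
  assumes AB: "(A, B) \<in> parcs (vis_quotient G)" and x: "x \<in> A"
  shows "\<exists>!y. y \<in> B \<and> y \<in> nbrs G x" and "y \<in> B \<Longrightarrow> y \<in> nbrs G x \<Longrightarrow> f y = f x"
proof -
  have A: "A = fibre x" "x \<in> pverts G"
    using quotient_arcE[OF AB] x fibre_of_mem by metis+
  then obtain y where y: "y \<in> nbrs G x" "f y = f x" "B = fibre y"
    using AB quotient_arc_iff by blast
  have bottom: "bottom y \<noteq> bottom x"
    using y collapsed_not_within by blast
  have *: "f v = f x" if "v \<in> B" "v \<in> nbrs G x" for v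
    using that bottom bottom_visible[of v x] y by (auto simp: fibre_def visible_def)
  then show "y \<in> B \<Longrightarrow> y \<in> nbrs G x \<Longrightarrow> f y = f x" for y
    by blast
  show "\<exists>!y. y \<in> B \<and> y \<in> nbrs G x"
  proof (rule ex1I[of _ y])
    show "y \<in> B \<and> y \<in> nbrs G x"
      using y in_V fibre_self by blast
    show "v = y" if "v \<in> B \<and> v \<in> nbrs G x" for v
      using collapsed_unique[of v x y] that * y by (auto simp: fibre_def)
  qed
qed

lemma partner:
  assumes "(A, B) \<in> parcs (vis_quotient G)" "x \<in> A"
  shows "partner B x \<in> B" "partner B x \<in> nbrs G x" "f (partner B x) = f x"
    and partner_eqI: "\<And>y. y \<in> B \<Longrightarrow> y \<in> nbrs G x \<Longrightarrow> partner B x = y"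
  using theI'[OF partner_unique(1)[OF assms]] partner_unique[OF assms] unfolding partner_def by blast+

lemma partner_partner:
  assumes "(A, B) \<in> parcs (vis_quotient G)" "x \<in> A"
  shows "partner A (partner B x) = x"
  using partner_eqI[OF quotient_arc_sym[OF assms(1)] partner(1)[OF assms] assms(2)] partner(2)[OF assms] N_sym by blast

text \<open>
  The square through \<open>x'\<close>, \<open>x\<close> and the partner of \<open>x\<close> ends in the partner of \<open>x'\<close>.
\<close>

lemma partner_adjacent:
  assumes AB: "(A, B) \<in> parcs (vis_quotient G)" and x: "x \<in> A" "x' \<in> A" "x' \<in> nbrs G x"
  shows "partner B x' \<in> nbrs G (partner B x)"
proof -
  have A: "A = fibre x" "A = fibre x'" "x \<in> pverts G" "x' \<in> pverts G"
    using quotient_arcE[OF AB] x fibre_of_mem by metis+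
  then have "bottom x' = bottom x"
    by (metis fibre_eq_iff)
  then have "x' \<in> visible x"
    using collapsed_not_within x by (auto simp: visible_def)
  then obtain y' where y': "y' \<in> nbrs G x'" "y' \<in> visible (partner B x)" "bottom y' = bottom (partner B x)"
    using collapsed_transport[OF partner(2,3)[OF AB x(1)]] by blast
  have "partner B x \<in> B" by (rule partner(1)[OF AB x(1)])
  moreover obtain y0 where "B = fibre y0"
    using quotient_arcE[OF quotient_arc_sym[OF AB]] by blast
  moreover have "y' \<in> pverts G" using y' in_V by blast
  ultimately have "y' \<in> B"
    using y'(3) by (simp add: fibre_def)
  then have "partner B x' = y'"
    using partner_eqI[OF AB x(2)] y'(1) by blast
  then show ?thesis
    using y'(2) by (simp add: visible_def)
qed

text \<open>
  The coordinates of a component refer to an arbitrary enumeration of the neighbours of its bottom.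
\<close>

definition atom_enum :: "'a \<Rightarrow> nat \<Rightarrow> 'a" where "atom_enum b = (SOME e. bij_betw e {..<vis_degree} (upper b))"

definition coords :: "'a \<Rightarrow> nat \<Rightarrow> bit" where
  "coords x = (\<lambda>i\<in>{..<vis_degree}. if atom_enum (bottom x) i \<in> atoms x then 1 else 0)"

lemma atom_enum:
  assumes "x \<in> pverts G"
  shows "bij_betw (atom_enum (bottom x)) {..<vis_degree} (upper (bottom x))"
proof -
  have "visible (bottom x) = upper (bottom x)"
    using bottom(1)[of x] by (simp add: visible_split height_0_iff)
  then have "card (upper (bottom x)) = vis_degree"
    using card_visible_r[OF bottom_V[OF assms]] by simp
  then have "\<exists>e. bij_betw e {..<vis_degree} (upper (bottom x))"
    using finite_same_card_bij[of "{..<vis_degree}" "upper (bottom x)"] by simp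
  then show ?thesis
    unfolding atom_enum_def by (rule someI_ex)
qed

lemma pverts_hypercube: "pverts (hypercube n) = {..<n} \<rightarrow>\<^sub>E UNIV"
  by (simp add: hypercube_def)

lemma coords_hypercube: "coords x \<in> pverts (hypercube vis_degree)"
  by (simp add: pverts_hypercube coords_def)

lemma coords_inj:
  assumes x: "x \<in> pverts G" and bottom: "bottom x = bottom y" and coords: "coords x = coords y"
  shows "x = y"
proof (rule atoms_inj[OF bottom])
  have "a \<in> atoms x \<longleftrightarrow> a \<in> atoms y" if a: "a \<in> upper (bottom x)" for a
  proof -
    obtain i where i: "i < vis_degree" "a = atom_enum (bottom x) i"
      using atom_enum[OF x] a by (auto simp: bij_betw_def)
    have "coords x i = coords y i" using coords by simp
    then show ?thesis
      using i bottom by (simp add: coords_def split: if_splits)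
  qed
  then show "atoms x = atoms y"
    using atoms_subset[of x] atoms_subset[of y] bottom by auto
qed

lemma coords_surj:
  assumes x: "x \<in> pverts G" and u: "u \<in> pverts (hypercube vis_degree)"
  obtains y where "y \<in> fibre x" "coords y = u"
proof -
  have u': "u \<in> {..<vis_degree} \<rightarrow>\<^sub>E UNIV"
    using u by (simp add: pverts_hypercube)
  let ?T = "atom_enum (bottom x) ` {i. i < vis_degree \<and> u i = 1}"
  have e: "bij_betw (atom_enum (bottom x)) {..<vis_degree} (upper (bottom x))" by (rule atom_enum[OF x])
  then have "?T \<subseteq> upper (bottom x)" by (auto simp: bij_betw_def)
  then obtain y where y: "y \<in> pverts G" "bottom y = bottom x" "atoms y = ?T"
    using atoms_surj[OF bottom_V[OF x] bottom(1)] by blast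
  have "coords y = u"
  proof
    fix i
    show "coords y i = u i"
    proof (cases "i < vis_degree")
      case True
      have iff: "atom_enum (bottom x) i \<in> ?T \<longleftrightarrow> u i = 1"
      proof
        assume "atom_enum (bottom x) i \<in> ?T"
        then obtain j where "j < vis_degree" "u j = 1" "atom_enum (bottom x) i = atom_enum (bottom x) j"
          by blast
        then show "u i = 1"
          using e True inj_onD[of "atom_enum (bottom x)" "{..<vis_degree}" i j] by (simp add: bij_betw_def)
      qed (use True in blast)
      have "coords y i = (if atom_enum (bottom x) i \<in> ?T then 1 else 0)"
        using True by (simp only: coords_def y restrict_apply lessThan_iff if_True)
      then show ?thesis
        unfolding iff by (cases "u i") simp_all
    next
      case False
      then show ?thesis
        using PiE_arb[OF u', of i] by (simp add: coords_def)
    qed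
  qed
  then show thesis
    using that y by (simp add: fibre_def)
qed

lemma adjacent_iff_atoms:
  assumes x: "x \<in> pverts G" and y: "y \<in> pverts G" and bottom: "bottom x = bottom y"
  shows "y \<in> nbrs G x \<longleftrightarrow> card ((atoms x - atoms y) \<union> (atoms y - atoms x)) = 1"
proof
  assume xy: "y \<in> nbrs G x"
  then have "f y \<noteq> f x"
    using collapsed_not_within bottom by force
  then consider "y \<in> upper x" | "x \<in> upper y"
    using xy N_sym by (force simp: upper_def)
  then show "card ((atoms x - atoms y) \<union> (atoms y - atoms x)) = 1"
  proof cases
    case 1
    then obtain a where "a \<notin> atoms x" "atoms y = insert a (atoms x)" using atoms_upper by metis
    then have "(atoms x - atoms y) \<union> (atoms y - atoms x) = {a}" by auto
    then show ?thesis by simp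
  next
    case 2
    then obtain a where "a \<notin> atoms y" "atoms x = insert a (atoms y)" using atoms_upper by metis
    then have "(atoms x - atoms y) \<union> (atoms y - atoms x) = {a}" by auto
    then show ?thesis by simp
  qed
next
  have *: "y \<in> nbrs G x" if x: "x \<in> pverts G" and bottom: "bottom x = bottom y"
    and a: "a \<notin> atoms x" "atoms y = insert a (atoms x)" for x y a
  proof -
    have "a \<in> upper (bottom x)"
      using atoms_subset[of y] a bottom by auto
    then obtain z where z: "z \<in> upper x" "atoms z = insert a (atoms x)"
      using upper_neighbour_exists[OF x] a by blast
    moreover have "bottom z = bottom x"
      using atoms_upper[OF z(1)] by blast
    ultimately have "z = y"
      using atoms_inj[of z y] a bottom by simp
    then show ?thesis
      using z by (simp add: upper_def)
  qed
  assume "card ((atoms x - atoms y) \<union> (atoms y - atoms x)) = 1"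
  then obtain a where a: "(atoms x - atoms y) \<union> (atoms y - atoms x) = {a}"
    by (auto simp: card_1_singleton_iff)
  have mem: "(v \<in> atoms x \<longleftrightarrow> v \<in> atoms y) \<longleftrightarrow> v \<noteq> a" for v
    using eqset_imp_iff[OF a, of v] by simp blast
  show "y \<in> nbrs G x"
  proof (cases "a \<in> atoms x")
    case True
    then have "a \<notin> atoms y"
      using mem[of a] by simp
    moreover have "atoms x = insert a (atoms y)"
    proof (rule set_eqI)
      show "v \<in> atoms x \<longleftrightarrow> v \<in> insert a (atoms y)" for v
        using mem[of v] True by (cases "v = a") simp_all
    qed
    ultimately have "x \<in> nbrs G y"
      using *[OF y] bottom by simp
    then show ?thesis by (rule N_sym)
  next
    case False
    have "atoms y = insert a (atoms x)"
    proof (rule set_eqI)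
      show "v \<in> atoms y \<longleftrightarrow> v \<in> insert a (atoms x)" for v
        using mem[of v] False by (cases "v = a") simp_all
    qed
    then show ?thesis
      using *[OF x bottom False] by simp
  qed
qed

lemma coords_adjacent:
  assumes x: "x \<in> pverts G" and y: "y \<in> pverts G" and bottom: "bottom x = bottom y"
  shows "(coords x, coords y) \<in> parcs (hypercube vis_degree) \<longleftrightarrow> y \<in> nbrs G x"
proof -
  let ?D = "(atoms x - atoms y) \<union> (atoms y - atoms x)" and ?e = "atom_enum (bottom x)"
  have e: "inj_on ?e {..<vis_degree}" "?e ` {..<vis_degree} = upper (bottom x)"
    using atom_enum[OF x] by (auto simp: bij_betw_def)
  have sub: "?D \<subseteq> ?e ` {..<vis_degree}"
    unfolding e(2) using atoms_subset[of x] atoms_subset[of y] bottom by auto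
  have D: "{i \<in> {..<vis_degree}. coords x i \<noteq> coords y i} = {i \<in> {..<vis_degree}. ?e i \<in> ?D}"
    using bottom by (auto simp: coords_def)
  have im: "?e ` {i \<in> {..<vis_degree}. coords x i \<noteq> coords y i} = ?D"
  proof (intro equalityI subsetI)
    fix v assume "v \<in> ?D"
    moreover from this obtain i where "i \<in> {..<vis_degree}" "v = ?e i"
      using sub by blast
    ultimately show "v \<in> ?e ` {i \<in> {..<vis_degree}. coords x i \<noteq> coords y i}"
      unfolding D by (intro image_eqI[of _ _ i]) simp_all
  next
    fix v assume "v \<in> ?e ` {i \<in> {..<vis_degree}. coords x i \<noteq> coords y i}"
    then show "v \<in> ?D"
      unfolding D by blast
  qed
  have "inj_on ?e {i \<in> {..<vis_degree}. coords x i \<noteq> coords y i}"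
    using e(1) by (rule inj_on_subset) blast
  from card_image[OF this, unfolded im]
  have "card {i \<in> {..<vis_degree}. coords x i \<noteq> coords y i} = card ?D"
    by (rule sym)
  then show ?thesis
    using adjacent_iff_atoms[OF assms] coords_hypercube[of x] coords_hypercube[of y]
    by (simp add: hypercube_def)
qed

definition point_at :: "'a set \<Rightarrow> (nat \<Rightarrow> bit) \<Rightarrow> 'a" where "point_at A u = (THE x. x \<in> A \<and> coords x = u)"

lemma point_at_coords: "x \<in> pverts G \<Longrightarrow> point_at (fibre x) (coords x) = x"
  unfolding point_at_def by (rule the_equality) (auto simp: fibre_def intro: coords_inj)

lemma point_at:
  assumes "A \<in> fibre ` pverts G" "u \<in> pverts (hypercube vis_degree)"
  shows "point_at A u \<in> A" "coords (point_at A u) = u"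
proof -
  obtain x where "x \<in> pverts G" "A = fibre x" using assms by blast
  then obtain y where "y \<in> fibre x" "coords y = u" using coords_surj assms(2) by metis
  then show "point_at A u \<in> A" "coords (point_at A u) = u"
    using point_at_coords[of y] fibre_of_mem \<open>A = fibre x\<close> by auto
qed

definition twist :: "'a set \<Rightarrow> 'a set \<Rightarrow> (nat \<Rightarrow> bit) \<Rightarrow> nat \<Rightarrow> bit" where
  "twist A B u = coords (partner B (point_at A u))"

lemma quotient_arc_verts:
  "(A, B) \<in> parcs (vis_quotient G) \<Longrightarrow> A \<in> fibre ` pverts G \<and> B \<in> fibre ` pverts G"
  by (auto simp: vis_quotient_def Let_def sccs_vis)

lemma twist_coords:
  assumes AB: "(A, B) \<in> parcs (vis_quotient G)" and x: "x \<in> A"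
  shows "twist A B (coords x) = coords (partner B x)"
proof -
  have "A = fibre x" "x \<in> pverts G"
    using quotient_arcE[OF AB] x fibre_of_mem by metis+
  then show ?thesis
    by (simp add: twist_def point_at_coords)
qed

lemma twist_inverse:
  assumes AB: "(A, B) \<in> parcs (vis_quotient G)" and u: "u \<in> pverts (hypercube vis_degree)"
  shows "twist B A (twist A B u) = u"
proof -
  have p: "point_at A u \<in> A" "coords (point_at A u) = u"
    using point_at quotient_arc_verts[OF AB] u by auto
  have "twist A B u = coords (partner B (point_at A u))"
    by (simp add: twist_def)
  then have "twist B A (twist A B u) = coords (partner A (partner B (point_at A u)))"
    using twist_coords[OF quotient_arc_sym[OF AB] partner(1)[OF AB p(1)]] by simp
  then show ?thesis
    using partner_partner[OF AB p(1)] p(2) by simp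
qed

lemma twist_hypercube: "twist A B u \<in> pverts (hypercube vis_degree)"
  by (simp add: twist_def coords_hypercube)

lemma twist_arc:
  assumes AB: "(A, B) \<in> parcs (vis_quotient G)"
    and uv: "(u, v) \<in> parcs (hypercube vis_degree)"
  shows "(twist A B u, twist A B v) \<in> parcs (hypercube vis_degree)"
proof -
  have "u \<in> pverts (hypercube vis_degree)" "v \<in> pverts (hypercube vis_degree)"
    using uv by (auto simp: hypercube_def)
  then obtain x y where x: "x \<in> A" "coords x = u" and y: "y \<in> A" "coords y = v"
    using point_at quotient_arc_verts[OF AB] by metis
  have same: "bottom a = bottom b \<and> a \<in> pverts G \<and> b \<in> pverts G" if "a \<in> C" "b \<in> C" "C \<in> fibre ` pverts G" for a b C
    using that by (auto simp: fibre_def)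
  have "y \<in> nbrs G x"
    using coords_adjacent same[OF x(1) y(1)] quotient_arc_verts[OF AB] x y uv by blast
  then have "partner B y \<in> nbrs G (partner B x)"
    using partner_adjacent[OF AB x(1) y(1)] by blast
  moreover have "partner B x \<in> B" "partner B y \<in> B"
    using partner(1)[OF AB] x y by auto
  ultimately show ?thesis
    using coords_adjacent same quotient_arc_verts[OF AB] twist_coords[OF AB] x y by metis
qed

lemma bundle_twist_twist: "bundle_twist (vis_quotient G) (hypercube vis_degree) twist"
  unfolding bundle_twist_def
proof (intro ballI, clarify, intro conjI ballI)
  fix A B assume AB: "(A, B) \<in> parcs (vis_quotient G)"
  note BA = quotient_arc_sym[OF AB]
  show "twist B A (twist A B u) = u" if "u \<in> pverts (hypercube vis_degree)" for u
    using that by (rule twist_inverse[OF AB])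
  have "bij_betw (twist A B) (pverts (hypercube vis_degree)) (pverts (hypercube vis_degree))"
    by (rule bij_betw_byWitness[where f' = "twist B A"])
      (auto simp: twist_inverse[OF AB] twist_inverse[OF BA] twist_hypercube)
  moreover have "(twist A B u, twist A B v) \<in> parcs (hypercube vis_degree) \<longleftrightarrow> (u, v) \<in> parcs (hypercube vis_degree)"
    if "u \<in> pverts (hypercube vis_degree)" "v \<in> pverts (hypercube vis_degree)" for u v
    using twist_arc[OF AB, of u v] twist_arc[OF BA, of "twist A B u" "twist A B v"]
      twist_inverse[OF AB] that by auto
  ultimately show "twist A B \<in> graph_auts (hypercube vis_degree)"
    by (simp add: graph_auts_def)
qed

lemma bundle_iso:
  "digraph_iso (with_proj G) (with_proj (graph_bundle (vis_quotient G) (hypercube vis_degree) twist))"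
proof (rule digraph_isoI[where h = "\<lambda>x. (fibre x, coords x)"])
  have wf: "pair_wf_digraph H" if "pair_graph H" for H :: "'z pair_pre_digraph"
  proof -
    interpret pair_graph H by fact
    show ?thesis by (rule pair_wf_digraph)
  qed
  show "pair_wf_digraph G" by (rule wf[OF graph])
  show "pair_wf_digraph (graph_bundle (vis_quotient G) (hypercube vis_degree) twist)"
  proof -
    interpret pair_graph "graph_bundle (vis_quotient G) (hypercube vis_degree) twist"
      by (rule pair_graph_graph_bundle[OF pair_graph_vis_quotient[OF graph] pair_graph_hypercube
            bundle_twist_twist])
    show ?thesis by (rule pair_wf_digraph)
  qed
  show "bij_betw (\<lambda>x. (fibre x, coords x)) (pverts G)
      (pverts (graph_bundle (vis_quotient G) (hypercube vis_degree) twist))"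
  proof (rule bij_betw_byWitness[where f' = "\<lambda>(A, u). point_at A u"])
    show "\<forall>x\<in>pverts G. (case (fibre x, coords x) of (A, u) \<Rightarrow> point_at A u) = x"
      by (simp add: point_at_coords)
    show "\<forall>p\<in>pverts (graph_bundle (vis_quotient G) (hypercube vis_degree) twist).
        (fibre (case p of (A, u) \<Rightarrow> point_at A u), coords (case p of (A, u) \<Rightarrow> point_at A u)) = p"
      using point_at fibre_of_mem by (auto simp: graph_bundle_def pverts_quotient)
    show "(\<lambda>x. (fibre x, coords x)) ` pverts G
        \<subseteq> pverts (graph_bundle (vis_quotient G) (hypercube vis_degree) twist)"
      by (auto simp: graph_bundle_def pverts_quotient coords_hypercube)
    show "(\<lambda>(A, u). point_at A u) ` pverts (graph_bundle (vis_quotient G) (hypercube vis_degree) twist) \<subseteq> pverts G"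
      using point_at fibre_of_mem by (fastforce simp: graph_bundle_def pverts_quotient)
  qed
next
  fix x y assume x: "x \<in> pverts G" and y: "y \<in> pverts G"
  have arc_iff: "((fibre x, coords x), (fibre y, coords y)) \<in> parcs (graph_bundle (vis_quotient G) (hypercube vis_degree) twist)
      \<longleftrightarrow> (fibre x, fibre y) \<in> parcs (vis_quotient G) \<and> coords y = twist (fibre x) (fibre y) (coords x)
        \<or> fibre x = fibre y \<and> (coords x, coords y) \<in> parcs (hypercube vis_degree)"
    using x coords_hypercube[of x] by (auto simp: graph_bundle_def pverts_quotient)
  have "((fibre x, coords x), (fibre y, coords y)) \<in> parcs (graph_bundle (vis_quotient G) (hypercube vis_degree) twist)
      \<longleftrightarrow> y \<in> nbrs G x"
  proof (cases "bottom x = bottom y")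
    case True
    then have "fibre x = fibre y" by (simp add: fibre_def)
    moreover have "(fibre x, fibre x) \<notin> parcs (vis_quotient G)"
      by (auto simp: vis_quotient_def Let_def)
    ultimately show ?thesis
      unfolding arc_iff using coords_adjacent[OF x y True] by auto
  next
    case False
    then have ne: "fibre x \<noteq> fibre y" using fibre_eq_iff[OF x] by simp
    have "y \<in> nbrs G x" if Q: "(fibre x, fibre y) \<in> parcs (vis_quotient G)"
      and l: "coords y = twist (fibre x) (fibre y) (coords x)"
    proof -
      have "coords y = coords (partner (fibre y) x)"
        using l twist_coords[OF Q fibre_self[OF x]] by simp
      moreover have "bottom y = bottom (partner (fibre y) x)"
        using partner(1)[OF Q fibre_self[OF x]] by (simp add: fibre_def)
      ultimately have "y = partner (fibre y) x"
        using coords_inj[OF y] by blast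
      then show ?thesis
        using partner(2)[OF Q fibre_self[OF x]] by simp
    qed
    moreover have "(fibre x, fibre y) \<in> parcs (vis_quotient G) \<and> coords y = twist (fibre x) (fibre y) (coords x)"
      if xy: "y \<in> nbrs G x"
    proof -
      have "f y = f x"
        using xy False bottom_visible[of y x] by (auto simp: visible_def)
      then have Q: "(fibre x, fibre y) \<in> parcs (vis_quotient G)"
        using xy quotient_arc_iff[OF x] by blast
      then show ?thesis
        using twist_coords[OF Q fibre_self[OF x]] partner_eqI[OF Q fibre_self[OF x] fibre_self[OF y] xy] by simp
    qed
    ultimately show ?thesis
      unfolding arc_iff using ne by blast
  qed
  then show "((fibre x, coords x), (fibre y, coords y)) \<in> parcs (graph_bundle (vis_quotient G) (hypercube vis_degree) twist)
      \<longleftrightarrow> (x, y) \<in> parcs G"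
    by (simp add: nbrs_def)
qed

text \<open>
  The section consists of the bottoms. They have coordinates zero in their components, and partners of
  bottoms are bottoms because the height is constant along collapsed edges.
\<close>

lemma bundle_section_zero:
  "bundle_section (vis_quotient G) (hypercube vis_degree) twist (\<lambda>A. (A, \<lambda>i\<in>{..<vis_degree}. 0))"
proof -
  let ?z = "\<lambda>i\<in>{..<vis_degree}. 0 :: bit"
  have z: "?z \<in> pverts (hypercube vis_degree)"
    by (simp add: pverts_hypercube)
  have lab0: "coords x = ?z" if "height x = 0" for x
    using atoms_height_0[OF that] by (simp add: coords_def)
  have "twist A B ?z = ?z" if AB: "(A, B) \<in> parcs (vis_quotient G)" for A B
  proof -
    obtain x where x: "x \<in> pverts G" "A = fibre x"
      using quotient_arcE[OF AB] by blast
    have b: "bottom x \<in> A"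
      using x bottom_V bottom_height_0[OF bottom(1)] by (simp add: fibre_def)
    have "height (partner B (bottom x)) = 0"
      using height_collapsed[OF partner(2,3)[OF AB b]] bottom(1) by simp
    then show ?thesis
      using twist_coords[OF AB b] lab0 bottom(1) by metis
  qed
  then have "((A, ?z), (B, ?z)) \<in> parcs (graph_bundle (vis_quotient G) (hypercube vis_degree) twist)"
    if "(A, B) \<in> parcs (vis_quotient G)" for A B
    using that z by (force simp: graph_bundle_def)
  then show ?thesis
    using z by (auto simp: bundle_section_def graph_bundle_def)
qed

end

section \<open>The spectrum of a regular graph\<close>

lemma finite_support_in_span:
  assumes "finite A" "\<And>x. x \<notin> A \<Longrightarrow> f x = 0"
  shows "f \<in> fun_space.span ((\<lambda>v x. if x = v then 1 else 0) ` A)"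
  using assms
proof (induction A arbitrary: f)
  case empty
  then have "f = 0" by (simp add: fun_eq_iff)
  show ?case
    unfolding \<open>f = 0\<close> by (rule fun_space.span_zero)
next
  case (insert a A)
  let ?e = "\<lambda>v x. if x = v then 1 else 0 :: real"
  have "(\<lambda>x. if x = a then 0 else f x) \<in> fun_space.span (?e ` A)"
    using insert by auto
  then have 1: "(\<lambda>x. if x = a then 0 else f x) \<in> fun_space.span (?e ` insert a A)"
    using fun_space.span_mono[of "?e ` A" "?e ` insert a A"] by blast
  have 2: "(\<lambda>x. f a * ?e a x) \<in> fun_space.span (?e ` insert a A)"
    by (intro fun_space.span_scale fun_space.span_base) simp
  have "f = (\<lambda>x. if x = a then 0 else f x) + (\<lambda>x. f a * ?e a x)"
    by (auto simp: fun_eq_iff)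
  then show ?case
    using fun_space.span_add[OF 1 2] by simp
qed

lemma dim_pos:
  assumes B: "finite B" and S: "S \<subseteq> fun_space.span B" and f: "f \<in> S" "f \<noteq> (\<lambda>_. 0)"
  shows "fun_space.dim S > 0"
proof -
  obtain C where C: "C \<subseteq> S" "fun_space.independent C" "S \<subseteq> fun_space.span C" "card C = fun_space.dim S"
    by (rule fun_space.basis_exists)
  have "finite C"
    using fun_space.independent_span_bound[OF B C(2)] C(1) S by blast
  moreover have "C \<noteq> {}"
    using C(3) f by (auto simp: zero_fun_def)
  ultimately show ?thesis
    using C(4) by (metis card_gt_0_iff)
qed

lemma lap_eigenspace_in_span:
  assumes "finite (pverts G)"
  shows "lap_eigenspace G c \<subseteq> fun_space.span ((\<lambda>v x. if x = v then 1 else 0) ` pverts G)"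
proof
  fix f assume "f \<in> lap_eigenspace G c"
  then show "f \<in> fun_space.span ((\<lambda>v x. if x = v then 1 else 0) ` pverts G)"
    using assms by (intro finite_support_in_span) (auto simp: lap_eigenspace_def)
qed

locale regular_graph = regular_nbrs "pverts G" "nbrs G" d for G :: "'a pair_pre_digraph" and d
begin

lemma sum_laplacian:
  "(\<Sum>x\<in>pverts G. f x * laplacian G g x) = - (\<Sum>x\<in>pverts G. \<Sum>y\<in>nbrs G x. (f y - f x) * (g y - g x)) / 2"
proof -
  have "(\<Sum>x\<in>pverts G. \<Sum>y\<in>nbrs G x. f y * (g y - g x))
      = (\<Sum>x\<in>pverts G. \<Sum>y\<in>nbrs G x. f x * (g x - g y))"
    by (rule sum_edges_swap)
  also have "\<dots> = - (\<Sum>x\<in>pverts G. \<Sum>y\<in>nbrs G x. f x * (g y - g x))"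
    by (simp add: sum_negf[symmetric] algebra_simps)
  finally have "(\<Sum>x\<in>pverts G. \<Sum>y\<in>nbrs G x. (f y - f x) * (g y - g x))
      = - 2 * (\<Sum>x\<in>pverts G. \<Sum>y\<in>nbrs G x. f x * (g y - g x))"
    by (simp add: left_diff_distrib sum_subtractf)
  moreover have "(\<Sum>x\<in>pverts G. f x * laplacian G g x)
      = (\<Sum>x\<in>pverts G. \<Sum>y\<in>nbrs G x. f x * (g y - g x))"
    by (simp add: laplacian_nbrs sum_distrib_left)
  ultimately show ?thesis
    by linarith
qed

lemma laplacian_self_adjoint:
  "(\<Sum>x\<in>pverts G. f x * laplacian G g x) = (\<Sum>x\<in>pverts G. g x * laplacian G f x)"
  unfolding sum_laplacian by (simp add: mult.commute)

lemma eigenfunction_laplacian: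
  "f \<in> lap_eigenspace G c \<Longrightarrow> x \<in> pverts G \<Longrightarrow> laplacian G f x = - c * f x"
  by (auto simp: lap_eigenspace_def add_eq_0_iff2)

lemma eigenspaces_orthogonal:
  assumes f: "f \<in> lap_eigenspace G a" and g: "g \<in> lap_eigenspace G b" and "a \<noteq> b"
  shows "(\<Sum>x\<in>pverts G. f x * g x) = 0"
proof -
  have "- b * (\<Sum>x\<in>pverts G. f x * g x) = (\<Sum>x\<in>pverts G. f x * laplacian G g x)"
    using eigenfunction_laplacian[OF g] by (simp add: sum_distrib_left mult_ac sum_negf)
  also have "\<dots> = (\<Sum>x\<in>pverts G. g x * laplacian G f x)"
    by (rule laplacian_self_adjoint)
  also have "\<dots> = - a * (\<Sum>x\<in>pverts G. f x * g x)"
    using eigenfunction_laplacian[OF f] by (simp add: sum_distrib_left mult_ac sum_negf)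
  finally show ?thesis
    using \<open>a \<noteq> b\<close> by simp
qed

lemma sum_squares_pos:
  assumes "f \<in> lap_eigenspace G c" "f \<noteq> (\<lambda>_. 0)"
  shows "(\<Sum>x\<in>pverts G. f x * f x) > 0"
proof -
  obtain x where "f x \<noteq> 0" using assms by auto
  moreover from this have "x \<in> pverts G" using assms by (auto simp: lap_eigenspace_def)
  ultimately show ?thesis
    using finite_V by (intro sum_pos2[of _ x]) (auto simp: zero_less_mult_iff)
qed

text \<open>
  Eigenfunctions for different eigenvalues are orthogonal, hence linearly independent. Finiteness is what
  gives the multiset sum in the definition of the spectrum its intended meaning.
\<close>

lemma finite_lap_eigenvalues: "finite (lap_eigenvalues G)"
proof -
  have "\<forall>c\<in>lap_eigenvalues G. \<exists>f. f \<in> lap_eigenspace G c \<and> f \<noteq> (\<lambda>_. 0)"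
    by (auto simp: lap_eigenvalues_def)
  then obtain e where e: "\<And>c. c \<in> lap_eigenvalues G \<Longrightarrow> e c \<in> lap_eigenspace G c \<and> e c \<noteq> (\<lambda>_. 0)"
    by metis
  let ?B = "(\<lambda>v x. if x = v then 1 else 0 :: real) ` pverts G"
  let ?ip = "\<lambda>f g. \<Sum>x\<in>pverts G. f x * g x :: real"
  have orth: "?ip (e a) (e b) = 0" if "a \<in> lap_eigenvalues G" "b \<in> lap_eigenvalues G" "a \<noteq> b" for a b
    using eigenspaces_orthogonal e that by blast
  have pos: "?ip (e a) (e a) \<noteq> 0" if "a \<in> lap_eigenvalues G" for a
    using sum_squares_pos[of "e a" a] e[OF that] by force
  have inj: "inj_on e (lap_eigenvalues G)"
  proof (rule inj_onI, rule ccontr)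
    fix a b assume ab: "a \<in> lap_eigenvalues G" "b \<in> lap_eigenvalues G" "e a = e b" "a \<noteq> b"
    then show False using orth[of a b] pos[of a] by simp
  qed
  have "card C \<le> card ?B" if C: "C \<subseteq> lap_eigenvalues G" "finite C" for C
  proof -
    have "fun_space.independent (e ` C)"
    proof (rule ccontr)
      assume "\<not> fun_space.independent (e ` C)"
      then obtain u c where c: "c \<in> C" "u (e c) \<noteq> 0"
        and zero: "(\<Sum>v\<in>e ` C. (\<lambda>x. u v * v x)) = 0"
        using fun_space.dependent_finite[of "e ` C"] C(2) by auto
      have sum_apply: "(\<Sum>v\<in>T. (\<lambda>x. u v * v x)) x = (\<Sum>v\<in>T. u v * v x)" if "finite T" for T x
        using that by (induction T) auto
      have "0 = ?ip (e c) (\<Sum>v\<in>e ` C. (\<lambda>x. u v * v x))"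
        unfolding zero by simp
      also have "\<dots> = (\<Sum>x\<in>pverts G. \<Sum>v\<in>e ` C. u v * (e c x * v x))"
        unfolding sum_apply[OF finite_imageI[OF C(2)]] by (simp add: sum_distrib_left mult_ac)
      also have "\<dots> = (\<Sum>v\<in>e ` C. u v * ?ip (e c) v)"
        by (subst sum.swap) (simp add: sum_distrib_left)
      also have "\<dots> = (\<Sum>a\<in>C. u (e a) * ?ip (e c) (e a))"
        using inj_on_subset[OF inj C(1)] by (simp add: sum.reindex)
      also have "\<dots> = (\<Sum>a\<in>C. if a = c then u (e c) * ?ip (e c) (e c) else 0)"
        using orth c C(1) by (intro sum.cong refl) auto
      also have "\<dots> = u (e c) * ?ip (e c) (e c)"
        using c C(2) by simp
      finally show False
        using c pos[of c] C(1) by auto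
    qed
    moreover have "e ` C \<subseteq> fun_space.span ?B"
      using e C(1) lap_eigenspace_in_span[OF finite_V] by blast
    ultimately have "card (e ` C) \<le> card ?B"
      using fun_space.independent_span_bound[of ?B "e ` C"] finite_V by blast
    then show ?thesis
      using card_image[OF inj_on_subset[OF inj C(1)]] by simp
  qed
  then show ?thesis
    using finite_if_finite_subsets_card_bdd by blast
qed

lemma dim_eigenspace_pos:
  assumes "c \<in> lap_eigenvalues G"
  shows "fun_space.dim (lap_eigenspace G c) > 0"
proof -
  obtain f where "f \<in> lap_eigenspace G c" "f \<noteq> (\<lambda>_. 0)"
    using assms unfolding lap_eigenvalues_def by blast
  then show ?thesis
    by (rule dim_pos[OF finite_imageI[OF finite_V] lap_eigenspace_in_span[OF finite_V]])
qed

lemma count_lap_spectrum: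
  "count (mset (lap_spectrum G)) c
    = (if c \<in> lap_eigenvalues G then fun_space.dim (lap_eigenspace G c) else 0)"
  using finite_lap_eigenvalues by (simp add: lap_spectrum_def count_sum)

lemma set_lap_spectrum: "set (lap_spectrum G) = lap_eigenvalues G"
proof -
  have "c \<in> set (lap_spectrum G) \<longleftrightarrow> c \<in> lap_eigenvalues G" for c
    using count_lap_spectrum[of c] dim_eigenspace_pos[of c]
    by (metis count_greater_zero_iff less_irrefl set_mset_mset)
  then show ?thesis by blast
qed

lemma sorted_lap_spectrum: "sorted (lap_spectrum G)"
  by (simp add: lap_spectrum_def)

lemma zero_eigenvalue:
  assumes "pverts G \<noteq> {}"
  shows "0 \<in> lap_eigenvalues G"
proof -
  let ?f = "\<lambda>x. if x \<in> pverts G then 1 else 0 :: real"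
  have "laplacian G ?f x = 0" if "x \<in> pverts G" for x
    unfolding laplacian_nbrs using that in_V by (intro sum.neutral) auto
  then have "?f \<in> lap_eigenspace G 0"
    by (simp add: lap_eigenspace_def)
  moreover have "?f \<noteq> (\<lambda>_. 0)"
    using assms by (auto simp: fun_eq_iff)
  ultimately show ?thesis
    unfolding lap_eigenvalues_def by blast
qed

text \<open>
  The eigenvalue 0 occupies the first place of the sorted list, which is the only place that can hold a
  value below the second entry.
\<close>

lemma eigenvalues_ge_second:
  assumes "pverts G \<noteq> {}" and len: "1 < length (lap_spectrum G)" and pos: "lap_spectrum G ! 1 > 0"
    and c: "c \<in> lap_eigenvalues G" "c \<noteq> 0"
  shows "lap_spectrum G ! 1 \<le> c"
proof (rule ccontr)
  assume less: "\<not> lap_spectrum G ! 1 \<le> c"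
  have first: "i = 0" if "i < length (lap_spectrum G)" "lap_spectrum G ! i < lap_spectrum G ! 1" for i
  proof (rule ccontr)
    assume "i \<noteq> 0"
    then have "lap_spectrum G ! 1 \<le> lap_spectrum G ! i"
      using sorted_lap_spectrum that(1) by (intro sorted_nth_mono) auto
    with that(2) show False by simp
  qed
  obtain i j where "i < length (lap_spectrum G)" "lap_spectrum G ! i = 0"
    "j < length (lap_spectrum G)" "lap_spectrum G ! j = c"
    using zero_eigenvalue[OF assms(1)] c(1) unfolding set_lap_spectrum[symmetric] in_set_conv_nth by blast
  then show False
    using first[of i] first[of j] pos less c(2) by simp
qed

lemma second_eigenvalue_greater:
  assumes zero: "fun_space.dim (lap_eigenspace G 0) \<le> 1"
    and c: "c \<in> lap_eigenvalues G" "c \<noteq> 0" and V: "pverts G \<noteq> {}"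
    and gap: "\<And>a. a \<in> lap_eigenvalues G \<Longrightarrow> a \<noteq> 0 \<Longrightarrow> a > b" and b: "b \<ge> 0"
  shows "1 < length (lap_spectrum G) \<and> lap_spectrum G ! 1 > b"
proof -
  have "{0, c} \<subseteq> set (lap_spectrum G)"
    using zero_eigenvalue[OF V] c by (simp add: set_lap_spectrum)
  then have "card {0, c} \<le> card (set (lap_spectrum G))"
    by (intro card_mono) auto
  also have "\<dots> \<le> length (lap_spectrum G)"
    by (rule card_length)
  finally have len: "1 < length (lap_spectrum G)"
    using c by simp
  obtain u v l where l: "lap_spectrum G = u # v # l"
  proof (cases "lap_spectrum G")
    case (Cons u l')
    then show thesis
      using that len by (cases l') auto
  qed (use len in simp)
  have ev: "u \<in> lap_eigenvalues G" "v \<in> lap_eigenvalues G"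
    using set_lap_spectrum l by auto
  have "v \<noteq> 0"
  proof
    assume v: "v = 0"
    have "u \<le> v"
      using sorted_lap_spectrum l by simp
    then have "u = 0"
      using gap[OF ev(1)] b v by force
    then have "count (mset (lap_spectrum G)) 0 \<ge> 2"
      using l v by simp
    then show False
      using count_lap_spectrum[of 0] zero by (simp split: if_splits)
  qed
  then show ?thesis
    using gap[OF ev(2)] l len by simp
qed

definition mean_zero :: "('a \<Rightarrow> real) set" where
  "mean_zero = {f. (\<forall>x. x \<notin> pverts G \<longrightarrow> f x = 0) \<and> (\<Sum>x\<in>pverts G. f x) = 0}"

definition energy :: "('a \<Rightarrow> real) \<Rightarrow> real" where
  "energy f = (\<Sum>x\<in>pverts G. \<Sum>y\<in>nbrs G x. (f y - f x)\<^sup>2) / 2"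

lemma energy_laplacian: "energy f = - (\<Sum>x\<in>pverts G. f x * laplacian G f x)"
  by (simp add: energy_def sum_laplacian power2_eq_square)

text \<open>
  The sphere is a closed subset of a product of compact intervals, so Tychonov's theorem applies.
\<close>

lemma compact_unit_sphere: "compact {f \<in> mean_zero. (\<Sum>x\<in>pverts G. (f x)\<^sup>2) = 1}"
proof -
  let ?K = "PiE UNIV (\<lambda>x. if x \<in> pverts G then {-1..1} else {0 :: real})"
  have "compactin (product_topology (\<lambda>i. euclidean) UNIV) ?K"
    unfolding compactin_PiE by simp
  then have "compact ?K"
    by (simp add: euclidean_product_topology)
  moreover have "closed {f. (\<Sum>x\<in>pverts G. f x) = (0 :: real)}"
    by (intro closed_Collect_eq continuous_on_sum continuous_on_product_coordinates continuous_on_const)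
  moreover have "closed {f. (\<Sum>x\<in>pverts G. (f x)\<^sup>2) = (1 :: real)}"
    by (intro closed_Collect_eq continuous_on_sum continuous_on_power
        continuous_on_product_coordinates continuous_on_const)
  ultimately have "compact ((?K \<inter> {f. (\<Sum>x\<in>pverts G. f x) = 0}) \<inter> {f. (\<Sum>x\<in>pverts G. (f x)\<^sup>2) = 1})"
    by (intro compact_Int_closed)
  also have "(?K \<inter> {f. (\<Sum>x\<in>pverts G. f x) = 0}) \<inter> {f. (\<Sum>x\<in>pverts G. (f x)\<^sup>2) = 1}
      = {f \<in> mean_zero. (\<Sum>x\<in>pverts G. (f x)\<^sup>2) = 1}"
  proof (intro equalityI subsetI)
    fix f assume f: "f \<in> {f \<in> mean_zero. (\<Sum>x\<in>pverts G. (f x)\<^sup>2) = 1}"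
    have "f x \<in> {-1..1}" if "x \<in> pverts G" for x
    proof -
      have "(f x)\<^sup>2 \<le> (\<Sum>x\<in>pverts G. (f x)\<^sup>2)"
        using that finite_V by (intro member_le_sum) auto
      then have "(f x)\<^sup>2 \<le> 1" using f by simp
      then show ?thesis by (auto simp: abs_square_le_1 abs_le_iff)
    qed
    with f show "f \<in> (?K \<inter> {f. (\<Sum>x\<in>pverts G. f x) = 0}) \<inter> {f. (\<Sum>x\<in>pverts G. (f x)\<^sup>2) = 1}"
      by (auto simp: mean_zero_def)
  next
    fix f assume f: "f \<in> (?K \<inter> {f. (\<Sum>x\<in>pverts G. f x) = 0}) \<inter> {f. (\<Sum>x\<in>pverts G. (f x)\<^sup>2) = 1}"
    then have "f x \<in> (if x \<in> pverts G then {-1..1} else {0})" for x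
      by (auto simp: PiE_def Pi_def)
    then have "f x = 0" if "x \<notin> pverts G" for x
      using that by (metis singletonD)
    with f show "f \<in> {f \<in> mean_zero. (\<Sum>x\<in>pverts G. (f x)\<^sup>2) = 1}"
      by (auto simp: mean_zero_def)
  qed
  finally show ?thesis .
qed

lemma continuous_energy: "continuous_on S energy"
proof -
  have "continuous_on UNIV energy"
    unfolding energy_def
    by (intro continuous_on_divide continuous_on_sum continuous_on_power continuous_on_diff
        continuous_on_product_coordinates continuous_on_const) simp
  then show ?thesis
    by (rule continuous_on_subset) simp
qed

lemma energy_scale: "energy (\<lambda>x. t * f x) = t\<^sup>2 * energy f"
  unfolding energy_def
  by (simp add: right_diff_distrib[symmetric] power_mult_distrib sum_distrib_left[symmetric])

lemma energy_add:
  "energy (\<lambda>x. g x + t * h x) = energy g - 2 * t * (\<Sum>x\<in>pverts G. h x * laplacian G g x) + t\<^sup>2 * energy h"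
proof -
  have lin: "laplacian G (\<lambda>x. g x + t * h x) x = laplacian G g x + t * laplacian G h x" for x
    unfolding laplacian_nbrs sum_distrib_left sum.distrib[symmetric]
    by (intro sum.cong refl) (simp add: algebra_simps)
  have "energy (\<lambda>x. g x + t * h x) = - (\<Sum>x\<in>pverts G. g x * laplacian G g x + t * (g x * laplacian G h x)
      + t * (h x * laplacian G g x) + t\<^sup>2 * (h x * laplacian G h x))"
    unfolding energy_laplacian lin
    by (intro arg_cong[where f = uminus] sum.cong refl) (simp add: algebra_simps power2_eq_square)
  also have "\<dots> = energy g - t * (\<Sum>x\<in>pverts G. g x * laplacian G h x)
      - t * (\<Sum>x\<in>pverts G. h x * laplacian G g x) + t\<^sup>2 * energy h"
    by (simp add: sum.distrib sum_distrib_left[symmetric] energy_laplacian)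
  finally show ?thesis
    unfolding laplacian_self_adjoint[of g h] by simp
qed

lemma mean_zero_scale: "f \<in> mean_zero \<Longrightarrow> (\<lambda>x. t * f x) \<in> mean_zero"
  by (simp add: mean_zero_def sum_distrib_left[symmetric])

lemma mean_zero_add: "f \<in> mean_zero \<Longrightarrow> g \<in> mean_zero \<Longrightarrow> (\<lambda>x. f x + t * g x) \<in> mean_zero"
  by (simp add: mean_zero_def sum.distrib sum_distrib_left[symmetric])

lemma rayleigh_minimiser:
  assumes ab: "a \<in> pverts G" "b \<in> pverts G" "a \<noteq> b"
  obtains g where "g \<in> mean_zero" "(\<Sum>x\<in>pverts G. (g x)\<^sup>2) = 1"
    "\<And>h. h \<in> mean_zero \<Longrightarrow> energy g * (\<Sum>x\<in>pverts G. (h x)\<^sup>2) \<le> energy h"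
proof -
  let ?S = "{f \<in> mean_zero. (\<Sum>x\<in>pverts G. (f x)\<^sup>2) = 1}"
  have normalise: "(\<lambda>x. (1 / sqrt s) * h x) \<in> ?S"
    if h: "h \<in> mean_zero" and s: "s = (\<Sum>x\<in>pverts G. (h x)\<^sup>2)" "s > 0" for h s
  proof -
    have "(\<Sum>x\<in>pverts G. ((1 / sqrt s) * h x)\<^sup>2) = (1 / sqrt s)\<^sup>2 * s"
      by (simp only: power_mult_distrib sum_distrib_left[symmetric] s(1))
    also have "\<dots> = 1"
      using s(2) by (simp add: power_divide)
    finally show ?thesis
      using mean_zero_scale[OF h, of "1 / sqrt s"] by simp
  qed
  define h0 where "h0 x = (if x = a then 1 else 0) - (if x = b then 1 else 0 :: real)" for x
  have h0: "h0 \<in> mean_zero"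
    using ab finite_V by (auto simp: mean_zero_def h0_def sum_subtractf)
  have "(\<Sum>x\<in>pverts G. (h0 x)\<^sup>2) > 0"
    using ab finite_V by (intro sum_pos2[of _ a]) (auto simp: h0_def)
  then have "?S \<noteq> {}"
    using normalise[OF h0 refl] by blast
  then obtain g where g: "g \<in> ?S" "\<And>h. h \<in> ?S \<Longrightarrow> energy g \<le> energy h"
    using continuous_attains_inf[OF compact_unit_sphere _ continuous_energy] by blast
  have "energy g * (\<Sum>x\<in>pverts G. (h x)\<^sup>2) \<le> energy h" if h: "h \<in> mean_zero" for h
  proof (cases "(\<Sum>x\<in>pverts G. (h x)\<^sup>2) = 0")
    case True
    then show ?thesis
      by (simp add: energy_def sum_nonneg)
  next
    case False
    define s where "s = (\<Sum>x\<in>pverts G. (h x)\<^sup>2)"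
    have s: "s > 0"
      using False unfolding s_def by (simp add: sum_nonneg order_less_le)
    have "energy g \<le> energy (\<lambda>x. (1 / sqrt s) * h x)"
      using g(2) normalise[OF h s_def s] by blast
    also have "\<dots> = energy h / s"
      unfolding energy_scale using s by (simp add: power_divide)
    finally show ?thesis
      using s by (simp add: s_def[symmetric] pos_le_divide_eq)
  qed
  with g(1) show thesis
    using that by blast
qed

text \<open>
  A minimiser \<open>g\<close> of the Rayleigh quotient on the functions with mean zero is an eigenfunction: the
  residual \<open>w = Lg + cg\<close> has mean zero itself, and the first variation in its direction is
  \<open>- 2 \<Sum> w\<^sup>2\<close>.
\<close>

lemma nonconstant_eigenfunction:
  assumes ab: "a \<in> pverts G" "b \<in> pverts G" "a \<noteq> b"
  obtains g c where "g \<in> lap_eigenspace G c" "g \<in> mean_zero" "g \<noteq> (\<lambda>_. 0)"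
proof -
  obtain g where g: "g \<in> mean_zero" "(\<Sum>x\<in>pverts G. (g x)\<^sup>2) = 1"
    and min: "\<And>h. h \<in> mean_zero \<Longrightarrow> energy g * (\<Sum>x\<in>pverts G. (h x)\<^sup>2) \<le> energy h"
    using rayleigh_minimiser[OF ab] by blast
  define c where "c = energy g"
  define w where "w x = (if x \<in> pverts G then laplacian G g x + c * g x else 0)" for x
  have "(\<Sum>x\<in>pverts G. w x) = (\<Sum>x\<in>pverts G. 1 * laplacian G g x) + c * (\<Sum>x\<in>pverts G. g x)"
    by (simp add: w_def sum.distrib sum_distrib_left)
  also have "(\<Sum>x\<in>pverts G. 1 * laplacian G g x) = 0"
    unfolding sum_laplacian by simp
  finally have w: "w \<in> mean_zero"
    using g(1) by (simp add: mean_zero_def w_def)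
  have "- (\<Sum>x\<in>pverts G. w x * (laplacian G g x + c * g x)) = 0"
  proof (rule quadratic_nonneg_imp_linear_zero)
    fix t
    have "c * (\<Sum>x\<in>pverts G. (g x + t * w x)\<^sup>2) \<le> energy (\<lambda>x. g x + t * w x)"
      unfolding c_def using min mean_zero_add[OF g(1) w] by blast
    also have "(\<Sum>x\<in>pverts G. (g x + t * w x)\<^sup>2)
        = (\<Sum>x\<in>pverts G. (g x)\<^sup>2) + 2 * t * (\<Sum>x\<in>pverts G. w x * g x) + t\<^sup>2 * (\<Sum>x\<in>pverts G. (w x)\<^sup>2)"
      unfolding sum_distrib_left sum.distrib[symmetric]
      by (intro sum.cong refl) (simp add: power2_eq_square algebra_simps)
    also have "energy (\<lambda>x. g x + t * w x)
        = c - 2 * t * (\<Sum>x\<in>pverts G. w x * laplacian G g x) + t\<^sup>2 * energy w"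
      unfolding c_def by (rule energy_add)
    finally have "2 * t * (- ((\<Sum>x\<in>pverts G. w x * laplacian G g x) + c * (\<Sum>x\<in>pverts G. w x * g x)))
        + (energy w - c * (\<Sum>x\<in>pverts G. (w x)\<^sup>2)) * t\<^sup>2 \<ge> 0"
      unfolding g(2) by (simp add: algebra_simps)
    moreover have "(\<Sum>x\<in>pverts G. w x * laplacian G g x) + c * (\<Sum>x\<in>pverts G. w x * g x)
        = (\<Sum>x\<in>pverts G. w x * (laplacian G g x + c * g x))"
      by (simp add: distrib_left sum.distrib sum_distrib_left mult_ac)
    ultimately show "0 \<le> 2 * t * - (\<Sum>x\<in>pverts G. w x * (laplacian G g x + c * g x))
        + (energy w - c * (\<Sum>x\<in>pverts G. (w x)\<^sup>2)) * t\<^sup>2"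
      by simp
  qed
  then have "(\<Sum>x\<in>pverts G. (w x)\<^sup>2) = 0"
    by (simp add: w_def power2_eq_square)
  then have "\<forall>x\<in>pverts G. (w x)\<^sup>2 = 0"
    using finite_V by (subst (asm) sum_nonneg_eq_0_iff) auto
  then have "laplacian G g x + c * g x = 0" if "x \<in> pverts G" for x
    using that by (simp add: w_def)
  then have "g \<in> lap_eigenspace G c"
    using g(1) by (simp add: lap_eigenspace_def mean_zero_def)
  moreover have "g \<noteq> (\<lambda>_. 0)"
    using g(2) by auto
  ultimately show thesis
    using that g(1) by blast
qed

end

locale connected_regular_graph = regular_graph +
  assumes conn: "\<lbrakk>P x; x \<in> pverts G; y \<in> pverts G; \<And>u v. \<lbrakk>P u; v \<in> nbrs G u\<rbrakk> \<Longrightarrow> P v\<rbrakk> \<Longrightarrow> P y"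
begin

lemma constant_if_edgewise_constant:
  assumes "\<And>u v. v \<in> nbrs G u \<Longrightarrow> f v = f u" "x \<in> pverts G" "y \<in> pverts G"
  shows "f y = f x"
  by (rule conn[of "\<lambda>y. f y = f x"]) (use assms in auto)

lemma harmonic_constant:
  assumes f: "f \<in> lap_eigenspace G 0" and xy: "x \<in> pverts G" "y \<in> pverts G"
  shows "f y = f x"
proof -
  have "energy f = 0"
    unfolding energy_laplacian using eigenfunction_laplacian[OF f] by simp
  then have "(\<Sum>x\<in>pverts G. \<Sum>y\<in>nbrs G x. (f y - f x)\<^sup>2) = 0"
    by (simp add: energy_def)
  then have "\<forall>x\<in>pverts G. (\<Sum>y\<in>nbrs G x. (f y - f x)\<^sup>2) = 0"
    using finite_V by (subst (asm) sum_nonneg_eq_0_iff) (auto intro: sum_nonneg)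
  then have "(f v - f u)\<^sup>2 = 0" if "v \<in> nbrs G u" for u v
    using that in_V(1)[OF that] sum_nonneg_eq_0_iff[OF finite_N, of u "\<lambda>v. (f v - f u)\<^sup>2"] by auto
  then show ?thesis
    using constant_if_edgewise_constant[of f x y] xy by simp
qed

lemma dim_harmonic: "fun_space.dim (lap_eigenspace G 0) \<le> 1"
proof -
  let ?g = "\<lambda>x. if x \<in> pverts G then 1 else 0 :: real"
  have "lap_eigenspace G 0 \<subseteq> fun_space.span {?g}"
  proof
    fix f assume f: "f \<in> lap_eigenspace G 0"
    obtain a where a: "\<And>x. x \<in> pverts G \<Longrightarrow> f x = a"
      using harmonic_constant[OF f] by metis
    have "f = (\<lambda>x. a * ?g x)"
      using a f by (auto simp: lap_eigenspace_def fun_eq_iff)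
    then show "f \<in> fun_space.span {?g}"
      using fun_space.span_scale[OF fun_space.span_base, of ?g "{?g}" a] by simp
  qed
  then show ?thesis
    using fun_space.dim_le_card[of _ "{?g}"] by fastforce
qed

lemma nonzero_eigenvalue:
  assumes ab: "a \<in> pverts G" "b \<in> pverts G" "a \<noteq> b"
  obtains c where "c \<in> lap_eigenvalues G" "c \<noteq> 0"
proof -
  obtain g c where g: "g \<in> lap_eigenspace G c" "g \<in> mean_zero" "g \<noteq> (\<lambda>_. 0)"
    using nonconstant_eigenfunction[OF ab] by blast
  have "c \<noteq> 0"
  proof
    assume "c = 0"
    then have const: "g x = g a" if "x \<in> pverts G" for x
      using harmonic_constant[of g a x] g(1) ab(1) that by blast
    then have "(\<Sum>x\<in>pverts G. g x) = card (pverts G) * g a"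
      by simp
    then have "g a = 0"
      using g(2) ab(1) finite_V by (auto simp: mean_zero_def)
    then have "g x = 0" for x
      using const g(2) by (cases "x \<in> pverts G") (auto simp: mean_zero_def)
    with g(3) show False by blast
  qed
  with g show thesis
    using that by (auto simp: lap_eigenvalues_def)
qed

end

section \<open>Curvature and spectrum of the quotient\<close>

context collapsed_structure
begin

lemma nbrs_quotient:
  assumes "x \<in> pverts G"
  shows "nbrs (vis_quotient G) (fibre x) = fibre ` {y \<in> nbrs G x. f y = f x}"
  unfolding nbrs_def[of "vis_quotient G"] using quotient_arc_iff[OF assms] by blast

lemma inj_on_fibre_collapsed: "inj_on fibre {y \<in> nbrs G x. f y = f x}"
proof (rule inj_onI)
  fix y z assume y: "y \<in> {y \<in> nbrs G x. f y = f x}" and z: "z \<in> {y \<in> nbrs G x. f y = f x}"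
    and eq: "fibre y = fibre z"
  have "bottom y = bottom z"
    using eq fibre_eq_iff in_V(2)[of y x] y by blast
  then show "y = z"
    using collapsed_unique[of y x z] y z by blast
qed

lemma fibre_visible: "y \<in> nbrs G x \<Longrightarrow> f y \<noteq> f x \<Longrightarrow> fibre y = fibre x"
  using bottom_visible[of y x] by (simp add: fibre_def visible_def)

text \<open>
  Visible neighbours stay in the component of \<open>x\<close>, and the collapsed ones represent each adjacent
  component exactly once.
\<close>

lemma sum_nbrs_quotient:
  assumes x: "x \<in> pverts G" and F: "F (fibre x) = 0"
  shows "(\<Sum>y\<in>nbrs G x. F (fibre y)) = (\<Sum>B\<in>nbrs (vis_quotient G) (fibre x). F B)"
proof -
  have "(\<Sum>y\<in>nbrs G x. F (fibre y)) = (\<Sum>y\<in>{y \<in> nbrs G x. f y = f x}. F (fibre y))"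
  proof (rule sum.mono_neutral_right)
    show "\<forall>y\<in>nbrs G x - {y \<in> nbrs G x. f y = f x}. F (fibre y) = 0"
    proof
      fix y assume "y \<in> nbrs G x - {y \<in> nbrs G x. f y = f x}"
      then have "fibre y = fibre x" by (intro fibre_visible) auto
      with F show "F (fibre y) = 0" by simp
    qed
  qed auto
  also have "\<dots> = (\<Sum>B\<in>nbrs (vis_quotient G) (fibre x). F B)"
    unfolding nbrs_quotient[OF x] sum.reindex[OF inj_on_fibre_collapsed] by simp
  finally show ?thesis .
qed

lemma regular_quotient: "graph_regular (vis_quotient G) (d - vis_degree)"
  unfolding graph_regular_def out_degree_nbrs
proof
  fix A assume "A \<in> pverts (vis_quotient G)"
  then obtain x where x: "x \<in> pverts G" "A = fibre x"
    by (auto simp: pverts_quotient)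
  have "{y \<in> nbrs G x. f y = f x} = nbrs G x - visible x"
    by (auto simp: visible_def)
  moreover have "visible x \<subseteq> nbrs G x" "finite (visible x)"
    by (auto simp: visible_def)
  ultimately have "card {y \<in> nbrs G x. f y = f x} = d - vis_degree"
    using card_Diff_subset[of "visible x" "nbrs G x"] card_N[OF x(1)] card_visible_r[OF x(1)] by simp
  then show "card (nbrs (vis_quotient G) A) = d - vis_degree"
    unfolding x(2) nbrs_quotient[OF x(1)] card_image[OF inj_on_fibre_collapsed] .
qed

lemma laplacian_lift:
  assumes x: "x \<in> pverts G" and h: "\<And>y. y \<in> pverts G \<Longrightarrow> h y = g (fibre y)"
  shows "laplacian G h x = laplacian (vis_quotient G) g (fibre x)"
proof -
  have "laplacian G h x = (\<Sum>y\<in>nbrs G x. g (fibre y) - g (fibre x))"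
    unfolding laplacian_nbrs using h in_V x by (intro sum.cong) auto
  then show ?thesis
    using sum_nbrs_quotient[OF x, of "\<lambda>B. g B - g (fibre x)"] by (simp add: laplacian_nbrs)
qed

lemma bakry_gamma_lift:
  assumes x: "x \<in> pverts G" and h: "\<And>y. y \<in> pverts G \<Longrightarrow> h y = g (fibre y)"
    and h': "\<And>y. y \<in> pverts G \<Longrightarrow> h' y = g' (fibre y)"
  shows "bakry_gamma G h h' x = bakry_gamma (vis_quotient G) g g' (fibre x)"
proof -
  have "(\<Sum>y\<in>nbrs G x. (h y - h x) * (h' y - h' x))
      = (\<Sum>y\<in>nbrs G x. (g (fibre y) - g (fibre x)) * (g' (fibre y) - g' (fibre x)))"
    using h h' in_V x by (intro sum.cong) auto
  then show ?thesis
    using sum_nbrs_quotient[OF x, of "\<lambda>B. (g B - g (fibre x)) * (g' B - g' (fibre x))"]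
    by (simp add: bakry_gamma_nbrs)
qed

lemma CD_inf_quotient:
  assumes "CD_inf G K"
  shows "CD_inf (vis_quotient G) K"
  unfolding CD_inf_def
proof (intro allI ballI)
  fix g :: "'a set \<Rightarrow> real" and A assume "A \<in> pverts (vis_quotient G)"
  then obtain x where x: "x \<in> pverts G" "A = fibre x"
    by (auto simp: pverts_quotient)
  let ?h = "\<lambda>y. g (fibre y)"
  have G: "bakry_gamma G ?h ?h y = bakry_gamma (vis_quotient G) g g (fibre y)"
    and L: "laplacian G ?h y = laplacian (vis_quotient G) g (fibre y)"
    if "y \<in> pverts G" for y
    using bakry_gamma_lift[OF that] laplacian_lift[OF that] by auto
  have "laplacian G (bakry_gamma G ?h ?h) x
      = laplacian (vis_quotient G) (bakry_gamma (vis_quotient G) g g) (fibre x)"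
    by (rule laplacian_lift[OF x(1)]) (rule G)
  moreover have "bakry_gamma G ?h (laplacian G ?h) x
      = bakry_gamma (vis_quotient G) g (laplacian (vis_quotient G) g) (fibre x)"
    by (rule bakry_gamma_lift[OF x(1)]) (simp_all add: L)
  ultimately have "bakry_gamma2 G ?h ?h x = bakry_gamma2 (vis_quotient G) g g (fibre x)"
    by (simp add: bakry_gamma2_def)
  moreover have "K * bakry_gamma G ?h ?h x \<le> bakry_gamma2 G ?h ?h x"
    using assms x(1) by (simp add: CD_inf_def)
  ultimately show "K * bakry_gamma (vis_quotient G) g g A \<le> bakry_gamma2 (vis_quotient G) g g A"
    using G[OF x(1)] x(2) by simp
qed

lemma connected_quotient:
  assumes "pverts G \<noteq> {}"
  shows "graph_connected (vis_quotient G)"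
proof -
  have "(fibre x, fibre y) \<in> (parcs (vis_quotient G))\<^sup>*" if "x \<in> pverts G" "y \<in> pverts G" for x y
  proof (rule connected[of "\<lambda>y. (fibre x, fibre y) \<in> (parcs (vis_quotient G))\<^sup>*" x y])
    fix u v assume u: "(fibre x, fibre u) \<in> (parcs (vis_quotient G))\<^sup>*" and v: "v \<in> nbrs G u"
    show "(fibre x, fibre v) \<in> (parcs (vis_quotient G))\<^sup>*"
    proof (cases "f v = f u")
      case True
      then have "(fibre u, fibre v) \<in> parcs (vis_quotient G)"
        using v quotient_arc_iff[OF in_V(1)[OF v]] by blast
      with u show ?thesis by (rule rtrancl_into_rtrancl)
    next
      case False
      then show ?thesis
        using u fibre_visible[OF v] by simp
    qed
  qed (use that in auto)
  then show ?thesis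
    using assms by (auto simp: graph_connected_iff[OF pair_graph_vis_quotient[OF graph]] pverts_quotient)
qed

lemma lift_eigenfunction:
  assumes g: "g \<in> lap_eigenspace (vis_quotient G) c"
  shows "(\<lambda>x. if x \<in> pverts G then g (fibre x) else 0) \<in> lap_eigenspace G c" (is "?h \<in> _")
proof -
  have "laplacian G ?h x = laplacian (vis_quotient G) g (fibre x)" if "x \<in> pverts G" for x
    using that by (intro laplacian_lift) auto
  then show ?thesis
    using g by (auto simp: lap_eigenspace_def pverts_quotient)
qed

lemma lift_nonzero:
  assumes g: "g \<in> lap_eigenspace (vis_quotient G) c" "g \<noteq> (\<lambda>_. 0)"
  obtains x where "x \<in> pverts G" "g (fibre x) \<noteq> 0"
proof -
  obtain A where "g A \<noteq> 0" using g(2) by auto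
  moreover from this have "A \<in> pverts (vis_quotient G)"
    using g(1) by (auto simp: lap_eigenspace_def)
  ultimately show thesis
    using that by (auto simp: pverts_quotient)
qed

lemma eigenvalues_quotient_subset: "lap_eigenvalues (vis_quotient G) \<subseteq> lap_eigenvalues G"
proof
  fix c assume "c \<in> lap_eigenvalues (vis_quotient G)"
  then obtain g where g: "g \<in> lap_eigenspace (vis_quotient G) c" "g \<noteq> (\<lambda>_. 0)"
    by (auto simp: lap_eigenvalues_def)
  obtain x where "x \<in> pverts G" "g (fibre x) \<noteq> 0"
    using lift_nonzero[OF g] by blast
  then have "(\<lambda>x. if x \<in> pverts G then g (fibre x) else 0) \<noteq> (\<lambda>_. 0)"
    by (auto simp: fun_eq_iff)
  then show "c \<in> lap_eigenvalues G"
    using lift_eigenfunction[OF g(1)] unfolding lap_eigenvalues_def by blast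
qed

lemma edgewise_constant_eigenfunction_zero:
  assumes h: "h \<in> lap_eigenspace G c" and c: "c \<noteq> 0" and edge: "\<And>u v. v \<in> nbrs G u \<Longrightarrow> h v = h u"
    and x: "x \<in> pverts G"
  shows "h x = 0"
proof -
  have "laplacian G h x = 0"
    unfolding laplacian_nbrs using edge by (intro sum.neutral) auto
  then show ?thesis
    using h x c by (auto simp: lap_eigenspace_def)
qed

text \<open>
  The lift of an eigenfunction belongs to the eigenspace that defines the collapsed edges, so it is
  constant along them. It is constant along visible edges as well.
\<close>

lemma two_not_eigenvalue_quotient: "2 \<notin> lap_eigenvalues (vis_quotient G)"
proof
  assume "2 \<in> lap_eigenvalues (vis_quotient G)"
  then obtain g where g: "g \<in> lap_eigenspace (vis_quotient G) 2" "g \<noteq> (\<lambda>_. 0)"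
    by (auto simp: lap_eigenvalues_def)
  let ?h = "\<lambda>x. if x \<in> pverts G then g (fibre x) else 0"
  have h: "?h \<in> lap_eigenspace G 2"
    by (rule lift_eigenfunction[OF g(1)])
  have "?h v = ?h u" if uv: "v \<in> nbrs G u" for u v
  proof (cases "f v = f u")
    case True
    then have "(u, v) \<in> collapsed_arcs G"
      using uv by (simp add: collapsed_arcs_eq nbrs_def)
    then have "\<forall>h\<in>lap_eigenspace G 2. h u = h v"
      by (simp add: collapsed_arcs_def)
    from bspec[OF this h] show ?thesis by (rule sym)
  next
    case False
    then show ?thesis
      using fibre_visible[OF uv] in_V[OF uv] by simp
  qed
  note const = this
  obtain x where x: "x \<in> pverts G" "g (fibre x) \<noteq> 0"
    by (rule lift_nonzero[OF g])
  have "?h x = 0"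
    by (rule edgewise_constant_eigenfunction_zero[OF h _ const x(1)]) simp
  with x show False by simp
qed

text \<open>
  Without visible edges, all functions in the eigenspace are constant along edges, thus zero.
\<close>

lemma degree_vis_pos:
  assumes "2 \<in> lap_eigenvalues G"
  shows "1 \<le> vis_degree"
proof (rule ccontr)
  assume "\<not> 1 \<le> vis_degree"
  then have vis_degree: "vis_degree = 0" by simp
  obtain h where h: "h \<in> lap_eigenspace G 2" "h \<noteq> (\<lambda>_. 0)"
    using assms by (auto simp: lap_eigenvalues_def)
  have "h v = h u" if uv: "v \<in> nbrs G u" for u v
  proof -
    have "visible u = {}"
      using card_visible_r[OF in_V(1)[OF uv]] vis_degree by (simp add: visible_def)
    then have "(u, v) \<in> collapsed_arcs G"
      using uv by (auto simp: visible_def collapsed_arcs_eq nbrs_def)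
    then show ?thesis
      using h(1) by (auto simp: collapsed_arcs_def)
  qed
  note const = this
  have "h x = 0" if "x \<in> pverts G" for x
    by (rule edgewise_constant_eigenfunction_zero[OF h(1) _ const that]) simp
  then have "h = (\<lambda>_. 0)"
    using h(1) by (auto simp: lap_eigenspace_def)
  with h(2) show False by blast
qed

end

theorem theorem5p4:
  fixes G :: "'a pair_pre_digraph" and d :: nat
  assumes "pair_graph G"
    and "graph_connected G"
    and "graph_regular G d"
    and "Lichnerowicz_sharp G"
  shows "(\<exists>r\<ge>1. graph_regular (vis_graph G) r \<and>
            (\<exists>\<sigma>. bundle_twist (vis_quotient G) (hypercube r) \<sigma> \<and>
                 digraph_iso (with_proj G)
                   (with_proj (graph_bundle (vis_quotient G) (hypercube r) \<sigma>)) \<and>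
                 (\<exists>s. bundle_section (vis_quotient G) (hypercube r) \<sigma> s))) \<and>
         (collapsed_arcs G \<noteq> {} \<longrightarrow>
            graph_connected (vis_quotient G) \<and>
            (\<exists>d'. graph_regular (vis_quotient G) d') \<and>
            CD_inf (vis_quotient G) 2 \<and>
            1 < length (lap_spectrum (vis_quotient G)) \<and> lap_spectrum (vis_quotient G) ! 1 > 2)"
proof -
  have sharp: "CD_inf G 2" "1 < length (lap_spectrum G)" "lap_spectrum G ! 1 = 2"
    using assms(4) by (auto simp: Lichnerowicz_sharp_def)
  have nonempty: "pverts G \<noteq> {}"
    using assms(2) graph_connected_iff[OF assms(1)] by blast
  obtain f where f: "f \<in> lap_eigenspace G 2" and collapsed: "collapsed_arcs G = {(x, y) \<in> parcs G. f x = f y}"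
    by (rule generic_eigenfunction[OF assms(1)])
  interpret S: square_function "pverts G" "nbrs G" d f
    by (rule square_function_eigenfunction[OF assms(1-3) sharp(1) f])
  interpret C: collapsed_structure G d f
    by (intro collapsed_structure.intro collapsed_structure_axioms.intro
        S.square_function_axioms assms(1) collapsed)
  interpret G: regular_graph G d
    by unfold_locales
  have two: "2 \<in> lap_eigenvalues G"
    using sharp(2,3) nth_mem[of 1 "lap_spectrum G"] by (simp add: G.set_lap_spectrum)
  have gap: "2 \<le> c" if "c \<in> lap_eigenvalues G" "c \<noteq> 0" for c
    using G.eigenvalues_ge_second[OF nonempty sharp(2) _ that] sharp(3) by simp
  have quotient: "1 < length (lap_spectrum (vis_quotient G)) \<and> lap_spectrum (vis_quotient G) ! 1 > 2"
    if "collapsed_arcs G \<noteq> {}"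
  proof -
    have Q: "pair_graph (vis_quotient G)"
      by (rule pair_graph_vis_quotient[OF assms(1)])
    interpret Q: regular_nbrs "pverts (vis_quotient G)" "nbrs (vis_quotient G)" "d - C.vis_degree"
      by (rule regular_nbrs_graph[OF Q C.regular_quotient])
    interpret Q: connected_regular_graph "vis_quotient G" "d - C.vis_degree"
    proof
      fix P A B
      assume "P A" "A \<in> pverts (vis_quotient G)" "B \<in> pverts (vis_quotient G)"
        and "\<And>C D. \<lbrakk>P C; D \<in> nbrs (vis_quotient G) C\<rbrakk> \<Longrightarrow> P D"
      then show "P B"
        by (intro connected_induct[OF Q C.connected_quotient[OF nonempty], of A B P])
    qed
    obtain x y where xy: "(x, y) \<in> collapsed_arcs G"
      using \<open>collapsed_arcs G \<noteq> {}\<close> by auto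
    then have yx: "y \<in> nbrs G x" "f y = f x"
      by (auto simp: collapsed nbrs_def)
    then have "(C.fibre x, C.fibre y) \<in> parcs (vis_quotient G)"
      using C.quotient_arc_iff[OF S.in_V(1)[OF yx(1)], of "C.fibre y"] by blast
    then have q: "C.fibre y \<in> nbrs (vis_quotient G) (C.fibre x)"
      by (simp add: nbrs_def)
    have "C.fibre x \<noteq> C.fibre y"
    proof
      assume "C.fibre x = C.fibre y"
      with q Q.N_irrefl[of "C.fibre x"] show False by simp
    qed
    then obtain c where c: "c \<in> lap_eigenvalues (vis_quotient G)" "c \<noteq> 0"
      by (rule Q.nonzero_eigenvalue[OF Q.in_V[OF q]])
    show ?thesis
    proof (rule Q.second_eigenvalue_greater[OF Q.dim_harmonic c])
      show "pverts (vis_quotient G) \<noteq> {}"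
        using nonempty by (simp add: C.pverts_quotient)
      fix a assume a: "a \<in> lap_eigenvalues (vis_quotient G)" "a \<noteq> 0"
      then have "2 \<le> a"
        using gap C.eigenvalues_quotient_subset by blast
      moreover have "a \<noteq> 2"
        using a(1) C.two_not_eigenvalue_quotient by blast
      ultimately show "2 < a" by simp
    qed simp
  qed
  show ?thesis
    using C.degree_vis_pos[OF two] C.regular_vis C.bundle_twist_twist C.bundle_iso
      C.bundle_section_zero C.connected_quotient[OF nonempty] C.regular_quotient
      C.CD_inf_quotient[OF sharp(1)] quotient by blast
qed

end
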